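(* Let $(R,\mathfrak m)$ be a noetherian local ring, $i\geq1$ and $x_1,\dots,x_i\in R$. Then $$\mathrm{Ass}_R\big(D(H^i_{(x_1,\dots,x_i)R}(R))\big)\subseteq\{\mathfrak p\in\mathrm{Spec}(R)\mid H^i_{(x_1,\dots,x_i)R}(R/\mathfrak p)\neq0\}.$$ If moreover $R$ is equicharacteristic (contains a field), then $$\{\mathfrak p\in\mathrm{Spec}(R)\mid \text{the images of } x_1,\dots,x_i \text{ form part of a system of parameters of } R/\mathfrak p\}\subseteq \mathrm{Ass}_R\big(D(H^i_{(x_1,\dots,x_i)R}(R))\big).$$
   Context: $D(M)=\mathrm{Hom}_R(M,E_R(R/\mathfrak m))$ is the Matlis dual. For an arbitrary (not necessarily finitely generated) $R$-module $N$, $\mathrm{Ass}_R(N)$ is the set of prime ideals of the form $\mathrm{Ann}_R(n)$ with $n\in N$. *)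

theory Defs
  imports Complex_Main
begin

definition is_ideal :: "'a::comm_ring_1 set \<Rightarrow> bool" where
  "is_ideal I \<longleftrightarrow> 0 \<in> I \<and> (\<forall>a\<in>I. \<forall>b\<in>I. a + b \<in> I) \<and> (\<forall>r a. a \<in> I \<longrightarrow> r * a \<in> I)"

definition prime_ideal :: "'a::comm_ring_1 set \<Rightarrow> bool" where
  "prime_ideal P \<longleftrightarrow> is_ideal P \<and> (1::'a) \<notin> P \<and> (\<forall>a b. a * b \<in> P \<longrightarrow> a \<in> P \<or> b \<in> P)"

definition maximal_ideal :: "'a::comm_ring_1 set \<Rightarrow> bool" where
  "maximal_ideal M \<longleftrightarrow> is_ideal M \<and> (1::'a) \<notin> M \<and>
     (\<forall>J. is_ideal J \<and> M \<subseteq> J \<longrightarrow> J = M \<or> J = UNIV)"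

definition ideal_gen :: "'a::comm_ring_1 list \<Rightarrow> 'a set" where
  "ideal_gen ys = {r. \<exists>c. r = (\<Sum>j<length ys. c j * ys ! j)}"

definition noetherian_ring :: "'a::comm_ring_1 itself \<Rightarrow> bool" where
  "noetherian_ring _ \<longleftrightarrow> (\<forall>I::'a set. is_ideal I \<longrightarrow> (\<exists>ys. I = ideal_gen ys))"

definition local_ring :: "'a::comm_ring_1 set \<Rightarrow> bool" where
  "local_ring m \<longleftrightarrow> maximal_ideal m \<and> (\<forall>M. maximal_ideal M \<longrightarrow> M = m)"

definition contains_field :: "'a::comm_ring_1 itself \<Rightarrow> bool" where
  "contains_field _ \<longleftrightarrow> (\<exists>K::'a set. 1 \<in> K \<and> (\<forall>a\<in>K. \<forall>b\<in>K. a - b \<in> K \<and> a * b \<in> K) \<and>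
      (\<forall>a\<in>K. a \<noteq> 0 \<longrightarrow> (\<exists>b\<in>K. a * b = 1)))"

definition radical :: "'a::comm_ring_1 set \<Rightarrow> 'a set" where
  "radical I = {r. \<exists>n. r ^ n \<in> I}"

text \<open>A chain of primes \<open>p \<subseteq> q0 \<subset> q1 \<subset> ... \<subset> qn\<close>, i.e. a chain of length n in Spec(R/p).\<close>
definition prime_chain_above :: "'a::comm_ring_1 set \<Rightarrow> nat \<Rightarrow> bool" where
  "prime_chain_above p n \<longleftrightarrow> (\<exists>q :: nat \<Rightarrow> 'a set. p \<subseteq> q 0 \<and> (\<forall>k\<le>n. prime_ideal (q k)) \<and>
      (\<forall>k<n. q k \<subset> q (Suc k)))"

definition dim_quot_eq :: "'a::comm_ring_1 set \<Rightarrow> nat \<Rightarrow> bool" where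
  "dim_quot_eq p d \<longleftrightarrow> prime_chain_above p d \<and> \<not> prime_chain_above p (Suc d)"

text \<open>The images of xs in the local ring (R/p, m/p) form part of a system of parameters:
  they can be extended by elements ys of m so that xs @ ys has length dim(R/p),
  all lie in m, and generate an (m/p)-primary ideal of R/p, i.e.
  rad(p + (xs @ ys)R) = m.\<close>
definition part_of_sop :: "'a::comm_ring_1 set \<Rightarrow> 'a set \<Rightarrow> 'a list \<Rightarrow> bool" where
  "part_of_sop m p xs \<longleftrightarrow> (\<exists>ys. dim_quot_eq p (length xs + length ys) \<and> set (xs @ ys) \<subseteq> m \<and>
      radical {a + b | a b. a \<in> p \<and> b \<in> ideal_gen (xs @ ys)} = m)"

text \<open>For the ideal I = (x_1,...,x_i)R and an ideal J, the module H^i_I(R/J) is the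
  cokernel of the last Cech map  \<Oplus>_j (R/J)_{y_j} \<rightarrow> (R/J)_y, where y = x_1...x_i and
  y_j = \<Prod>_{k\<noteq>j} x_k.  An element of (R/J)_y is represented by a pair (r,n) standing for r/y^n.
  \<open>cech_top_zero xs J r n\<close> says that the class of r/y^n lies in the image of the Cech map,
  i.e. it is zero in H^i_I(R/J): there are t, k, a_j with
  y^k (y^t r - y^n \<Sum>_j a_j x_j^t) \<in> J  (the image of a_j/y_j^t is a_j x_j^t / y^t).\<close>
definition cech_top_zero :: "'a::comm_ring_1 list \<Rightarrow> 'a set \<Rightarrow> 'a \<Rightarrow> nat \<Rightarrow> bool" where
  "cech_top_zero xs J r n \<longleftrightarrow> (let y = prod_list xs in
     \<exists>t k a. y ^ k * (y ^ t * r - y ^ n * (\<Sum>j<length xs. a j * (xs ! j) ^ t)) \<in> J)"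

definition top_lc_nonzero :: "'a::comm_ring_1 list \<Rightarrow> 'a set \<Rightarrow> bool" where
  "top_lc_nonzero xs J \<longleftrightarrow> (\<exists>r n. \<not> cech_top_zero xs J r n)"

definition lc_eq :: "'a::comm_ring_1 list \<Rightarrow> 'a \<Rightarrow> nat \<Rightarrow> 'a \<Rightarrow> nat \<Rightarrow> bool" where
  "lc_eq xs r n s m \<longleftrightarrow> (let y = prod_list xs in cech_top_zero xs {0} (r * y ^ m - s * y ^ n) (n + m))"

text \<open>An R-linear map H^i_{(xs)R}(R) \<rightarrow> E, given on representatives (r,n) of r/y^n
  (well-defined on classes, additive, R-linear).\<close>
definition lc_hom :: "('a::comm_ring_1 \<Rightarrow> 'm::ab_group_add \<Rightarrow> 'm) \<Rightarrow> 'a list \<Rightarrow> ('a \<Rightarrow> nat \<Rightarrow> 'm) \<Rightarrow> bool" where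
  "lc_hom scale xs f \<longleftrightarrow> (let y = prod_list xs in
     (\<forall>r n s m. lc_eq xs r n s m \<longrightarrow> f r n = f s m) \<and>
     (\<forall>r n s m. f r n + f s m = f (r * y ^ m + s * y ^ n) (n + m)) \<and>
     (\<forall>a r n. f (a * r) n = scale a (f r n)))"

definition baer_injective :: "('a::comm_ring_1 \<Rightarrow> 'm::ab_group_add \<Rightarrow> 'm) \<Rightarrow> bool" where
  "baer_injective scale \<longleftrightarrow> (\<forall>I g. is_ideal I \<and>
       (\<forall>a\<in>I. \<forall>b\<in>I. g (a + b) = g a + g b) \<and> (\<forall>r. \<forall>a\<in>I. g (r * a) = scale r (g a))
     \<longrightarrow> (\<exists>v. \<forall>a\<in>I. g a = scale a v))"

text \<open>E is an injective hull of R/m: E is an injective module containing an element e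
  with Ann(e) = m (so Re \<cong> R/m), and Re \<subseteq> E is essential.\<close>
definition injective_hull_residue :: "('a::comm_ring_1 \<Rightarrow> 'm::ab_group_add \<Rightarrow> 'm) \<Rightarrow> 'a set \<Rightarrow> bool" where
  "injective_hull_residue scale m \<longleftrightarrow> module scale \<and> baer_injective scale \<and>
     (\<exists>e. {a. scale a e = 0} = m \<and>
        (\<forall>S. module.subspace scale S \<and> S \<noteq> {0} \<longrightarrow> S \<inter> module.span scale {e} \<noteq> {0}))"

definition ass_matlis_dual_lc :: "('a::comm_ring_1 \<Rightarrow> 'm::ab_group_add \<Rightarrow> 'm) \<Rightarrow> 'a list \<Rightarrow> 'a set set" where
  "ass_matlis_dual_lc scale xs = {p. prime_ideal p \<and>
      (\<exists>f. lc_hom scale xs f \<and> p = {a. \<forall>r n. scale a (f r n) = 0})}"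

end

theory Submission
  imports Defs "HOL-Library.Function_Algebras"
begin

text \<open>
  The first inclusion holds because \<open>H\<^sup>i(R/p) = H\<^sup>i(R)/p H\<^sup>i(R)\<close>. For the second one we construct homomorphisms
  from \<open>H\<^sup>i\<^bsub>xs\<^esub>(R/p)\<close> to the hull with annihilator \<open>p\<close>, by induction on \<open>d = dim R/p\<close>.

  If \<open>i < d\<close>, there are infinitely many primes \<open>q k\<close> of height one over \<open>p\<close> such that \<open>xs\<close> is part of a
  system of parameters of \<open>R/q k\<close>. A suitable infinite sum \<open>\<Sum>c k \<cdot> g k\<close>, where \<open>g k\<close> has annihilator \<open>q k\<close>,
  has annihilator \<open>\<Inter> q k = p\<close>. If \<open>i = d\<close>, every nonzero homomorphism has a multiple with
  prime annihilator, and a prime occurring in this way has coheight at least \<open>d\<close>, so that it equals \<open>p\<close>.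
  It remains to show \<open>H\<^sup>d(R/p) \<noteq> 0\<close> (Grothendieck nonvanishing). Here the induction hypothesis
  provides infinitely many homomorphisms on \<open>H\<^sup>d\<^sup>-\<^sup>1\<close> with different prime annihilators; if \<open>H\<^sup>d(R/p)\<close>
  vanished, they would contradict the fact that \<open>H\<^sup>d\<^sup>-\<^sup>1\<^bsub>m\<^esub>(R/p)\<close> is Artinian.
\<close>

text \<open>A homomorphism from the top local cohomology of R/p to the hull E is determined by the
  images e n of the classes 1/y^n, where y is the product of \<open>xs\<close>. So the dual is the
  inverse limit, under multiplication by y, of the submodules of E killed by p and by the n-th
  powers of \<open>xs\<close>, and the second inclusion becomes a question about such sequences. The
  infinite sum makes sense because E is m-torsion: a power of an element of m outside q k kills any
  prescribed initial segment of g k and leaves its annihilator unchanged. Nonzero elements of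
  inverse limits come from the descending chain condition in E. The chain condition for H^j_m(R/p)
  is proved on limits of Koszul cohomology by induction on j, after the m-torsion of the
  coefficients has been divided out so that a regular element exists. Quotients and localisations
  are never formed: an ideal of R/J is an ideal containing J, an ideal of a localisation is an ideal
  closed under cancelling, and an Artinian quotient is a chain condition between two
  submodules.\<close>

lemma is_idealD:
  assumes "is_ideal I"
  shows "0 \<in> I" "\<And>a b. a \<in> I \<Longrightarrow> b \<in> I \<Longrightarrow> a + b \<in> I" "\<And>r a. a \<in> I \<Longrightarrow> r * a \<in> I"
    "\<And>r a. a \<in> I \<Longrightarrow> a * r \<in> I"
    "\<And>a. a \<in> I \<Longrightarrow> - a \<in> I" "\<And>a b. a \<in> I \<Longrightarrow> b \<in> I \<Longrightarrow> a - b \<in> I"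
proof -
  show *: "0 \<in> I" "\<And>a b. a \<in> I \<Longrightarrow> b \<in> I \<Longrightarrow> a + b \<in> I" "\<And>r a. a \<in> I \<Longrightarrow> r * a \<in> I"
    using assms unfolding is_ideal_def by auto
  show "\<And>r a. a \<in> I \<Longrightarrow> a * r \<in> I"
    by (subst mult.commute) (rule *(3))
  show m: "\<And>a. a \<in> I \<Longrightarrow> - a \<in> I"
    using *(3)[of _ "-1"] by simp
  show "\<And>a b. a \<in> I \<Longrightarrow> b \<in> I \<Longrightarrow> a - b \<in> I"
    using *(2) m by (metis diff_conv_add_uminus)
qed

lemma ideal_sum: "is_ideal I \<Longrightarrow> (\<And>j. j \<in> A \<Longrightarrow> f j \<in> I) \<Longrightarrow> sum f A \<in> I"
  by (induction A rule: infinite_finite_induct) (auto simp: is_idealD)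

lemma ideal_diff_iff: "is_ideal I \<Longrightarrow> a - b \<in> I \<Longrightarrow> a \<in> I \<longleftrightarrow> b \<in> I"
  using is_idealD(2)[of I "a - b" b] is_idealD(6)[of I a "a - b"] by auto

lemma prime_idealD:
  assumes "prime_ideal P"
  shows "is_ideal P" "1 \<notin> P" "\<And>a b. a * b \<in> P \<Longrightarrow> a \<in> P \<or> b \<in> P"
  using assms unfolding prime_ideal_def by auto

lemma prime_ideal_power: "prime_ideal P \<Longrightarrow> a ^ n \<in> P \<Longrightarrow> a \<in> P"
  by (induction n) (auto dest: prime_idealD)

lemma is_ideal_UNIV [simp]: "is_ideal UNIV"
  by (simp add: is_ideal_def)

lemma ideal_one: "is_ideal I \<Longrightarrow> 1 \<in> I \<Longrightarrow> I = UNIV"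
  using is_idealD(3)[of I 1] by fastforce

section \<open>Colon ideals and ideals with adjoined generators\<close>

definition colon :: "'a::comm_ring_1 set \<Rightarrow> 'a \<Rightarrow> 'a set" where
  "colon I a = {r. r * a \<in> I}"

lemma colon_ideal: "is_ideal I \<Longrightarrow> is_ideal (colon I a)"
  unfolding is_ideal_def colon_def by (auto simp: distrib_right mult.assoc)

text \<open>The ideal J + (xs), which stands for the ideal generated by \<open>xs\<close> in R/J.
  The recursion allows induction on the list, one generator at a time.\<close>

fun adjoin :: "'a::comm_ring_1 set \<Rightarrow> 'a list \<Rightarrow> 'a set" where
  "adjoin J [] = J"
| "adjoin J (x # xs) = {a + r * x | a r. a \<in> adjoin J xs}"

lemma adjoin_ideal: "is_ideal J \<Longrightarrow> is_ideal (adjoin J xs)"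
proof (induction xs)
  case (Cons x xs)
  let ?I = "adjoin J xs"
  have I: "is_ideal ?I" using Cons by simp
  show ?case unfolding is_ideal_def adjoin.simps
  proof (intro conjI ballI allI impI)
    show "0 \<in> {a + r * x |a r. a \<in> ?I}"
      using is_idealD(1)[OF I] by (force intro: exI[of _ 0])
  next
    fix a b assume "a \<in> {a + r * x |a r. a \<in> ?I}" "b \<in> {a + r * x |a r. a \<in> ?I}"
    then obtain a' r b' s where "a = a' + r * x" "b = b' + s * x" "a' \<in> ?I" "b' \<in> ?I" by auto
    then have "a + b = (a' + b') + (r + s) * x" "a' + b' \<in> ?I"
      using is_idealD(2)[OF I] by (auto simp: algebra_simps)
    then show "a + b \<in> {a + r * x |a r. a \<in> ?I}" by blast
  next
    fix t a assume "a \<in> {a + r * x |a r. a \<in> ?I}"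
    then obtain a' r where "a = a' + r * x" "a' \<in> ?I" by auto
    then have "t * a = t * a' + (t * r) * x" "t * a' \<in> ?I"
      using is_idealD(3)[OF I] by (auto simp: algebra_simps)
    then show "t * a \<in> {a + r * x |a r. a \<in> ?I}" by blast
  qed
qed simp

lemma adjoin_Cons_sup: "adjoin J xs \<subseteq> adjoin J (x # xs)"
proof
  fix a assume "a \<in> adjoin J xs"
  then have "a = a + 0 * x \<and> a \<in> adjoin J xs" by simp
  then show "a \<in> adjoin J (x # xs)" unfolding adjoin.simps by blast
qed

lemma adjoin_sup: "J \<subseteq> adjoin J xs"
  by (induction xs) (use adjoin_Cons_sup in fastforce)+

lemma adjoin_set: "is_ideal J \<Longrightarrow> set xs \<subseteq> adjoin J xs"
proof (induction xs)
  case (Cons x xs)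
  have "0 \<in> adjoin J xs" using Cons.prems by (simp add: adjoin_ideal is_idealD)
  then have "x = 0 + 1 * x \<and> 0 \<in> adjoin J xs" by simp
  then have "x \<in> adjoin J (x # xs)" unfolding adjoin.simps by blast
  moreover have "set xs \<subseteq> adjoin J (x # xs)"
    using Cons.IH[OF Cons.prems] adjoin_Cons_sup by blast
  ultimately show ?case by simp
qed simp

lemma adjoin_least:
  "is_ideal K \<Longrightarrow> J \<subseteq> K \<Longrightarrow> set xs \<subseteq> K \<Longrightarrow> adjoin J xs \<subseteq> K"
proof (induction xs)
  case (Cons x xs)
  then have "adjoin J xs \<subseteq> K" "x \<in> K" by auto
  then show ?case using is_idealD[OF Cons.prems(1)] by auto
qed simp

declare adjoin.simps(2) [simp del]

section \<open>Noetherian rings\<close>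

locale noetherian =
  fixes ty :: "'a::comm_ring_1 itself"
  assumes noeth: "noetherian_ring TYPE('a)"
begin

text \<open>The union of a chain of ideals is finitely generated, and its generators all lie in one
  member of the chain. So the union belongs to the chain, and Zorn's lemma applies inside
  \<A>.\<close>

lemma maximal_member:
  fixes \<A> :: "'a set set"
  assumes "\<A> \<noteq> {}" and ideals: "\<And>I. I \<in> \<A> \<Longrightarrow> is_ideal I"
  obtains I where "I \<in> \<A>" "\<And>J. J \<in> \<A> \<Longrightarrow> I \<subseteq> J \<Longrightarrow> J = I"
proof -
  have "\<exists>M\<in>\<A>. \<forall>X\<in>\<A>. M \<subseteq> X \<longrightarrow> X = M"
  proof (rule subset_Zorn_nonempty[OF assms(1)])
    fix C assume C: "C \<noteq> {}" and ch: "subset.chain \<A> C"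
    have CA: "C \<subseteq> \<A>" and lin: "\<And>X Y. X \<in> C \<Longrightarrow> Y \<in> C \<Longrightarrow> X \<subseteq> Y \<or> Y \<subseteq> X"
      using ch unfolding subset_chain_def by auto
    have "is_ideal (\<Union>C)" unfolding is_ideal_def
    proof (intro conjI ballI allI impI)
      show "0 \<in> \<Union>C" using C CA ideals is_idealD(1) by blast
    next
      fix a b assume "a \<in> \<Union>C" "b \<in> \<Union>C"
      then obtain X Y where XY: "X \<in> C" "Y \<in> C" "a \<in> X" "b \<in> Y" by auto
      then obtain Z where "Z \<in> C" "a \<in> Z" "b \<in> Z" using lin by blast
      then show "a + b \<in> \<Union>C" using CA ideals is_idealD(2) by blast
    next
      fix r a assume "a \<in> \<Union>C"
      then show "r * a \<in> \<Union>C" using CA ideals is_idealD(3) by blast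
    qed
    then obtain ys where ys: "\<Union>C = ideal_gen ys"
      using noeth unfolding noetherian_ring_def by blast
    have sub: "set ys \<subseteq> \<Union>C"
    proof
      fix y assume "y \<in> set ys"
      then obtain j where j: "j < length ys" "y = ys ! j" by (metis in_set_conv_nth)
      have "y = (\<Sum>k<length ys. (if k = j then 1 else 0) * ys ! k)"
        using j by (simp add: if_distrib[of "\<lambda>c. c * _"] sum.delta cong: if_cong)
      then show "y \<in> \<Union>C" unfolding ys ideal_gen_def by (intro CollectI exI)
    qed
    have "\<exists>Z\<in>C. set zs \<subseteq> Z" if "set zs \<subseteq> \<Union>C" for zs
      using that
    proof (induction zs)
      case Nil then show ?case using C by auto
    next
      case (Cons z zs)
      then obtain Z Y where "Z \<in> C" "set zs \<subseteq> Z" "Y \<in> C" "z \<in> Y" by auto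
      then show ?case using lin[of Z Y] by (metis insert_subset list.simps(15) subset_eq)
    qed
    then obtain Z where Z: "Z \<in> C" "set ys \<subseteq> Z" using sub by blast
    have Zi: "is_ideal Z" using Z CA ideals by blast
    have "\<Union>C \<subseteq> Z" unfolding ys ideal_gen_def
      using Z(2) by (auto intro!: ideal_sum[OF Zi] is_idealD(3)[OF Zi])
    then have "\<Union>C = Z" using Z(1) by blast
    then show "\<Union>C \<in> \<A>" using Z(1) CA by blast
  qed
  then show thesis using that by blast
qed

lemma maximal_such:
  fixes I0 :: "'a set"
  assumes "Q I0" and "\<And>I. Q I \<Longrightarrow> is_ideal I"
  obtains I where "Q I" "\<And>J. Q J \<Longrightarrow> I \<subseteq> J \<Longrightarrow> J = I"
proof (rule maximal_member[of "Collect Q"])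
  show "Collect Q \<noteq> {}" using assms(1) by blast
qed (use assms(2) that in auto)

lemma ascending_chain:
  fixes I :: "nat \<Rightarrow> 'a set"
  assumes "\<And>n. is_ideal (I n)" "\<And>n. I n \<subseteq> I (Suc n)"
  obtains N where "\<And>n. N \<le> n \<Longrightarrow> I n = I N"
proof -
  obtain J where J: "J \<in> range I" "\<And>K. K \<in> range I \<Longrightarrow> J \<subseteq> K \<Longrightarrow> K = J"
    by (rule maximal_such[of "\<lambda>J. J \<in> range I" "I 0"]) (use assms(1) in auto)
  then obtain N where N: "J = I N" by blast
  have "I n = I N" if "N \<le> n" for n
    using J(2)[of "I n"] lift_Suc_mono_le[of I, OF assms(2) that] N by simp
  then show thesis by (rule that)
qed

text \<open>Existence of an associated prime of R/K: a maximal annihilator of a nonzero element is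
  prime, because passing from a to a nonzero multiple of a cannot enlarge it.\<close>

lemma prime_colon:
  fixes K :: "'a set"
  assumes K: "is_ideal K" "1 \<notin> K"
  obtains a where "a \<notin> K" "prime_ideal (colon K a)"
proof -
  let ?A = "colon K ` (- K)"
  obtain I where I: "I \<in> ?A" "\<And>J. J \<in> ?A \<Longrightarrow> I \<subseteq> J \<Longrightarrow> J = I"
    by (rule maximal_such[of "\<lambda>J. J \<in> ?A" "colon K 1"]) (use colon_ideal[OF K(1)] K(2) in auto)
  then obtain a where a: "I = colon K a" "a \<notin> K" by blast
  have "c \<in> I" if bc: "b * c \<in> I" and b: "b \<notin> I" for b c
  proof -
    have "b * a \<notin> K" using b a by (simp add: colon_def)
    then have "colon K (b * a) \<in> ?A" by blast
    moreover have "I \<subseteq> colon K (b * a)"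
      using is_idealD(3)[OF K(1), of "_ * a" b] a(1) by (auto simp: colon_def mult.left_commute)
    ultimately have "colon K (b * a) = I" using I(2) by blast
    moreover have "c \<in> colon K (b * a)"
      using bc a(1) by (simp add: colon_def mult_ac)
    ultimately show ?thesis by simp
  qed
  moreover have "1 \<notin> I" using a by (simp add: colon_def)
  ultimately have "prime_ideal I"
    unfolding prime_ideal_def using a colon_ideal[OF K(1)] by blast
  then show thesis using that a by blast
qed

lemma prime_disjoint:
  fixes I :: "'a set"
  assumes I: "is_ideal I" and S: "1 \<in> S" "\<And>a b. a \<in> S \<Longrightarrow> b \<in> S \<Longrightarrow> a * b \<in> S" "I \<inter> S = {}"
  obtains Q where "prime_ideal Q" "I \<subseteq> Q" "Q \<inter> S = {}"
proof -
  let ?A = "{J. is_ideal J \<and> I \<subseteq> J \<and> J \<inter> S = {}}"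
  have "I \<in> ?A" using I S(3) by simp
  then obtain Q where Q: "Q \<in> ?A" "\<And>J. J \<in> ?A \<Longrightarrow> Q \<subseteq> J \<Longrightarrow> J = Q"
    by (rule maximal_such[of "\<lambda>J. J \<in> ?A" I]) blast+
  then have Qi: "is_ideal Q" by simp
  have ex: "\<exists>q r. q \<in> Q \<and> q + r * a \<in> S" if a: "a \<notin> Q" for a
  proof (rule ccontr)
    assume "\<nexists>q r. q \<in> Q \<and> q + r * a \<in> S"
    then have "s \<notin> S" if "s \<in> adjoin Q [a]" for s using that by (auto simp: adjoin.simps)
    then have "adjoin Q [a] \<in> ?A"
      using adjoin_ideal[OF Qi, of "[a]"] adjoin_sup[of Q "[a]"] Q(1) by blast
    then have "adjoin Q [a] = Q" using Q(2) adjoin_sup by metis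
    then show False using a adjoin_set[OF Qi, of "[a]"] by simp
  qed
  have "a \<in> Q \<or> b \<in> Q" if ab: "a * b \<in> Q" for a b
  proof (rule ccontr)
    assume no: "\<not> (a \<in> Q \<or> b \<in> Q)"
    obtain q r where q: "q \<in> Q" "q + r * a \<in> S" using ex no by metis
    obtain q' r' where q': "q' \<in> Q" "q' + r' * b \<in> S" using ex no by metis
    have "(q + r * a) * (q' + r' * b) = q * (q' + r' * b) + (r * a) * q' + (r * r') * (a * b)"
      by (simp add: algebra_simps)
    also have "\<dots> \<in> Q"
      by (intro is_idealD(2)[OF Qi] is_idealD(3)[OF Qi] is_idealD(4)[OF Qi, OF q(1)] q' ab)
    finally have "(q + r * a) * (q' + r' * b) \<in> Q" .
    moreover have "(q + r * a) * (q' + r' * b) \<in> S" using S(2) q q' by simp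
    ultimately show False using Q(1) by (metis (lifting) IntI empty_iff mem_Collect_eq)
  qed
  moreover have "1 \<notin> Q" using Q(1) S(1) by blast
  ultimately have "prime_ideal Q" unfolding prime_ideal_def using Qi by blast
  then show thesis using that Q(1) by blast
qed

lemma power_in_ideal:
  fixes I :: "'a set"
  assumes "is_ideal I" "\<And>Q. prime_ideal Q \<Longrightarrow> I \<subseteq> Q \<Longrightarrow> c \<in> Q"
  obtains n where "c ^ n \<in> I"
proof -
  have "\<exists>n. c ^ n \<in> I"
  proof (rule ccontr)
    assume no: "\<nexists>n. c ^ n \<in> I"
    define S where "S = {s. \<exists>n. s = c ^ n}"
    have "1 \<in> S" "c \<in> S" unfolding S_def by (force intro: exI[of _ 0] exI[of _ 1])+
    moreover have "s * t \<in> S" if "s \<in> S" "t \<in> S" for s t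
      using that unfolding S_def by (auto simp: power_add[symmetric])
    moreover have "I \<inter> S = {}" using no unfolding S_def by blast
    ultimately obtain Q where Q: "prime_ideal Q" "I \<subseteq> Q" "Q \<inter> S = {}"
      using prime_disjoint[OF assms(1), of S] by blast
    then show False using assms(2)[OF Q(1,2)] \<open>c \<in> S\<close> by blast
  qed
  then show thesis using that by blast
qed

text \<open>Noetherian induction: a maximal counterexample I is not prime, so it contains a product
  a b with a and b outside. A prime over I lies over I + (a) or I + (b), and the two finite sets
  combine. F contains all minimal primes over I, and possibly others.\<close>

lemma finite_primes_below:
  fixes I :: "'a set"
  assumes "is_ideal I"
  obtains F where "finite F" "\<And>P. P \<in> F \<Longrightarrow> prime_ideal P \<and> I \<subseteq> P"
    "\<And>Q. prime_ideal Q \<Longrightarrow> I \<subseteq> Q \<Longrightarrow> \<exists>P\<in>F. P \<subseteq> Q"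
proof -
  define ok where "ok = (\<lambda>I :: 'a set. \<exists>F. finite F \<and> (\<forall>P\<in>F. prime_ideal P \<and> I \<subseteq> P) \<and>
    (\<forall>Q. prime_ideal Q \<and> I \<subseteq> Q \<longrightarrow> (\<exists>P\<in>F. P \<subseteq> Q)))"
  let ?A = "{I. is_ideal I \<and> \<not> ok I}"
  have "I' \<notin> ?A" for I' :: "'a set"
  proof
    assume "I' \<in> ?A"
    then obtain I where I: "I \<in> ?A" "\<And>J. J \<in> ?A \<Longrightarrow> I \<subseteq> J \<Longrightarrow> J = I"
      by (rule maximal_such[of "\<lambda>J. J \<in> ?A" I']) blast+
    have Ii: "is_ideal I" using I(1) by simp
    have "1 \<notin> I"
    proof
      assume "1 \<in> I"
      then have "ok I" unfolding ok_def using prime_idealD(2) by (intro exI[of _ "{}"]) blast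
      then show False using I(1) by simp
    qed
    moreover have "\<not> prime_ideal I"
    proof
      assume "prime_ideal I"
      then have "ok I" unfolding ok_def by (intro exI[of _ "{I}"]) blast
      then show False using I(1) by simp
    qed
    ultimately obtain a b where ab: "a * b \<in> I" "a \<notin> I" "b \<notin> I"
      unfolding prime_ideal_def using Ii by blast
    have ok: "ok (adjoin I [c])" if "c \<notin> I" for c
    proof (rule ccontr)
      assume "\<not> ok (adjoin I [c])"
      then have "adjoin I [c] \<in> ?A" using adjoin_ideal[OF Ii] by simp
      then have "adjoin I [c] = I" using I(2) adjoin_sup by blast
      then show False using that adjoin_set[OF Ii, of "[c]"] by simp
    qed
    obtain F where F: "finite F" "\<forall>P\<in>F. prime_ideal P \<and> adjoin I [a] \<subseteq> P"
        "\<forall>Q. prime_ideal Q \<and> adjoin I [a] \<subseteq> Q \<longrightarrow> (\<exists>P\<in>F. P \<subseteq> Q)"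
      using ok[OF ab(2)] unfolding ok_def by (elim exE conjE) (rule that)
    obtain G where G: "finite G" "\<forall>P\<in>G. prime_ideal P \<and> adjoin I [b] \<subseteq> P"
        "\<forall>Q. prime_ideal Q \<and> adjoin I [b] \<subseteq> Q \<longrightarrow> (\<exists>P\<in>G. P \<subseteq> Q)"
      using ok[OF ab(3)] unfolding ok_def by (elim exE conjE) (rule that)
    have "\<exists>P\<in>F \<union> G. P \<subseteq> Q" if Q: "prime_ideal Q" "I \<subseteq> Q" for Q
    proof -
      have "a \<in> Q \<or> b \<in> Q" using prime_idealD(3)[OF Q(1)] ab(1) Q(2) by blast
      then have "adjoin I [a] \<subseteq> Q \<or> adjoin I [b] \<subseteq> Q"
        using adjoin_least[OF prime_idealD(1)[OF Q(1)] Q(2), of "[a]"]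
          adjoin_least[OF prime_idealD(1)[OF Q(1)] Q(2), of "[b]"] by auto
      then have "(\<exists>P\<in>F. P \<subseteq> Q) \<or> (\<exists>P\<in>G. P \<subseteq> Q)"
        using F(3)[rule_format, of Q] G(3)[rule_format, of Q] Q(1) by argo
      then show ?thesis by (auto simp only: bex_Un)
    qed
    moreover have "prime_ideal P \<and> I \<subseteq> P" if "P \<in> F \<union> G" for P
      using that F(2) G(2) adjoin_sup[of I "[a]"] adjoin_sup[of I "[b]"] by (meson Un_iff subset_trans)
    ultimately have "ok I" unfolding ok_def using F(1) G(1)
      by (intro exI[of _ "F \<union> G"]) (simp only: finite_Un, simp)
    then show False using I(1) by simp
  qed
  then have "ok I" using assms by simp
  then show thesis unfolding ok_def by (elim exE conjE) (rule that, auto)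
qed

text \<open>F consists of the maximal annihilators of nonzero elements of R/I. Were there infinitely
  many, P n = Ann(a n), then some a N would lie in I plus the ideal generated by the earlier ones.
  Hence P N would contain the intersection of the earlier P i, which is impossible for pairwise
  incomparable primes.\<close>

lemma zero_divisors_in_finite_union:
  fixes I :: "'a set"
  assumes I: "is_ideal I"
  obtains F where "finite F" "\<And>P. P \<in> F \<Longrightarrow> prime_ideal P \<and> (\<exists>a. a \<notin> I \<and> P = colon I a)"
    "\<And>x a. x * a \<in> I \<Longrightarrow> a \<notin> I \<Longrightarrow> \<exists>P\<in>F. x \<in> P"
proof -
  define F where "F = {P. prime_ideal P \<and> (\<exists>a. a \<notin> I \<and> P = colon I a) \<and>
     (\<forall>a. a \<notin> I \<and> P \<subseteq> colon I a \<longrightarrow> colon I a = P)}"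
  have ex: "\<exists>P\<in>F. x \<in> P" if xa: "x * a \<in> I" "a \<notin> I" for x a
  proof -
    let ?A = "colon I ` {b. b \<notin> I \<and> x * b \<in> I}"
    obtain P where P: "P \<in> ?A" "\<And>J. J \<in> ?A \<Longrightarrow> P \<subseteq> J \<Longrightarrow> J = P"
      by (rule maximal_such[of "\<lambda>J. J \<in> ?A" "colon I a"]) (use colon_ideal[OF I] xa in auto)
    then obtain b where b: "b \<notin> I" "x * b \<in> I" "P = colon I b" by blast
    have max: "colon I c = P" if c: "c \<notin> I" "P \<subseteq> colon I c" for c
    proof -
      have "x \<in> colon I c" using c(2) b by (auto simp: colon_def)
      then show ?thesis using P(2)[of "colon I c"] c by (auto simp: colon_def)
    qed
    have Pi: "is_ideal P" "1 \<notin> P" using colon_ideal[OF I] b by (auto simp: colon_def)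
    have "v \<in> P" if uv: "u * v \<in> P" and u: "u \<notin> P" for u v
    proof -
      have "u * b \<notin> I" using u b by (simp add: colon_def)
      moreover have "P \<subseteq> colon I (u * b)"
        using is_idealD(3)[OF I, of "_ * b" u] b(3) by (auto simp: colon_def mult.left_commute)
      ultimately have "colon I (u * b) = P" using max by blast
      moreover have "v \<in> colon I (u * b)" using uv b(3) by (simp add: colon_def mult_ac)
      ultimately show ?thesis by simp
    qed
    then have "prime_ideal P" unfolding prime_ideal_def using Pi by blast
    then have "P \<in> F" unfolding F_def using b max by blast
    then show ?thesis using b by (auto simp: colon_def)
  qed
  have "finite F"
  proof (rule ccontr)
    assume "infinite F"
    then obtain P :: "nat \<Rightarrow> 'a set" where P: "inj P" "range P \<subseteq> F"
      using infinite_countable_subset by blast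
    have "\<forall>n. \<exists>a. a \<notin> I \<and> P n = colon I a" using P(2) F_def by blast
    then obtain a where "\<forall>n. a n \<notin> I \<and> P n = colon I (a n)" by (rule choice[THEN exE])
    then have a: "\<And>n. a n \<notin> I" "\<And>n. P n = colon I (a n)" by auto
    have Pp: "prime_ideal (P n)" for n using P(2) F_def by blast
    have Pm: "P i = P j" if "P i \<subseteq> P j" for i j
    proof -
      have "P i \<in> F" using P(2) by blast
      then have "colon I (a j) = P i" unfolding F_def using a that by simp
      then show ?thesis using a by simp
    qed
    let ?K = "\<lambda>n. adjoin I (map a (rev [0..<n]))"
    have "?K n \<subseteq> ?K (Suc n)" for n
      using adjoin_Cons_sup by simp
    then obtain N where N: "\<And>n. N \<le> n \<Longrightarrow> ?K n = ?K N"
      using ascending_chain[of ?K, OF adjoin_ideal[OF I]] by metis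
    have "?K (Suc N) = ?K N" by (rule N) simp
    moreover have "a N \<in> ?K (Suc N)" using adjoin_set[OF I, of "map a (rev [0..<Suc N])"] by auto
    ultimately have aN: "a N \<in> ?K N" by simp
    have "b \<in> P N" if b: "\<And>i. i < N \<Longrightarrow> b \<in> P i" for b
    proof -
      have "?K N \<subseteq> colon I b"
        using b a(2) is_idealD(4)[OF I]
        by (intro adjoin_least colon_ideal I) (auto simp: colon_def mult.commute)
      then show ?thesis using aN a(2) by (auto simp: colon_def mult.commute)
    qed
    moreover have "\<exists>b. b \<notin> P N \<and> (\<forall>i<k. b \<in> P i)" if "k \<le> N" for k
      using that
    proof (induction k)
      case 0
      then show ?case using prime_idealD(2)[OF Pp] by blast
    next
      case (Suc k)
      then obtain b where b: "b \<notin> P N" "\<forall>i<k. b \<in> P i" by auto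
      have "P k \<noteq> P N" using P(1) Suc.prems by (auto dest: injD)
      then obtain c where c: "c \<in> P k" "c \<notin> P N" using Pm[of k N] by blast
      have "b * c \<notin> P N" using b(1) c(2) prime_idealD(3)[OF Pp, of b c N] by blast
      moreover have "b * c \<in> P i" if "i < Suc k" for i
        using that b(2) c(1) is_idealD(3,4)[OF prime_idealD(1)[OF Pp[of i]]] less_Suc_eq by blast
      ultimately show ?case by blast
    qed
    ultimately show False by blast
  qed
  then show thesis using that[of F] ex F_def by blast
qed

end

section \<open>Prime avoidance\<close>

lemma prime_contains_Inter:
  assumes "finite F" "prime_ideal P" "\<And>Q. Q \<in> F \<Longrightarrow> is_ideal Q \<and> \<not> Q \<subseteq> P"
  obtains b where "b \<notin> P" "\<And>Q. Q \<in> F \<Longrightarrow> b \<in> Q"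
proof -
  have "\<exists>b. b \<notin> P \<and> (\<forall>Q\<in>F. b \<in> Q)" using assms(1,3)
  proof (induction F)
    case empty
    then show ?case using prime_idealD(2)[OF assms(2)] by blast
  next
    case (insert Q F)
    then obtain b c where "b \<notin> P" "\<forall>Q\<in>F. b \<in> Q" "c \<in> Q" "c \<notin> P" by (metis insertCI subsetI)
    then have "b * c \<notin> P" using prime_idealD(3)[OF assms(2)] by blast
    moreover have "b * c \<in> Q'" if "Q' \<in> insert Q F" for Q'
    proof -
      have "is_ideal Q'" using insert.prems that by blast
      then show ?thesis using that \<open>\<forall>Q\<in>F. b \<in> Q\<close> \<open>c \<in> Q\<close> is_idealD(3,4)[of Q'] by blast
    qed
    ultimately show ?case by blast
  qed
  then show thesis using that by blast
qed

lemma prime_avoidance: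
  assumes "finite F" "is_ideal I" "\<And>P. P \<in> F \<Longrightarrow> prime_ideal P \<and> \<not> I \<subseteq> P"
  obtains a where "a \<in> I" "\<And>P. P \<in> F \<Longrightarrow> a \<notin> P"
proof -
  have "\<exists>a\<in>I. \<forall>P\<in>F. a \<notin> P" using assms(1,3)
  proof (induction F rule: finite_psubset_induct)
    case (psubset F)
    show ?case
    proof (cases "F = {}")
      case True
      then show ?thesis using is_idealD(1)[OF assms(2)] by blast
    next
      case False
      then obtain P where P: "P \<in> F" by blast
      let ?G = "F - {P}"
      have "?G \<subset> F" using P by blast
      then obtain a where a: "a \<in> I" "\<forall>P\<in>?G. a \<notin> P" using psubset by (metis DiffD1)
      show ?thesis
      proof (cases "\<exists>Q\<in>?G. Q \<subseteq> P")
        case True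
        then obtain Q where Q: "Q \<in> ?G" "Q \<subseteq> P" by blast
        then have "F - {Q} \<subset> F" by blast
        then obtain a' where "a' \<in> I" "\<forall>P\<in>F - {Q}. a' \<notin> P" using psubset by (metis DiffD1)
        then show ?thesis using Q P by blast
      next
        case no: False
        show ?thesis
        proof (cases "a \<in> P")
          case False
          then show ?thesis using a by blast
        next
          case True
          \<comment> \<open>The element b lies in I and in all primes except P. As a lies in P only,
            a + b avoids every member of F.\<close>
          have "finite (insert I ?G)" using psubset.hyps by simp
          then obtain b where b: "b \<notin> P" "\<And>Q. Q \<in> insert I ?G \<Longrightarrow> b \<in> Q"
          proof (rule prime_contains_Inter)
            show "prime_ideal P" using psubset.prems P by blast
            show "is_ideal Q \<and> \<not> Q \<subseteq> P" if "Q \<in> insert I ?G" for Q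
              using that psubset.prems P no assms(2) prime_idealD(1) by blast
          qed (use that in blast)
          have "a + b \<in> I" using a b is_idealD(2)[OF assms(2)] by blast
          moreover have "a + b \<notin> P"
            using True b is_idealD(6)[of P "a + b" a] psubset.prems P by (auto dest: prime_idealD)
          moreover have "a + b \<notin> Q" if "Q \<in> ?G" for Q
            using that a b is_idealD(6)[of Q "a + b" b] psubset.prems by (auto dest: prime_idealD)
          ultimately show ?thesis by blast
        qed
      qed
    qed
  qed
  then show thesis using that by blast
qed

section \<open>Localisation at a prime and the principal ideal theorem\<close>

lemma principal_ideal: "is_ideal (range (\<lambda>r. a * r))"
  unfolding is_ideal_def
proof (intro conjI ballI allI impI)
  show "0 \<in> range (\<lambda>r. a * r)" by (rule range_eqI[of _ _ 0]) simp
next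
  fix x y assume "x \<in> range (\<lambda>r. a * r)" "y \<in> range (\<lambda>r. a * r)"
  then show "x + y \<in> range (\<lambda>r. a * r)" by (auto simp: distrib_left[symmetric])
next
  fix c x assume "x \<in> range (\<lambda>r. a * r)"
  then show "c * x \<in> range (\<lambda>r. a * r)" by (auto simp: mult.left_commute)
qed

text \<open>The sum of \<open>I\<close> and \<open>K\<close> in the localisation at \<open>P\<close>, intersected with \<open>U\<close>.\<close>
definition local_sum :: "'a::comm_ring_1 set \<Rightarrow> 'a set \<Rightarrow> 'a set \<Rightarrow> 'a set \<Rightarrow> 'a set" where
  "local_sum P U I K = {x \<in> U. \<exists>s y. s \<notin> P \<and> y \<in> K \<and> s * x - y \<in> I}"

lemma local_sum_ideal:
  assumes P: "prime_ideal P" and U: "is_ideal U" and I: "is_ideal I" and K: "is_ideal K"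
  shows "is_ideal (local_sum P U I K)"
  unfolding is_ideal_def
proof (intro conjI ballI allI impI)
  have "1 * 0 - 0 \<in> I" using is_idealD(1)[OF I] by simp
  then show "0 \<in> local_sum P U I K" unfolding local_sum_def
    using prime_idealD(2)[OF P] is_idealD(1)[OF U] is_idealD(1)[OF K] by blast
next
  fix x y assume "x \<in> local_sum P U I K" "y \<in> local_sum P U I K"
  then obtain s x' t y' where *: "x \<in> U" "y \<in> U" "s \<notin> P" "t \<notin> P" "x' \<in> K" "y' \<in> K"
    "s * x - x' \<in> I" "t * y - y' \<in> I" unfolding local_sum_def by auto
  have "(s * t) * (x + y) - (t * x' + s * y') = t * (s * x - x') + s * (t * y - y')"
    by (simp add: algebra_simps)
  also have "\<dots> \<in> I" using * is_idealD(2,3)[OF I] by simp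
  finally have "(s * t) * (x + y) - (t * x' + s * y') \<in> I" .
  moreover have "t * x' + s * y' \<in> K" using * is_idealD(2,3)[OF K] by simp
  moreover have "s * t \<notin> P" using prime_idealD(3)[OF P] * by blast
  ultimately show "x + y \<in> local_sum P U I K" unfolding local_sum_def using * is_idealD(2)[OF U] by blast
next
  fix q x assume "x \<in> local_sum P U I K"
  then obtain s x' where *: "x \<in> U" "s \<notin> P" "x' \<in> K" "s * x - x' \<in> I" unfolding local_sum_def by auto
  have "s * (q * x) - q * x' = q * (s * x - x')" by (simp add: algebra_simps)
  also have "\<dots> \<in> I" using * is_idealD(3)[OF I] by simp
  finally have "s * (q * x) - q * x' \<in> I" .
  moreover have "q * x' \<in> K" using * is_idealD(3)[OF K] by simp
  ultimately show "q * x \<in> local_sum P U I K" unfolding local_sum_def using * is_idealD(3)[OF U] by blast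
qed

lemma local_sum_saturated:
  assumes P: "prime_ideal P" and U: "\<forall>s a. s \<notin> P \<longrightarrow> s * a \<in> U \<longrightarrow> a \<in> U"
    and s: "s \<notin> P" "s * x \<in> local_sum P U I K"
  shows "x \<in> local_sum P U I K"
proof -
  obtain t y where *: "s * x \<in> U" "t \<notin> P" "y \<in> K" "t * (s * x) - y \<in> I" using s(2) unfolding local_sum_def by auto
  then have "(t * s) * x - y \<in> I" by (simp add: mult.assoc)
  moreover have "t * s \<notin> P" using prime_idealD(3)[OF P] s(1) * by blast
  ultimately show ?thesis unfolding local_sum_def using * U s(1) by blast
qed

context noetherian begin

text \<open>Ideals of the localisation at \<open>P\<close> are the ideals closed under cancelling factors outside \<open>P\<close>;
  the next lemma says that a module of finite length over that localisation is Artinian.\<close>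

lemma descending_chain_saturated:
  fixes P :: "'a set"
  assumes P: "prime_ideal P"
    and U: "is_ideal U" "\<And>s a. s \<notin> P \<Longrightarrow> s * a \<in> U \<Longrightarrow> a \<in> U"
    and nil: "\<And>a c. a \<in> U \<Longrightarrow> c \<in> P \<Longrightarrow> \<exists>s n. s \<notin> P \<and> s * (c ^ n * a) \<in> J"
    and L: "\<And>n. is_ideal (L n)" "\<And>n. J \<subseteq> L n" "\<And>n. L n \<subseteq> U"
      "\<And>n s a. s \<notin> P \<Longrightarrow> s * a \<in> L n \<Longrightarrow> a \<in> L n"
      "\<And>n. L (Suc n) \<subseteq> L n"
  obtains N where "\<And>n. N \<le> n \<Longrightarrow> L n = L N"
proof -
  have satU: "\<forall>s a. s \<notin> P \<longrightarrow> s * a \<in> U \<longrightarrow> a \<in> U" using U(2) by blast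
  define chn where "chn = (\<lambda>I (L :: nat \<Rightarrow> 'a set). (\<forall>n. is_ideal (L n) \<and> I \<subseteq> L n \<and> L n \<subseteq> U \<and>
     (\<forall>s a. s \<notin> P \<longrightarrow> s * a \<in> L n \<longrightarrow> a \<in> L n) \<and> L (Suc n) \<subseteq> L n))"
  define stab where "stab = (\<lambda>(L :: nat \<Rightarrow> 'a set). \<exists>N. \<forall>n\<ge>N. L n = L N)"
  \<comment> \<open>Noetherian induction on the lower bound of the chain, not on the chain itself: a
    maximal \<open>bad\<close> ideal I0 is refuted.\<close>
  define bad where "bad = (\<lambda>I. is_ideal I \<and> J \<subseteq> I \<and> (\<forall>s a. s \<notin> P \<longrightarrow> s * a \<in> I \<longrightarrow> a \<in> I) \<and>
     (\<exists>L. chn I L \<and> \<not> stab L))"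
  have badD: "is_ideal I" if "bad I" for I
    using that unfolding bad_def by blast
  have "\<not> bad I" for I
  proof
    assume "bad I"
    then obtain I0 where bad0: "bad I0" and max0: "\<And>I. bad I \<Longrightarrow> I0 \<subseteq> I \<Longrightarrow> I = I0"
      by (rule maximal_such) (erule badD, blast)
    from bad0 obtain L where L: "chn I0 L" "\<not> stab L" and I0: "is_ideal I0" "J \<subseteq> I0"
      and sat0: "\<And>s a. s \<notin> P \<Longrightarrow> s * a \<in> I0 \<Longrightarrow> a \<in> I0"
      unfolding bad_def by (elim conjE exE) (rule that, assumption, assumption, assumption, assumption, iprover)
    have Li: "is_ideal (L n)" and IL: "I0 \<subseteq> L n" and LU: "L n \<subseteq> U" and LS: "L (Suc n) \<subseteq> L n" for n
      using L(1) unfolding chn_def by blast+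
    have Ls: "a \<in> L n" if "s \<notin> P" "s * a \<in> L n" for s a n
      using L(1) that unfolding chn_def by blast
    have Ldec: "L n \<subseteq> L k" if "k \<le> n" for k n
      using lift_Suc_antimono_le[of L, OF LS that] .
    have "\<exists>u. u \<in> U \<and> u \<notin> I0"
    proof (rule ccontr)
      assume "\<nexists>u. u \<in> U \<and> u \<notin> I0"
      then have "U \<subseteq> I0" by blast
      then have "L n = I0" for n using IL[of n] LU[of n] by simp
      then show False using L(2) by (simp add: stab_def)
    qed
    then obtain u where u: "u \<in> U" "u \<notin> I0" by (elim exE conjE)
    have "is_ideal (colon I0 u)" "1 \<notin> colon I0 u"
      using colon_ideal[OF I0(1)] u(2) by (simp_all add: colon_def)
    then obtain b where b: "b \<notin> colon I0 u" "prime_ideal (colon (colon I0 u) b)"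
      by (rule prime_colon)
    define a where "a = b * u"
    have a: "a \<notin> I0" "a \<in> U" using b u is_idealD(3)[OF U(1)] by (simp_all add: a_def colon_def)
    have "colon (colon I0 u) b = colon I0 a" by (simp add: colon_def a_def mult.assoc)
    with b have Q: "prime_ideal (colon I0 a)" by simp
    \<comment> \<open>Every element of P is locally nilpotent on U modulo J, so P is the only
      possible associated prime of U/I0. Locally at P, the submodule I1/I0 generated by a is
      therefore simple.\<close>
    have QP: "colon I0 a = P"
    proof
      show "colon I0 a \<subseteq> P"
        using sat0 a(1) by (auto simp: colon_def)
      show "P \<subseteq> colon I0 a"
      proof
        fix c assume c: "c \<in> P"
        obtain s n where sn: "s \<notin> P" "s * (c ^ n * a) \<in> J" using nil[OF a(2) c] by (elim exE conjE)
        then have "s * (c ^ n * a) \<in> I0" using I0(2) by blast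
        then have "c ^ n * a \<in> I0" using sat0 sn(1) by simp
        then have "c ^ n \<in> colon I0 a" by (simp add: colon_def)
        then show "c \<in> colon I0 a" using prime_ideal_power[OF Q] by simp
      qed
    qed
    define I1 where "I1 = {x\<in>U. \<exists>s r. s \<notin> P \<and> s * x - r * a \<in> I0}"
    have one: "1 \<notin> P" and mulP: "\<And>s t. s \<notin> P \<Longrightarrow> t \<notin> P \<Longrightarrow> s * t \<notin> P"
      using prime_idealD[OF P] by blast+
    have I1_eq: "I1 = local_sum P U I0 (range (\<lambda>r. a * r))"
      unfolding I1_def local_sum_def by (auto simp: mult.commute)
    have I1i: "is_ideal I1" unfolding I1_eq by (rule local_sum_ideal[OF P U(1) I0(1) principal_ideal])
    have I01: "I0 \<subseteq> I1"
    proof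
      fix x assume x: "x \<in> I0"
      then have "1 * x - 0 * a \<in> I0" by simp
      moreover have "x \<in> U" using x IL LU by blast
      ultimately show "x \<in> I1" unfolding I1_def using one by blast
    qed
    have aI1: "a \<in> I1"
    proof -
      have "1 * a - 1 * a \<in> I0" using is_idealD(1)[OF I0(1)] by simp
      then show ?thesis unfolding I1_def using one a(2) by blast
    qed
    have sat1: "x \<in> I1" if "s \<notin> P" "s * x \<in> I1" for s x
      using local_sum_saturated[OF P satU] that unfolding I1_eq by blast
    have stab1: "stab M" if "chn I1 M" for M
    proof (rule ccontr)
      assume "\<not> stab M"
      then have "bad I1" unfolding bad_def using I1i I0(2) I01 sat1 that by blast
      then have "I1 = I0" using max0 I01 by simp
      then show False using aI1 a(1) by simp
    qed
    \<comment> \<open>Simplicity of I1/I0: a term of the chain that meets I1 outside I0 contains a,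
      and with it all of I1.\<close>
    have I1L: "I1 \<subseteq> L n" if y: "y \<in> L n" "y \<in> I1" "y \<notin> I0" for n y
    proof -
      obtain s r where sr: "s \<notin> P" "s * y - r * a \<in> I0" using y(2) unfolding I1_def by auto
      have "r \<notin> P"
      proof
        assume "r \<in> P"
        then have "r * a \<in> I0" using QP by (auto simp: colon_def)
        then have "s * y \<in> I0" using sr(2) ideal_diff_iff[OF I0(1)] by blast
        then show False using sat0 sr(1) y(3) by blast
      qed
      moreover have "r * a \<in> L n"
        using ideal_diff_iff[OF Li[of n], of "s * y" "r * a"] sr(2) IL[of n] is_idealD(3)[OF Li[of n] y(1)] by blast
      ultimately have aL: "a \<in> L n" using Ls by blast
      show ?thesis
      proof
        fix x assume "x \<in> I1"
        then obtain t q where "t \<notin> P" "t * x - q * a \<in> I0" unfolding I1_def by auto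
        moreover from this have "t * x \<in> L n"
          using ideal_diff_iff[OF Li[of n], of "t * x" "q * a"] IL[of n] is_idealD(3)[OF Li[of n] aL] by blast
        ultimately show "x \<in> L n" using Ls by blast
      qed
    qed
    show False
    proof (cases "\<forall>n. I1 \<subseteq> L n")
      case True
      then have "chn I1 L" using L(1) True unfolding chn_def by blast
      then show False using stab1 L(2) by blast
    next
      case False
      then obtain n0 where n0: "\<not> I1 \<subseteq> L n0" by auto
      have meet: "y \<in> I0" if "n0 \<le> n" "y \<in> L n" "y \<in> I1" for n y
        using I1L[of y n0] n0 Ldec[OF that(1)] that by blast
      \<comment> \<open>Modular law: from n0 on, L n meets I1 only inside I0, while the local sums
        of I1 and L n stabilise by maximality of I0. Both together determine L n.\<close>
      define M where "M = (\<lambda>n. local_sum P U I1 (L n))"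
      have "chn I1 M" unfolding chn_def
      proof (intro allI conjI impI)
        fix n
        show "is_ideal (M n)" unfolding M_def by (rule local_sum_ideal[OF P U(1) I1i Li])
        show "I1 \<subseteq> M n"
        proof
          fix x assume x: "x \<in> I1"
          then have "1 * x - 0 \<in> I1" "x \<in> U" by (auto simp: I1_def)
          then show "x \<in> M n" unfolding M_def local_sum_def using one is_idealD(1)[OF Li[of n]] by blast
        qed
        show "M n \<subseteq> U" by (auto simp: M_def local_sum_def)
        show "M (Suc n) \<subseteq> M n" unfolding M_def local_sum_def using LS by blast
        show "x \<in> M n" if "s \<notin> P" "s * x \<in> M n" for s x
          using local_sum_saturated[OF P satU] that unfolding M_def by blast
      qed
      then have "stab M" by (rule stab1)
      then obtain N1 where N1: "\<And>n. N1 \<le> n \<Longrightarrow> M n = M N1" unfolding stab_def by blast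
      define N where "N = max n0 N1"
      have "L n = L N" if n: "N \<le> n" for n
      proof
        show "L n \<subseteq> L N" using Ldec[OF n] .
        show "L N \<subseteq> L n"
        proof
          fix x assume x: "x \<in> L N"
          have "1 * x - x \<in> I1" using is_idealD(1)[OF I1i] by simp
          then have "x \<in> M N" unfolding M_def local_sum_def using x LU one by blast
          moreover have "M N = M n" using N1[of N] N1[of n] n unfolding N_def by simp
          ultimately have "x \<in> M n" by simp
          then obtain s y where *: "s \<notin> P" "y \<in> L n" "s * x - y \<in> I1" unfolding M_def local_sum_def by auto
          have "s * x \<in> L N" "y \<in> L N" using is_idealD(3)[OF Li x] *(2) Ldec[OF n] by blast+
          then have "s * x - y \<in> L N" using is_idealD(6)[OF Li] by blast
          then have "s * x - y \<in> I0" using meet[of N] *(3) unfolding N_def by simp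
          then have "s * x \<in> L n"
            using ideal_diff_iff[OF Li[of n], of "s * x" y] IL[of n] *(2) by blast
          then show "x \<in> L n" using Ls *(1) by blast
        qed
      qed
      then have "stab L" unfolding stab_def by blast
      then show False using L(2) by simp
    qed
  qed
  \<comment> \<open>The intersection of the chain is an admissible lower bound, so the statement
    about \<open>bad\<close> covers the given chain.\<close>
  define K where "K = {a. \<forall>n. a \<in> L n}"
  have "is_ideal K" unfolding K_def is_ideal_def using is_idealD(1-3)[OF L(1)] by blast
  moreover have "J \<subseteq> K" unfolding K_def using L(2) by blast
  moreover have "\<forall>s a. s \<notin> P \<longrightarrow> s * a \<in> K \<longrightarrow> a \<in> K" unfolding K_def using L(4) by blast
  moreover have "chn K L" unfolding chn_def K_def using L by blast
  ultimately have "stab L" using \<open>\<not> bad K\<close> unfolding bad_def by blast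
  then show thesis unfolding stab_def using that by blast
qed

text \<open>Krull's principal ideal theorem in terms of chains. Otherwise P2 would be minimal over
  P0 + (w) and w would lie outside P1. The localisation of R/(P0 + (w)) at P2 would then be
  Artinian, which contradicts the behaviour of the powers of an element u of P1 outside P0.\<close>

lemma principal_ideal_chain:
  fixes P0 :: "'a set"
  assumes P: "prime_ideal P0" "prime_ideal P1" "prime_ideal P2" "P0 \<subset> P1" "P1 \<subset> P2" "w \<in> P2"
  shows "\<exists>P'. prime_ideal P' \<and> P0 \<subset> P' \<and> P' \<subset> P2 \<and> w \<in> P'"
proof (rule ccontr)
  assume no: "\<not> ?thesis"
  have none: "\<not> (P0 \<subset> Q \<and> Q \<subset> P2 \<and> w \<in> Q)" if "prime_ideal Q" for Q
    using that no by blast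
  have w1: "w \<notin> P1" using none[OF P(2)] P(4,5) by blast
  have i0: "is_ideal P0" and i1: "is_ideal P1" and i2: "is_ideal P2"
    using P(1-3) prime_idealD(1) by blast+
  have m1: "s * t \<notin> P1" if "s \<notin> P1" "t \<notin> P1" for s t using prime_idealD(3)[OF P(2)] that by blast
  have m2: "s * t \<notin> P2" if "s \<notin> P2" "t \<notin> P2" for s t using prime_idealD(3)[OF P(3)] that by blast
  have one: "1 \<notin> P1" "1 \<notin> P2" using prime_idealD(2)[OF P(2)] prime_idealD(2)[OF P(3)] .
  have P12: "s \<notin> P1" if "s \<notin> P2" for s using that P(5) by blast
  obtain u where u: "u \<in> P1" "u \<notin> P0" using P(4) by blast
  define J where "J = adjoin P0 [w]"
  have Ji: "is_ideal J" "P0 \<subseteq> J" "w \<in> J"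
    unfolding J_def using adjoin_ideal[OF i0] adjoin_sup adjoin_set[OF i0, of "[w]"] by auto
  \<comment> \<open>If c were not nilpotent modulo J locally at P2, a prime over J avoiding the
    powers of c and the complement of P2 would lie strictly between P0 and P2 and contain w.\<close>
  have nil: "\<exists>s n. s \<notin> P2 \<and> s * (c ^ n * a) \<in> J" if c: "c \<in> P2" for a c
  proof (rule ccontr)
    assume no: "\<nexists>s n. s \<notin> P2 \<and> s * (c ^ n * a) \<in> J"
    define S where "S = {t. \<exists>s n. s \<notin> P2 \<and> t = s * c ^ n}"
    have S1: "s \<in> S" if "s \<notin> P2" for s
    proof -
      have "s = s * c ^ 0" by simp
      then show ?thesis unfolding S_def using that by blast
    qed
    have "x * y \<in> S" if xy: "x \<in> S" "y \<in> S" for x y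
    proof -
      obtain s n t k where "s \<notin> P2" "x = s * c ^ n" "t \<notin> P2" "y = t * c ^ k" using xy unfolding S_def by auto
      then have "x * y = (s * t) * c ^ (n + k)" "s * t \<notin> P2" using m2 by (auto simp: power_add algebra_simps)
      then show ?thesis unfolding S_def by blast
    qed
    moreover have "J \<inter> S = {}"
    proof (rule ccontr)
      assume "J \<inter> S \<noteq> {}"
      then obtain s n where "s \<notin> P2" "s * c ^ n \<in> J" unfolding S_def by auto
      then have "s * (c ^ n * a) \<in> J" using is_idealD(4)[OF Ji(1), of "s * c ^ n" a] by (simp add: mult.assoc)
      then show False using no \<open>s \<notin> P2\<close> by blast
    qed
    ultimately obtain Q where Q: "prime_ideal Q" "J \<subseteq> Q" "Q \<inter> S = {}"
      using prime_disjoint[OF Ji(1), of S] S1[OF one(2)] by metis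
    have "Q \<subseteq> P2" using Q(3) S1 by blast
    moreover have "1 * c ^ 1 \<in> S" unfolding S_def using one(2) by blast
    then have "c \<notin> Q" using Q(3) by auto
    ultimately have "Q \<subset> P2" using c by blast
    moreover have "P0 \<subset> Q" using Ji Q(2) w1 P(4) by blast
    ultimately show False using none[OF Q(1)] Ji(3) Q(2) by blast
  qed
  \<comment> \<open>The contraction of the ideal generated by u^k in the localisation of R/P0 at P1.
    It takes the place of the symbolic powers of P1.\<close>
  define L where "L = (\<lambda>k::nat. {a. \<exists>t r. t \<notin> P1 \<and> t * a - u ^ k * r \<in> P0})"
  have L_eq: "L k = local_sum P1 UNIV P0 (range (\<lambda>r. u ^ k * r))" for k
    unfolding L_def local_sum_def by auto
  have Li: "is_ideal (L k)" for k
    unfolding L_eq by (rule local_sum_ideal[OF P(2) is_ideal_UNIV i0 principal_ideal])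
  have L0: "P0 \<subseteq> L k" for k
  proof
    fix x assume "x \<in> P0"
    then have "1 * x - u ^ k * 0 \<in> P0" by simp
    then show "x \<in> L k" unfolding L_def using one by blast
  qed
  have LS: "L (Suc k) \<subseteq> L k" for k
  proof
    fix x assume "x \<in> L (Suc k)"
    then obtain t r where "t \<notin> P1" "t * x - u ^ k * (u * r) \<in> P0" unfolding L_def by (auto simp: algebra_simps)
    then show "x \<in> L k" unfolding L_def by blast
  qed
  have Ls: "x \<in> L k" if "s \<notin> P1" "s * x \<in> L k" for s x k
    using local_sum_saturated[OF P(2), of UNIV] that unfolding L_eq by blast
  define M where "M = (\<lambda>k. {a. \<exists>s b r. s \<notin> P2 \<and> b \<in> L k \<and> s * a = b + w * r})"
  have M_eq: "M k = local_sum P2 UNIV (L k) (range (\<lambda>r. w * r))" for k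
  proof (intro set_eqI iffI)
    fix a assume "a \<in> M k"
    then obtain s b r where *: "s \<notin> P2" "b \<in> L k" "s * a = b + w * r" unfolding M_def by auto
    then have "s * a - w * r \<in> L k" by simp
    then show "a \<in> local_sum P2 UNIV (L k) (range (\<lambda>r. w * r))" unfolding local_sum_def using *(1) by blast
  next
    fix a assume "a \<in> local_sum P2 UNIV (L k) (range (\<lambda>r. w * r))"
    then obtain s r where "s \<notin> P2" "s * a - w * r \<in> L k" unfolding local_sum_def by auto
    moreover have "s * a = (s * a - w * r) + w * r" by simp
    ultimately show "a \<in> M k" unfolding M_def by blast
  qed
  have Mi: "is_ideal (M k)" for k
    unfolding M_eq by (rule local_sum_ideal[OF P(3) is_ideal_UNIV Li principal_ideal])
  have LM: "L k \<subseteq> M k" for k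
  proof
    fix x assume "x \<in> L k"
    then have "1 * x = x + w * 0 \<and> x \<in> L k" by simp
    then show "x \<in> M k" unfolding M_def using one(2) by blast
  qed
  have JM: "J \<subseteq> M k" for k
  proof -
    have "1 * w = 0 + w * 1" by simp
    then have "w \<in> M k" unfolding M_def using one(2) is_idealD(1)[OF Li] by blast
    then show ?thesis unfolding J_def
      using L0[of k] LM[of k] by (intro adjoin_least Mi) auto
  qed
  have Ms: "x \<in> M k" if "s \<notin> P2" "s * x \<in> M k" for s x k
    using local_sum_saturated[OF P(3), of UNIV] that unfolding M_eq by blast
  have "M (Suc k) \<subseteq> M k" for k unfolding M_def using LS by blast
  then obtain k where k: "\<And>n. k \<le> n \<Longrightarrow> M n = M k"
    by (rule descending_chain_saturated[OF P(3), of UNIV J M, rotated 7]) (use nil Mi JM Ms in auto)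
  have Mk: "M (Suc k) = M k" by (rule k) simp
  have Lk: "\<exists>s b c. s \<notin> P2 \<and> b \<in> L (Suc k) \<and> c \<in> L k \<and> s * a = b + w * c" if a: "a \<in> L k" for a
  proof -
    have "a \<in> M (Suc k)" using LM[of k] a Mk by blast
    then obtain s b c where *: "s \<notin> P2" "b \<in> L (Suc k)" "s * a = b + w * c" unfolding M_def by auto
    have "w * c = s * a - b" using *(3) by simp
    also have "\<dots> \<in> L k" using is_idealD(3)[OF Li a] LS[of k] *(2) is_idealD(6)[OF Li] by blast
    finally have "c \<in> L k" using Ls[OF w1] by simp
    then show ?thesis using * by blast
  qed
  \<comment> \<open>By \<open>Lk\<close>, L k is locally L (Suc k) + w L k, so this is Nakayama's
    lemma. An ideal I maximal between the two replaces generators: modulo I some class a generates L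
    k locally at P2, and a relation (s t - w r) a = 0 with w in P2 and s t outside forces a into
    I.\<close>
  have sub: "L k \<subseteq> L (Suc k)"
  proof (rule ccontr)
    assume nsub: "\<not> L k \<subseteq> L (Suc k)"
    define Q where "Q = (\<lambda>I. is_ideal I \<and> L (Suc k) \<subseteq> I \<and> I \<subseteq> L k \<and> \<not> L k \<subseteq> I \<and>
      (\<forall>s a. s \<notin> P2 \<longrightarrow> s * a \<in> I \<longrightarrow> a \<in> I))"
    have QD: "is_ideal I" if "Q I" for I
      using that unfolding Q_def by blast
    have "Q (L (Suc k))" unfolding Q_def using Li LS nsub Ls P12 by blast
    then obtain I where I: "Q I" and Im: "\<And>K. Q K \<Longrightarrow> I \<subseteq> K \<Longrightarrow> K = I"
      by (rule maximal_such) (erule QD, blast)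
    have Ii: "is_ideal I" "L (Suc k) \<subseteq> I" "I \<subseteq> L k" and Is: "\<And>s a. s \<notin> P2 \<Longrightarrow> s * a \<in> I \<Longrightarrow> a \<in> I"
      using I unfolding Q_def by blast+
    obtain a where a: "a \<in> L k" "a \<notin> I" using I unfolding Q_def by blast
    define K where "K = {x. \<exists>s r. s \<notin> P2 \<and> s * x - r * a \<in> I}"
    have K_eq: "K = local_sum P2 UNIV I (range (\<lambda>r. a * r))"
      unfolding K_def local_sum_def by (auto simp: mult.commute)
    have Ki: "is_ideal K"
      unfolding K_eq by (rule local_sum_ideal[OF P(3) is_ideal_UNIV Ii(1) principal_ideal])
    have IK: "I \<subseteq> K"
    proof
      fix x assume "x \<in> I"
      then have "1 * x - 0 * a \<in> I" by simp
      then show "x \<in> K" unfolding K_def using one by blast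
    qed
    have "1 * a - 1 * a \<in> I" using is_idealD(1)[OF Ii(1)] by simp
    then have aK: "a \<in> K" unfolding K_def using one by blast
    have "L k \<subseteq> K"
    proof (rule ccontr)
      assume "\<not> L k \<subseteq> K"
      moreover have "K \<subseteq> L k"
      proof
        fix x assume "x \<in> K"
        then obtain s r where sr: "s \<notin> P2" "s * x - r * a \<in> I" unfolding K_def by auto
        then have "s * x \<in> L k"
          using ideal_diff_iff[OF Li[of k], of "s * x" "r * a"] Ii(3) is_idealD(3)[OF Li a(1)] by blast
        then show "x \<in> L k" using Ls[OF P12[OF sr(1)]] by blast
      qed
      moreover have "x \<in> K" if "s \<notin> P2" "s * x \<in> K" for s x
        using local_sum_saturated[OF P(3), of UNIV] that unfolding K_eq by blast
      ultimately have "Q K" unfolding Q_def using Ki Ii(2) IK by blast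
      then have "K = I" using Im IK by blast
      then show False using aK a(2) by simp
    qed
    obtain s b c where sbc: "s \<notin> P2" "b \<in> L (Suc k)" "c \<in> L k" "s * a = b + w * c"
      using Lk[OF a(1)] by (elim exE conjE)
    obtain t r where tr: "t \<notin> P2" "t * c - r * a \<in> I" using sbc(3) \<open>L k \<subseteq> K\<close> unfolding K_def by auto
    have "(s * t - w * r) * a = t * (s * a) - w * (r * a)" by (simp add: algebra_simps)
    also have "\<dots> = t * b + w * (t * c - r * a)" unfolding sbc(4) by (simp add: algebra_simps)
    also have "\<dots> \<in> I" using tr(2) sbc(2) Ii(2) is_idealD(2,3)[OF Ii(1)] by blast
    finally have "(s * t - w * r) * a \<in> I" .
    moreover have "s * t - w * r \<notin> P2"
      using ideal_diff_iff[OF i2, of "s * t" "w * r"] m2[OF sbc(1) tr(1)] is_idealD(4)[OF i2 P(6)] 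
      by blast
    ultimately show False using Is a(2) by blast
  qed
  \<comment> \<open>The inclusion gives t u^k = u^(k+1) r modulo P0 with t outside P1. Cancelling
    u^k in the domain R/P0 makes t a multiple of u modulo P0, so t lies in P1.\<close>
  have "1 * u ^ k - u ^ k * 1 \<in> P0" using is_idealD(1)[OF i0] by simp
  then have "u ^ k \<in> L k" unfolding L_def using one by blast
  then have "u ^ k \<in> L (Suc k)" using sub by blast
  then obtain t r where tr: "t \<notin> P1" "t * u ^ k - u ^ Suc k * r \<in> P0" unfolding L_def by auto
  have "u ^ k * (t - u * r) \<in> P0" using tr(2) by (simp add: algebra_simps)
  moreover have "u ^ k \<notin> P0" using prime_ideal_power[OF P(1)] u(2) by blast
  ultimately have "t - u * r \<in> P0" using prime_idealD(3)[OF P(1)] by blast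
  then have "t - u * r \<in> P1" using P(4) by blast
  then have "t \<in> P1" using ideal_diff_iff[OF i1, of t "u * r"] is_idealD(4)[OF i1 u(1)] by blast
  then show False using tr(1) by simp
qed

end

section \<open>Chains of primes and coheight\<close>

definition spec_less :: "('a::comm_ring_1 set \<times> 'a set) set" where
  "spec_less = {(P, Q). prime_ideal P \<and> prime_ideal Q \<and> P \<subset> Q}"

text \<open>A chain that merely begins above p may have its first member replaced by p. Coheight
  thus becomes a matter of relation powers, which are easy to split and concatenate.\<close>

lemma prime_chain_above_iff:
  assumes "prime_ideal p"
  shows "prime_chain_above p n \<longleftrightarrow> (\<exists>Q. (p, Q) \<in> spec_less ^^ n)"
proof
  assume "prime_chain_above p n"
  then obtain q where q: "p \<subseteq> q 0" "\<forall>k\<le>n. prime_ideal (q k)" "\<forall>k<n. q k \<subset> q (Suc k)"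
    unfolding prime_chain_above_def by blast
  define q' where "q' = q(0 := p)"
  have "q' k \<subset> q' (Suc k)" if "k < n" for k
    using q(1,3) that by (cases k) (auto simp: q'_def)
  moreover have "prime_ideal (q' k)" if "k \<le> n" for k
    using q(2) assms that by (auto simp: q'_def)
  ultimately have "\<forall>i<n. (q' i, q' (Suc i)) \<in> spec_less"
    by (simp add: spec_less_def)
  then have "(p, q' n) \<in> spec_less ^^ n"
    unfolding relpow_fun_conv by (intro exI[of _ q']) (simp add: q'_def)
  then show "\<exists>Q. (p, Q) \<in> spec_less ^^ n" by blast
next
  assume "\<exists>Q. (p, Q) \<in> spec_less ^^ n"
  then obtain Q f where f: "f 0 = p" "\<forall>i<n. (f i, f (Suc i)) \<in> spec_less"
    unfolding relpow_fun_conv by blast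
  have "prime_ideal (f k)" if "k \<le> n" for k
    using f assms that by (cases k) (auto simp: spec_less_def)
  then show "prime_chain_above p n"
    unfolding prime_chain_above_def using f by (intro exI[of _ f]) (auto simp: spec_less_def)
qed

lemma prime_chain_above_Suc:
  assumes "prime_ideal p" "prime_ideal q" "p \<subset> q" "prime_chain_above q n"
  shows "prime_chain_above p (Suc n)"
proof -
  obtain Q where "(q, Q) \<in> spec_less ^^ n" using assms(4) prime_chain_above_iff[OF assms(2)] by blast
  moreover have "(p, q) \<in> spec_less" using assms by (simp add: spec_less_def)
  ultimately show ?thesis
    unfolding prime_chain_above_iff[OF assms(1)] by (intro exI[of _ Q]) (rule relpow_Suc_I2)
qed

lemma prime_chain_above_0: "prime_ideal p \<Longrightarrow> prime_chain_above p 0"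
  by (auto simp: prime_chain_above_iff)

context noetherian begin

text \<open>The element w is moved down the chain: the principal ideal theorem, applied to the three
  topmost primes, replaces the second highest by one containing w. Repetition puts w into the prime
  next to p, whose coheight is thus only one smaller.\<close>

lemma chain_through:
  fixes p :: "'a set"
  shows "(p, Q) \<in> spec_less ^^ Suc n \<Longrightarrow> w \<in> Q \<Longrightarrow>
    \<exists>q. (p, q) \<in> spec_less \<and> w \<in> q \<and> (q, Q) \<in> spec_less ^^ n"
proof (induction n arbitrary: Q)
  case 0
  then show ?case by auto
next
  case (Suc n)
  obtain A where A: "(p, A) \<in> spec_less ^^ Suc n" "(A, Q) \<in> spec_less"
    using Suc.prems(1) by (rule relpow_Suc_E)
  obtain A0 where A0: "(p, A0) \<in> spec_less ^^ n" "(A0, A) \<in> spec_less"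
    using A(1) by (rule relpow_Suc_E)
  obtain B where B: "prime_ideal B" "A0 \<subset> B" "B \<subset> Q" "w \<in> B"
    using principal_ideal_chain[of A0 A Q w] A(2) A0(2) Suc.prems(2) unfolding spec_less_def by auto
  then have B': "(A0, B) \<in> spec_less" "(B, Q) \<in> spec_less"
    using A(2) A0(2) by (auto simp: spec_less_def)
  then have "(p, B) \<in> spec_less ^^ Suc n" using A0(1) by (intro relpow_Suc_I)
  then obtain q where q: "(p, q) \<in> spec_less" "w \<in> q" "(q, B) \<in> spec_less ^^ n"
    using Suc.IH B(4) by blast
  have "(q, Q) \<in> spec_less ^^ Suc n" using q(3) B'(2) by (rule relpow_Suc_I)
  then show ?case using q by blast
qed

end

section \<open>Local rings and cutting down by parameters\<close>

locale noetherian_local = noetherian ty for ty :: "'a::comm_ring_1 itself" +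
  fixes m :: "'a set"
  assumes loc: "local_ring m"
begin

lemma m_ideal: "is_ideal m" and m_proper: "1 \<notin> m"
  and m_max: "\<And>J. is_ideal J \<Longrightarrow> m \<subseteq> J \<Longrightarrow> J = m \<or> J = UNIV"
  using loc unfolding local_ring_def maximal_ideal_def by blast+

lemma proper_ideal_subset: "is_ideal I \<Longrightarrow> 1 \<notin> I \<Longrightarrow> I \<subseteq> m"
proof -
  assume I: "is_ideal I" "1 \<notin> I"
  define Q where "Q = (\<lambda>J :: 'a set. is_ideal J \<and> 1 \<notin> J \<and> I \<subseteq> J)"
  have QD: "\<And>J. Q J \<Longrightarrow> is_ideal J" by (simp add: Q_def)
  have "Q I" using I by (simp add: Q_def)
  then obtain M where M: "Q M" and max: "\<And>J. Q J \<Longrightarrow> M \<subseteq> J \<Longrightarrow> J = M"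
    by (rule maximal_such[of Q]) (erule QD, blast)
  have "J = M \<or> J = UNIV" if J: "is_ideal J" "M \<subseteq> J" for J
  proof (cases "1 \<in> J")
    case True
    then show ?thesis using ideal_one[OF J(1)] by blast
  next
    case False
    then have "Q J" using J M unfolding Q_def by blast
    then show ?thesis using max J(2) by blast
  qed
  then have "maximal_ideal M" using M unfolding maximal_ideal_def Q_def by blast
  then have "M = m" using loc unfolding local_ring_def by blast
  then show ?thesis using M unfolding Q_def by blast
qed

lemma prime_subset: "prime_ideal P \<Longrightarrow> P \<subseteq> m"
  using proper_ideal_subset prime_idealD by blast

lemma unit_iff: "s \<notin> m \<Longrightarrow> \<exists>t. t * s = 1"
proof -
  assume s: "s \<notin> m"
  have Z: "is_ideal {0::'a}" by (simp add: is_ideal_def)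
  have "s \<in> adjoin {0} [s]" using adjoin_set[OF Z, of "[s]"] by simp
  then have "1 \<in> adjoin {0} [s]"
    using proper_ideal_subset[OF adjoin_ideal[OF Z], of "[s]"] s by blast
  then show ?thesis by (auto simp: adjoin.simps(2))
qed

lemma m_prime: "prime_ideal m"
  unfolding prime_ideal_def
proof (intro conjI allI impI m_ideal m_proper)
  fix a b assume ab: "a * b \<in> m"
  show "a \<in> m \<or> b \<in> m"
  proof (rule disjCI)
    assume "b \<notin> m"
    then obtain t where t: "t * b = 1" using unit_iff by blast
    have "t * (a * b) \<in> m" using ab is_idealD(3)[OF m_ideal] by blast
    moreover have "t * (a * b) = a * (t * b)" by (simp add: mult_ac)
    ultimately show "a \<in> m" using t by simp
  qed
qed

lemma cancel_unit: "is_ideal I \<Longrightarrow> s \<notin> m \<Longrightarrow> s * a \<in> I \<Longrightarrow> a \<in> I"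
proof -
  assume I: "is_ideal I" and s: "s \<notin> m" "s * a \<in> I"
  obtain t where t: "t * s = 1" using unit_iff s(1) by blast
  have "t * (s * a) \<in> I" using s(2) is_idealD(3)[OF I] by blast
  then show "a \<in> I" using t by (simp add: mult.assoc[symmetric])
qed

text \<open>The ideal J + (zs) is m-primary or the unit ideal. Quantifying over primes keeps the
  condition easy to pass on to larger J.\<close>

definition m_primary :: "'a set \<Rightarrow> 'a list \<Rightarrow> bool" where
  "m_primary J zs \<longleftrightarrow> (\<forall>Q. prime_ideal Q \<longrightarrow> J \<subseteq> Q \<longrightarrow> set zs \<subseteq> Q \<longrightarrow> Q = m)"

lemma m_primary_power:
  assumes "m_primary J zs" "is_ideal I" "J \<subseteq> I" "\<And>z. z \<in> set zs \<Longrightarrow> z ^ n \<in> I" "c \<in> m"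
  obtains k where "c ^ k \<in> I"
proof (rule power_in_ideal[OF assms(2)])
  fix Q assume Q: "prime_ideal Q" "I \<subseteq> Q"
  have "set zs \<subseteq> Q" using assms(4) Q prime_ideal_power[OF Q(1)] by blast
  then have "Q = m" using assms(1,3) Q unfolding m_primary_def by blast
  then show "c \<in> Q" using assms(5) by simp
qed (use that in blast)

text \<open>The primes \<open>q\<close> arise by cutting with elements avoiding the finitely many primes already found;
  the principal ideal theorem guarantees that the coheight drops by one only.\<close>

lemma infinitely_many_cuts:
  assumes p: "prime_ideal p" "prime_chain_above p (Suc d)" and d: "1 \<le> d"
    and prim: "m_primary p (z # zs)" and z: "z \<in> m"
  shows "infinite {q. prime_ideal q \<and> p \<subset> q \<and> prime_chain_above q d \<and> m_primary q zs}" (is "infinite ?S")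
proof
  assume fin: "finite ?S"
  have pi: "is_ideal p" using p(1) prime_idealD(1) by blast
  obtain F where F: "finite F" "\<And>P. P \<in> F \<Longrightarrow> prime_ideal P \<and> adjoin p zs \<subseteq> P"
    "\<And>Q. prime_ideal Q \<Longrightarrow> adjoin p zs \<subseteq> Q \<Longrightarrow> \<exists>P\<in>F. P \<subseteq> Q"
    using finite_primes_below[OF adjoin_ideal[OF pi], of zs] by metis
  \<comment> \<open>Avoiding the members of F other than m lets w cut down p + (zs); avoiding ?S
    ensures that the prime obtained through w is new.\<close>
  let ?G = "(F - {m}) \<union> ?S"
  have nm: "\<not> m \<subseteq> P" if P: "P \<in> ?G" for P
  proof
    assume mP: "m \<subseteq> P"
    have Pp: "prime_ideal P" using P F(2) by blast
    then have Pm: "P = m" using prime_subset mP by blast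
    then have "prime_chain_above P d" using P by blast
    then obtain Q where Q: "(m, Q) \<in> spec_less ^^ d" using Pm prime_chain_above_iff[OF Pp] by blast
    obtain e where e: "d = Suc e" using d by (cases d) auto
    obtain B where "(m, B) \<in> spec_less" using Q unfolding e by (rule relpow_Suc_E2)
    then show False using prime_subset[of B] unfolding spec_less_def by blast
  qed
  obtain w where w: "w \<in> m" "\<And>P. P \<in> ?G \<Longrightarrow> w \<notin> P"
  proof (rule prime_avoidance[OF _ m_ideal])
    show "finite ?G" using F(1) fin by blast
    show "prime_ideal P \<and> \<not> m \<subseteq> P" if "P \<in> ?G" for P
      using that nm[OF that] F(2) by blast
  qed (use that in blast)
  obtain Q where Q: "(p, Q) \<in> spec_less ^^ Suc (Suc (d - 1))"
    using p d prime_chain_above_iff[OF p(1), of "Suc d"] by auto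
  obtain Q' where Q': "(p, Q') \<in> spec_less ^^ Suc (d - 1)" "(Q', Q) \<in> spec_less"
    using Q by (rule relpow_Suc_E)
  have "\<exists>Q. (p, Q) \<in> spec_less ^^ Suc d \<and> w \<in> Q"
  proof -
    have "prime_ideal Q'" "Q' \<subset> m" using Q'(2) prime_subset[of Q] by (auto simp: spec_less_def)
    then have "(Q', m) \<in> spec_less" using m_prime by (simp add: spec_less_def)
    then have "(p, m) \<in> spec_less ^^ Suc (Suc (d - 1))" using Q'(1) by (rule relpow_Suc_I[rotated])
    then show ?thesis using w(1) d by auto
  qed
  then obtain Q where "(p, Q) \<in> spec_less ^^ Suc d" "w \<in> Q" by blast
  then obtain q where q: "(p, q) \<in> spec_less" "w \<in> q" "(q, Q) \<in> spec_less ^^ d"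
    using chain_through by blast
  have qp: "prime_ideal q" "p \<subset> q" using q(1) by (auto simp: spec_less_def)
  have "m_primary q zs" unfolding m_primary_def
  proof (intro allI impI)
    fix P assume P: "prime_ideal P" "q \<subseteq> P" "set zs \<subseteq> P"
    have "adjoin p zs \<subseteq> P" using P qp by (intro adjoin_least prime_idealD(1)) auto
    then obtain A where A: "A \<in> F" "A \<subseteq> P" using F(3) P(1) by blast
    \<comment> \<open>Were P smaller than m, the chain A \<subset> P \<subset> m would give a prime
      B containing z strictly between A and m. But m is the only prime that contains p, z and
      zs.\<close>
    show "P = m"
    proof (rule ccontr)
      assume "P \<noteq> m"
      then have Pm: "P \<subset> m" using prime_subset P(1) by blast
      then have "A \<in> ?G" using A by blast
      then have "w \<notin> A" using w(2) by blast
      then have AP: "A \<subset> P" using A(2) q(2) P(2) by blast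
      obtain B where B: "prime_ideal B" "A \<subset> B" "B \<subset> m" "z \<in> B"
        using principal_ideal_chain[OF _ P(1) m_prime AP Pm z] F(2)[OF A(1)] by blast
      have "p \<subseteq> B" "set zs \<subseteq> B"
        using F(2)[OF A(1)] B(2) adjoin_sup[of p zs] adjoin_set[OF pi, of zs] by blast+
      then have "B = m" using prim B unfolding m_primary_def by simp
      then show False using B(3) by blast
    qed
  qed
  then have "q \<in> ?S" using qp q(3) prime_chain_above_iff[OF qp(1)] by blast
  then show False using w(2)[of q] q(2) by blast
qed

end

section \<open>Artinian modules and the injective hull\<close>

locale scalar_module = module scale
  for scale :: "'a::comm_ring_1 \<Rightarrow> 'b::ab_group_add \<Rightarrow> 'b" (infixr "*s" 75)
begin

text \<open>The quotient Z/B is Artinian, expressed by submodules between B and Z.\<close>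

definition dcc :: "'b set \<Rightarrow> 'b set \<Rightarrow> bool" where
  "dcc B Z \<longleftrightarrow> (\<forall>U :: nat \<Rightarrow> 'b set. (\<forall>n. subspace (U n) \<and> B \<subseteq> U n \<and> U n \<subseteq> Z \<and> U (Suc n) \<subseteq> U n) \<longrightarrow>
     (\<exists>N. \<forall>n\<ge>N. U n = U N))"

lemma dccI:
  assumes "\<And>U. (\<And>n. subspace (U n)) \<Longrightarrow> (\<And>n. B \<subseteq> U n) \<Longrightarrow> (\<And>n. U n \<subseteq> Z) \<Longrightarrow> (\<And>n. U (Suc n) \<subseteq> U n)
    \<Longrightarrow> \<exists>N. \<forall>n\<ge>N. U n = U N"
  shows "dcc B Z"
  unfolding dcc_def by (intro allI impI, rule assms) auto

lemma dccD:
  assumes "dcc B Z" "\<And>n. subspace (U n)" "\<And>n. B \<subseteq> U n" "\<And>n. U n \<subseteq> Z" "\<And>n. U (Suc n) \<subseteq> U n"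
  obtains N where "\<And>n. N \<le> n \<Longrightarrow> U n = U N"
proof -
  have "\<forall>n. subspace (U n) \<and> B \<subseteq> U n \<and> U n \<subseteq> Z \<and> U (Suc n) \<subseteq> U n" using assms(2-5) by simp
  then have "\<exists>N. \<forall>n\<ge>N. U n = U N" using assms(1) unfolding dcc_def by simp
  then obtain N where "\<forall>n\<ge>N. U n = U N" by blast
  then show thesis by (intro that[of N]) iprover
qed

text \<open>A chain \<open>U\<close> is controlled by the submodules \<open>x\<^sup>k U\<^sub>i \<inter> (0 : x)\<close>, for which stabilisation is uniform in \<open>k\<close>.\<close>

lemma dcc_torsion:
  assumes B: "subspace B" and Z: "subspace Z" and BZ: "B \<subseteq> Z"
    and tor: "\<And>z. z \<in> Z \<Longrightarrow> \<exists>k. x ^ k *s z \<in> B"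
    and ker: "dcc B {z \<in> Z. x *s z \<in> B}"
  shows "dcc B Z"
proof (rule dccI)
  fix U :: "nat \<Rightarrow> 'b set"
  assume U: "\<And>n. subspace (U n)" "\<And>n. B \<subseteq> U n" "\<And>n. U n \<subseteq> Z" "\<And>n. U (Suc n) \<subseteq> U n"
  define V where "V = (\<lambda>i k. {v \<in> Z. x *s v \<in> B \<and> (\<exists>u\<in>U i. v - x ^ k *s u \<in> B)})"
  have Vs: "subspace (V i k)" for i k
  proof (rule subspaceI)
    show "0 \<in> V i k" unfolding V_def using subspace_0[OF B] subspace_0[OF Z] subspace_0[OF U(1)[of i]]
      by (auto intro!: bexI[of _ 0])
  next
    fix v w assume "v \<in> V i k" "w \<in> V i k"
    then obtain u u' where *: "v \<in> Z" "w \<in> Z" "x *s v \<in> B" "x *s w \<in> B" "u \<in> U i" "u' \<in> U i"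
      "v - x ^ k *s u \<in> B" "w - x ^ k *s u' \<in> B" unfolding V_def by auto
    have "(v + w) - x ^ k *s (u + u') = (v - x ^ k *s u) + (w - x ^ k *s u')"
      by (simp add: scale_right_distrib)
    also have "\<dots> \<in> B" using * subspace_add[OF B] by blast
    finally have "(v + w) - x ^ k *s (u + u') \<in> B" .
    moreover have "x *s (v + w) \<in> B" using * subspace_add[OF B] by (simp add: scale_right_distrib)
    moreover have "v + w \<in> Z" "u + u' \<in> U i" using * subspace_add[OF Z] subspace_add[OF U(1)] by blast+
    ultimately show "v + w \<in> V i k" unfolding V_def by blast
  next
    fix c v assume "v \<in> V i k"
    then obtain u where *: "v \<in> Z" "x *s v \<in> B" "u \<in> U i" "v - x ^ k *s u \<in> B" unfolding V_def by auto
    have "c *s v - x ^ k *s (c *s u) = c *s (v - x ^ k *s u)"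
      by (simp add: scale_right_diff_distrib mult.commute)
    also have "\<dots> \<in> B" using * subspace_scale[OF B] by blast
    finally have "c *s v - x ^ k *s (c *s u) \<in> B" .
    moreover have "x *s (c *s v) \<in> B" using subspace_scale[OF B *(2), of c] by (simp add: mult.commute)
    moreover have "c *s v \<in> Z" "c *s u \<in> U i" using * subspace_scale[OF Z] subspace_scale[OF U(1)] by blast+
    ultimately show "c *s v \<in> V i k" unfolding V_def by blast
  qed
  have VB: "B \<subseteq> V i k" for i k
  proof
    fix v assume v: "v \<in> B"
    have "v - x ^ k *s 0 \<in> B" using v by simp
    then show "v \<in> V i k" unfolding V_def using v BZ subspace_scale[OF B v] subspace_0[OF U(1)] by blast
  qed
  have VK: "V i k \<subseteq> {z \<in> Z. x *s z \<in> B}" for i k by (auto simp: V_def)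
  have Udec: "U j \<subseteq> U i" if "i \<le> j" for i j using lift_Suc_antimono_le[of U, OF U(4) that] .
  have Vi: "V j k \<subseteq> V i k" if "i \<le> j" for i j k unfolding V_def using Udec[OF that] by blast
  have Vk: "V i (Suc k) \<subseteq> V i k" for i k
  proof
    fix v assume "v \<in> V i (Suc k)"
    then obtain u where *: "v \<in> Z" "x *s v \<in> B" "u \<in> U i" "v - x ^ k *s (x *s u) \<in> B"
      unfolding V_def by (auto simp: mult.commute)
    then show "v \<in> V i k" unfolding V_def using subspace_scale[OF U(1)] by blast
  qed
  have Vk': "V i l \<subseteq> V i k" if "k \<le> l" for i k l using lift_Suc_antimono_le[of "V i", OF Vk that] .
  \<comment> \<open>V decreases in both arguments, so the diagonal chain settles all pairs i, k
    \<ge> N at once. The finitely many k < N are treated one by one.\<close>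
  have "V (Suc n) (Suc n) \<subseteq> V n n" for n using Vi[of n "Suc n" "Suc n"] Vk[of n n] by simp
  then obtain N where N: "\<And>n. N \<le> n \<Longrightarrow> V n n = V N N"
    by (rule dccD[OF ker, of "\<lambda>n. V n n", rotated 3]) (use Vs VB VK in auto)
  have big: "V i k = V N N" if "N \<le> i" "N \<le> k" for i k
  proof -
    have "V (max i k) (max i k) = V N N" using that by (intro N) simp
    moreover have "V (max i k) (max i k) \<subseteq> V i k"
      using Vi[of i "max i k" "max i k"] Vk'[of k "max i k" i] by simp
    moreover have "V i k \<subseteq> V N N" using Vi[OF that(1), of k] Vk'[OF that(2), of N] by simp
    ultimately show ?thesis by simp
  qed
  have "\<exists>Nk. \<forall>i\<ge>Nk. V i k = V Nk k" for k
  proof -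
    have "V (Suc n) k \<subseteq> V n k" for n using Vi by simp
    then obtain M where "\<And>n. M \<le> n \<Longrightarrow> V n k = V M k"
      by (rule dccD[OF ker, of "\<lambda>n. V n k", rotated 3]) (use Vs VB VK in auto)
    then show ?thesis by (intro exI[of _ M] allI impI)
  qed
  then obtain g where g: "\<And>k i. g k \<le> i \<Longrightarrow> V i k = V (g k) k" by metis
  define M where "M = N + (\<Sum>k<N. g k)"
  have stab: "V i k = V M k" if "M \<le> i" for i k
  proof (cases "k < N")
    case True
    then have "g k \<le> (\<Sum>k<N. g k)" by (intro member_le_sum) auto
    then have "g k \<le> M" by (simp add: M_def)
    then show ?thesis using g[of k i] g[of k M] that by simp
  next
    case False
    then show ?thesis using big[of i k] big[of M k] that by (simp add: M_def)
  qed
  \<comment> \<open>Equality of V M k and V i k supplies u' in U i with x^k u' = x^(k) u modulo B.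
    Subtracting u' lowers the power of x that is needed to reach B.\<close>
  have "u \<in> U i" if iM: "M \<le> i" and "u \<in> U M" "x ^ k *s u \<in> B" for i k u
    using that(2,3)
  proof (induction k arbitrary: u)
    case 0
    then show ?case using U(2)[of i] by auto
  next
    case (Suc k)
    let ?v = "x ^ k *s u"
    have "?v \<in> V M k"
    proof -
      have "?v \<in> Z" using Suc.prems(1) U(3)[of M] subspace_scale[OF Z] by blast
      moreover have "x *s ?v \<in> B" using Suc.prems(2) by simp
      moreover have "?v - x ^ k *s u \<in> B" using subspace_0[OF B] by simp
      ultimately show ?thesis unfolding V_def using Suc.prems(1) by blast
    qed
    then have "?v \<in> V i k" using stab[OF iM] by simp
    then obtain u' where u': "u' \<in> U i" "?v - x ^ k *s u' \<in> B" unfolding V_def by auto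
    have "u - u' \<in> U M" using Suc.prems(1) u'(1) Udec[OF iM] subspace_diff[OF U(1)] by blast
    moreover have "x ^ k *s (u - u') \<in> B" using u'(2) by (simp add: scale_right_diff_distrib)
    ultimately have "u - u' \<in> U i" by (rule Suc.IH)
    then have "(u - u') + u' \<in> U i" using u'(1) subspace_add[OF U(1)] by blast
    then show ?case by simp
  qed
  then have "U M \<subseteq> U i" if "M \<le> i" for i using tor U(3) that by blast
  then show "\<exists>N. \<forall>n\<ge>N. U n = U N" using Udec by (intro exI[of _ M]) blast
qed

end

section \<open>The injective hull of the residue field is Artinian\<close>

locale matlis = noetherian_local ty m + scalar_module scale
  for ty :: "'a::comm_ring_1 itself" and m :: "'a set"
    and scale :: "'a \<Rightarrow> 'e::ab_group_add \<Rightarrow> 'e" (infixr "*s" 75) +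
  assumes E: "injective_hull_residue scale m"
begin

lemma generator:
  obtains e where "{a. a *s e = 0} = m" "\<And>S. subspace S \<Longrightarrow> S \<noteq> {0} \<Longrightarrow> S \<inter> span {e} \<noteq> {0}"
  using E unfolding injective_hull_residue_def by blast

lemma multiples_subspace: "subspace (range (\<lambda>r. r *s v))"
  by (rule subspaceI) (auto simp: scale_left_distrib[symmetric] intro: range_eqI[of _ _ 0])

lemma essential:
  assumes e: "{a. a *s e = 0} = m" "\<And>S. subspace S \<Longrightarrow> S \<noteq> {0} \<Longrightarrow> S \<inter> span {e} \<noteq> {0}" and v: "v \<noteq> 0"
  obtains r u where "r *s v = u *s e" "r *s v \<noteq> 0" "u \<notin> m"
proof -
  have "v \<in> range (\<lambda>r. r *s v)" by (rule range_eqI[of _ _ 1]) simp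
  then have "range (\<lambda>r. r *s v) \<noteq> {0}" using v by blast
  then have "range (\<lambda>r. r *s v) \<inter> span {e} \<noteq> {0}" using e(2) multiples_subspace by blast
  moreover have "0 \<in> range (\<lambda>r. r *s v) \<inter> span {e}"
    using subspace_0[OF multiples_subspace] span_zero by blast
  ultimately obtain w where w: "w \<in> range (\<lambda>r. r *s v)" "w \<in> span {e}" "w \<noteq> 0" by blast
  obtain r where r: "w = r *s v" using w(1) by blast
  obtain u where u: "w = u *s e" using w(2) unfolding span_singleton by blast
  have "u \<notin> m" using u w(3) e(1) by blast
  then show thesis using that[of r u] r u w(3) by simp
qed

lemma annihilator_ideal: "is_ideal {a. \<forall>v\<in>V. a *s v = 0}"
  unfolding is_ideal_def by (auto simp: scale_left_distrib scale_scale[symmetric] simp del: scale_scale)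

text \<open>The annihilators of x^n v stabilise at some N. If x^N v were nonzero, essentiality would
  give a nonzero multiple of it in R e. That multiple is killed by x, so its coefficient annihilates
  x^(N+1) v and hence already x^N v.\<close>

lemma m_torsion: "x \<in> m \<Longrightarrow> \<exists>n. x ^ n *s v = 0"
proof (rule ccontr)
  assume x: "x \<in> m" and no: "\<nexists>n. x ^ n *s v = 0"
  obtain e where e: "{a. a *s e = 0} = m" "\<And>S. subspace S \<Longrightarrow> S \<noteq> {0} \<Longrightarrow> S \<inter> span {e} \<noteq> {0}"
    using generator by blast
  define I where "I = (\<lambda>n. {a. a *s (x ^ n *s v) = 0})"
  have "is_ideal (I n)" for n using annihilator_ideal[of "{x ^ n *s v}"] by (simp add: I_def)
  moreover have "I n \<subseteq> I (Suc n)" for n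
  proof
    fix a assume "a \<in> I n"
    then have "x *s (a *s (x ^ n *s v)) = 0" by (simp add: I_def)
    then show "a \<in> I (Suc n)" by (simp add: I_def mult_ac)
  qed
  ultimately obtain N where N: "\<And>n. N \<le> n \<Longrightarrow> I n = I N" using ascending_chain[of I] by metis
  have "x ^ N *s v \<noteq> 0" using no by blast
  then obtain r u where ru: "r *s (x ^ N *s v) = u *s e" "r *s (x ^ N *s v) \<noteq> 0"
    using essential[OF e] by metis
  have "x *s e = 0" using e(1) x by blast
  then have "x *s (u *s e) = 0" by (metis scale_left_commute scale_zero_right)
  then have "x *s (r *s (x ^ N *s v)) = 0" using ru(1) by metis
  then have "r \<in> I (Suc N)" by (simp add: I_def mult_ac)
  then have "r \<in> I N" using N[of "Suc N"] by simp
  then show False using ru(2) by (simp add: I_def)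
qed

text \<open>The socle is a one-dimensional space over the residue field: a submodule with a nonzero
  element contains e by essentiality, and each socle element is a multiple of e.\<close>

lemma dcc_socle: "dcc {0} {v. \<forall>a\<in>m. a *s v = 0}"
proof (rule dccI)
  fix U :: "nat \<Rightarrow> 'e set"
  assume U: "\<And>n. subspace (U n)" "\<And>n. {0} \<subseteq> U n" "\<And>n. U n \<subseteq> {v. \<forall>a\<in>m. a *s v = 0}" "\<And>n. U (Suc n) \<subseteq> U n"
  obtain e where e: "{a. a *s e = 0} = m" "\<And>S. subspace S \<Longrightarrow> S \<noteq> {0} \<Longrightarrow> S \<inter> span {e} \<noteq> {0}"
    using generator by blast
  have Udec: "U j \<subseteq> U i" if "i \<le> j" for i j using lift_Suc_antimono_le[of U, OF U(4) that] .
  have sub: "w \<in> S" if S: "subspace S" and v: "v \<in> S" "v \<noteq> 0" and w: "\<And>a. a \<in> m \<Longrightarrow> a *s w = 0" for S v w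
  proof (cases "w = 0")
    case True
    then show ?thesis using subspace_0[OF S] by simp
  next
    case False
    obtain r u where ru: "r *s v = u *s e" "u \<notin> m" using essential[OF e v(2)] by metis
    obtain t q where tq: "t *s w = q *s e" "t *s w \<noteq> 0" using essential[OF e False] by metis
    have "t \<notin> m" using tq(2) w by blast
    then obtain t' where t': "t' * t = 1" using unit_iff by blast
    obtain u' where u': "u' * u = 1" using unit_iff ru(2) by blast
    have "e = u' *s (r *s v)" using ru(1) u' by (metis scale_one scale_scale)
    then have eS: "e \<in> S" using subspace_scale[OF S] v(1) by metis
    have "w = t' *s (q *s e)" using tq(1) t' by (metis scale_one scale_scale)
    then show ?thesis using subspace_scale[OF S] eS by metis
  qed
  show "\<exists>N. \<forall>n\<ge>N. U n = U N"
  proof (cases "\<forall>n. \<exists>v\<in>U n. v \<noteq> 0")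
    case True
    have "U 0 \<subseteq> U n" for n
    proof
      fix w assume "w \<in> U 0"
      then have "\<And>a. a \<in> m \<Longrightarrow> a *s w = 0" using U(3) by blast
      then show "w \<in> U n" using True sub[OF U(1)] by metis
    qed
    then have "U n = U 0" for n using Udec[of 0 n] by blast
    then show ?thesis by blast
  next
    case False
    then obtain N where N: "U N \<subseteq> {0}" by blast
    have "U n = U N" if "N \<le> n" for n using Udec[OF that] N U(2)[of n] by blast
    then show ?thesis by blast
  qed
qed

text \<open>Starting from the socle, the condition of being killed by the generators of m is dropped
  one generator at a time. Each step is \<open>dcc_torsion\<close>, as every generator acts locally
  nilpotently.\<close>

lemma dcc_hull: "dcc {0} UNIV"
proof -
  obtain gs where gs: "m = ideal_gen gs" using noeth m_ideal unfolding noetherian_ring_def by blast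
  have gm: "set gs \<subseteq> m"
  proof
    fix y assume "y \<in> set gs"
    then obtain j where j: "j < length gs" "y = gs ! j" by (metis in_set_conv_nth)
    have "y = (\<Sum>k<length gs. (if k = j then 1 else 0) * gs ! k)"
      using j by (simp add: if_distrib[of "\<lambda>c. c * _"] cong: if_cong)
    then show "y \<in> m" unfolding gs ideal_gen_def by (intro CollectI exI)
  qed
  have step: "dcc {0} UNIV" if "set hs \<subseteq> m" "dcc {0} {v. \<forall>g\<in>set hs. g *s v = 0}" for hs
    using that
  proof (induction hs)
    case Nil
    then show ?case by simp
  next
    case (Cons h hs)
    let ?Z = "{v. \<forall>g\<in>set hs. g *s v = 0}"
    have "subspace ?Z"
      by (rule subspaceI) (auto simp: scale_right_distrib scale_left_commute simp del: scale_scale)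
    moreover have "{z \<in> ?Z. h *s z \<in> {0}} = {v. \<forall>g\<in>set (h # hs). g *s v = 0}" by auto
    moreover have "\<exists>k. h ^ k *s z \<in> {0}" for z using m_torsion[of h z] Cons.prems(1) by simp
    ultimately have "dcc {0} ?Z"
      using Cons.prems(2) by (intro dcc_torsion[of "{0}" ?Z h]) (auto simp: subspace_single_0)
    then show ?case using Cons by simp
  qed
  have eq: "{v. \<forall>g\<in>set gs. g *s v = 0} = {v. \<forall>a\<in>m. a *s v = 0}"
  proof -
    have "a *s v = 0" if v: "\<forall>g\<in>set gs. g *s v = 0" and a: "a \<in> m" for a v
    proof -
      obtain c where "a = (\<Sum>j<length gs. c j * gs ! j)" using a unfolding gs ideal_gen_def by blast
      then have "a *s v = (\<Sum>j<length gs. c j *s (gs ! j *s v))" by (simp add: scale_sum_left)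
      also have "\<dots> = (\<Sum>j<length gs. c j *s 0)"
        using v by (intro sum.cong refl) (metis lessThan_iff nth_mem)
      also have "\<dots> = 0" by simp
      finally show ?thesis .
    qed
    then show ?thesis using gm by auto
  qed
  show ?thesis using step[OF gm] dcc_socle eq by simp
qed

text \<open>The map i + a r \<mapsto> a e on I + (r) is well defined because I : r lies in m =
  Ann(e). By injectivity it is multiplication by some v, which I kills, while r v = e.\<close>

lemma separating:
  assumes I: "is_ideal I" and r: "r \<notin> I"
  obtains v where "\<And>a. a \<in> I \<Longrightarrow> a *s v = 0" "r *s v \<noteq> 0"
proof -
  obtain e where e: "{a. a *s e = 0} = m" using generator by blast
  have "1 \<notin> colon I r" using r by (simp add: colon_def)
  then have col: "colon I r \<subseteq> m" using proper_ideal_subset colon_ideal[OF I] by blast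
  define K where "K = adjoin I [r]"
  have Ki: "is_ideal K" unfolding K_def by (rule adjoin_ideal[OF I])
  \<comment> \<open>The coefficient a is determined only up to I : r, so it is the multiple
    \<open>h b *s e\<close>, not \<open>h b\<close>, that depends additively on b.\<close>
  define h where "h = (\<lambda>b. SOME a. b - a * r \<in> I)"
  have h: "b - h b * r \<in> I" if bK: "b \<in> K" for b
  proof -
    obtain i a where "i \<in> I" "b = i + a * r" using bK unfolding K_def adjoin.simps by blast
    then have "b - a * r \<in> I" by simp
    then have "\<exists>a. b - a * r \<in> I" by blast
    then show ?thesis unfolding h_def by (rule someI_ex)
  qed
  have uniq: "h b *s e = a *s e" if "b \<in> K" "b - a * r \<in> I" for a b
  proof -
    have "(b - a * r) - (b - h b * r) \<in> I" using h that is_idealD(6)[OF I] by blast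
    then have "h b - a \<in> colon I r" by (simp add: colon_def algebra_simps)
    then have "(h b - a) *s e = 0" using col e by blast
    then show ?thesis by (simp add: scale_left_diff_distrib)
  qed
  have add: "h (a + b) *s e = h a *s e + h b *s e" if "a \<in> K" "b \<in> K" for a b
  proof -
    have "(a + b) - (h a + h b) * r = (a - h a * r) + (b - h b * r)" by (simp add: algebra_simps)
    also have "\<dots> \<in> I" using h that is_idealD(2)[OF I] by blast
    finally show ?thesis using uniq[of "a + b" "h a + h b"] that is_idealD(2)[OF Ki]
      by (simp add: scale_left_distrib)
  qed
  have mult: "h (c * a) *s e = c *s (h a *s e)" if "a \<in> K" for a c
  proof -
    have "c * a - (c * h a) * r = c * (a - h a * r)" by (simp add: algebra_simps)
    also have "\<dots> \<in> I" using h that is_idealD(3)[OF I] by blast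
    finally show ?thesis using uniq[of "c * a" "c * h a"] that is_idealD(3)[OF Ki] by simp
  qed
  have "baer_injective scale" using E unfolding injective_hull_residue_def by blast
  then have "\<exists>v. \<forall>a\<in>K. h a *s e = a *s v"
    unfolding baer_injective_def using Ki add mult by (elim allE[of _ K] allE[of _ "\<lambda>a. h a *s e"]) blast
  then obtain v where v: "\<And>a. a \<in> K \<Longrightarrow> h a *s e = a *s v" by blast
  have "a *s v = 0" if "a \<in> I" for a
  proof -
    have "a \<in> K" using that adjoin_sup unfolding K_def by blast
    moreover have "a - 0 * r \<in> I" using that by simp
    ultimately show ?thesis using uniq[of a 0] v[of a] by simp
  qed
  moreover have "r *s v \<noteq> 0"
  proof
    assume "r *s v = 0"
    moreover have rK: "r \<in> K" using adjoin_set[OF I, of "[r]"] unfolding K_def by simp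
    moreover have "r - 1 * r \<in> I" using is_idealD(1)[OF I] by simp
    ultimately have "e = 0" using uniq[of r 1] v[of r] by simp
    then have "1 \<in> m" using e by auto
    then show False using m_proper by simp
  qed
  ultimately show thesis using that by blast
qed

text \<open>Families \<open>e\<close> with \<open>e n = f (1 / y\<^sup>n)\<close> for a homomorphism \<open>f\<close> on the top local cohomology of \<open>R/p\<close>,
  where \<open>y\<close> is the product of the \<open>xs\<close>.\<close>
definition family :: "'a list \<Rightarrow> 'a set \<Rightarrow> (nat \<Rightarrow> 'e) \<Rightarrow> bool" where
  "family xs p e \<longleftrightarrow> (\<forall>n. (\<forall>x\<in>set xs. x ^ n *s e n = 0) \<and> (\<forall>a\<in>p. a *s e n = 0) \<and>
     prod_list xs *s e (Suc n) = e n)"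

definition ann :: "(nat \<Rightarrow> 'e) \<Rightarrow> 'a set" where
  "ann e = {a. \<forall>n. a *s e n = 0}"

lemma ann_ideal: "is_ideal (ann e)"
proof -
  have "ann e = {a. \<forall>v\<in>range e. a *s v = 0}" by (auto simp: ann_def)
  then show ?thesis by (simp only: annihilator_ideal)
qed

lemma ann_scale: "ann (\<lambda>n. a *s e n) = colon (ann e) a"
  by (simp add: ann_def colon_def)

lemma familyD:
  assumes "family xs p e"
  shows "\<And>n x. x \<in> set xs \<Longrightarrow> x ^ n *s e n = 0" "\<And>n a. a \<in> p \<Longrightarrow> a *s e n = 0"
    "\<And>n. prod_list xs *s e (Suc n) = e n"
  using assms unfolding family_def by blast+

lemma family_prod_power: "family xs p e \<Longrightarrow> prod_list xs ^ k *s e (n + k) = e n"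
proof (induction k)
  case (Suc k)
  have "prod_list xs ^ Suc k *s e (n + Suc k) = prod_list xs ^ k *s (prod_list xs *s e (Suc (n + k)))"
    by (simp add: mult.commute)
  then show ?case using Suc familyD(3)[OF Suc.prems] by simp
qed simp

lemma family_scale: "family xs p e \<Longrightarrow> family xs p (\<lambda>n. a *s e n)"
  unfolding family_def by (metis scale_left_commute scale_zero_right)

lemma family_zero_ann: "family xs p e \<Longrightarrow> p \<subseteq> ann e"
  using familyD(2) by (auto simp: ann_def)

text \<open>The families \<open>f k\<close> below describe \<open>1/y'\<^sup>n \<mapsto> f (1/(x\<^sup>k y'\<^sup>n))\<close>: the first nonzero one is killed
  by \<open>x\<close>, while \<open>x\<close> does not lie in the annihilator of \<open>e\<close>.\<close>

lemma prime_chain_above_ann: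
  assumes "family xs p e" "prime_ideal (ann e)"
  shows "prime_chain_above (ann e) (length xs)"
  using assms
proof (induction xs arbitrary: p e)
  case Nil
  then show ?case using prime_chain_above_0 by simp
next
  case (Cons x xs)
  define y where "y = prod_list xs"
  \<comment> \<open>The fraction 1/(x^k y^n) brought to the denominator (x y)^(n+k) has the
    numerator y^k x^n.\<close>
  define f where "f = (\<lambda>k n. (y ^ k * x ^ n) *s e (n + k))"
  have e1: "(x * y) *s e (Suc n) = e n" for n using familyD(3)[OF Cons.prems(1), of n] by (simp add: y_def)
  have fS: "x *s f (Suc k) n = f k n" for k n
  proof -
    have "x *s f (Suc k) n = (y ^ k * x ^ n) *s ((x * y) *s e (Suc (n + k)))"
      by (simp add: f_def mult_ac)
    then show ?thesis using e1 by (simp add: f_def)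
  qed
  have f0: "f 0 n = 0" for n using familyD(1)[OF Cons.prems(1), of x n] by (simp add: f_def)
  have fn: "f n n = e n" for n
    using family_prod_power[OF Cons.prems(1), of n n] by (simp add: f_def y_def power_mult_distrib mult.commute)
  have ff: "family xs (ann e) (f k)" for k unfolding family_def
  proof (intro allI conjI ballI)
    fix n a assume "a \<in> ann e"
    then show "a *s f k n = 0" unfolding f_def by (metis (mono_tags) ann_def mem_Collect_eq scale_left_commute scale_zero_right)
  next
    fix n z assume z: "z \<in> set xs"
    then have "z dvd y" unfolding y_def by (rule prod_list_dvd)
    then have "z ^ k dvd y ^ k" by (rule dvd_power_same)
    then obtain c where "y ^ k = z ^ k * c" by (elim dvdE)
    then have "z ^ n *s f k n = (c * x ^ n) *s (z ^ (n + k) *s e (n + k))"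
      by (simp add: f_def power_add mult_ac)
    then show "z ^ n *s f k n = 0" using familyD(1)[OF Cons.prems(1), of z "n + k"] z by simp
  next
    fix n
    have "prod_list xs *s f k (Suc n) = (y ^ k * x ^ n) *s ((x * y) *s e (Suc (n + k)))"
      by (simp add: f_def y_def mult_ac)
    then show "prod_list xs *s f k (Suc n) = f k n" using e1 by (simp add: f_def)
  qed
  have x: "x \<notin> ann e"
  proof
    assume "x \<in> ann e"
    then have "x *s f (Suc n) n = 0" for n using family_zero_ann[OF ff] by (auto simp: ann_def)
    then have "e n = 0" for n using fS[of n n] fn by simp
    then have "1 \<in> ann e" by (simp add: ann_def)
    then show False using prime_idealD(2)[OF Cons.prems(2)] by simp
  qed
  have "\<exists>k. 1 \<notin> ann (f k)"
  proof (rule ccontr)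
    assume "\<nexists>k. 1 \<notin> ann (f k)"
    then have "f n n = 0" for n by (simp add: ann_def)
    then have "1 \<in> ann e" using fn by (simp add: ann_def)
    then show False using prime_idealD(2)[OF Cons.prems(2)] by simp
  qed
  define k where "k = (LEAST k. 1 \<notin> ann (f k))"
  have k: "1 \<notin> ann (f k)" and kmin: "\<And>j. j < k \<Longrightarrow> 1 \<in> ann (f j)"
    unfolding k_def using LeastI_ex[OF \<open>\<exists>k. 1 \<notin> ann (f k)\<close>] not_less_Least by blast+
  obtain j where j: "k = Suc j" using k f0 by (cases k) (auto simp: ann_def)
  have xk: "x \<in> ann (f k)" using kmin[of j] fS j by (simp add: ann_def)
  \<comment> \<open>A multiple of f k with prime annihilator. That prime contains ann e and x, so it
    is strictly larger than ann e and each parameter lengthens the chain by one.\<close>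
  obtain a where a: "a \<notin> ann (f k)" "prime_ideal (colon (ann (f k)) a)"
    using prime_colon[OF ann_ideal k] by blast
  define g where "g = (\<lambda>n. a *s f k n)"
  have g: "family xs (ann e) g" "prime_ideal (ann g)"
    unfolding g_def ann_scale using family_scale[OF ff] a(2) by blast+
  then have "prime_chain_above (ann g) (length xs)" using Cons.IH by blast
  moreover have "x \<in> ann g" unfolding g_def ann_scale
    using xk is_idealD(4)[OF ann_ideal] by (simp add: colon_def)
  then have "ann e \<subset> ann g" using family_zero_ann[OF g(1)] x by blast
  ultimately show ?case using prime_chain_above_Suc[OF Cons.prems(2) g(2)] by simp
qed

end

section \<open>Limits of Koszul complexes\<close>

text \<open>A basis element of the Koszul complex of \<open>n\<close> elements is a subset of the indices, encoded as a
  Boolean list of length \<open>n\<close>; its degree is the number of entries \<open>True\<close>. The complex of \<open>x # xs\<close>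
  is the mapping cone of multiplication by \<open>x\<close> on the complex of \<open>xs\<close>.\<close>

fun koszul :: "'a::comm_ring_1 list \<Rightarrow> (bool list \<Rightarrow> 'a) \<Rightarrow> bool list \<Rightarrow> 'a" where
  "koszul [] c l = 0"
| "koszul (x # xs) c [] = 0"
| "koszul (x # xs) c (b # l) = (if b then x * c (False # l) - koszul xs (\<lambda>k. c (True # k)) l
     else koszul xs (\<lambda>k. c (False # k)) l)"

text \<open>The transition map from the Koszul complex of the t-th powers to that of the (t+s)-th
  powers multiplies the basis element l by \<open>weight xs l ^ s\<close>.\<close>

fun weight :: "'a::comm_ring_1 list \<Rightarrow> bool list \<Rightarrow> 'a" where
  "weight (x # xs) (b # l) = (if b then x else 1) * weight xs l"
| "weight _ _ = 1"

text \<open>Interior multiplication by the i-th basis vector, the homotopy operator of the Koszul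
  complex. The sign comes from passing earlier entries \<open>True\<close>.\<close>

fun contract :: "nat \<Rightarrow> (bool list \<Rightarrow> 'a::comm_ring_1) \<Rightarrow> bool list \<Rightarrow> 'a" where
  "contract i c [] = 0"
| "contract 0 c (b # l) = (if b then 0 else c (True # l))"
| "contract (Suc i) c (b # l) = (if b then - contract i (\<lambda>k. c (True # k)) l
     else contract i (\<lambda>k. c (False # k)) l)"

definition cells :: "nat \<Rightarrow> nat \<Rightarrow> bool list set" where
  "cells n j = {l. length l = n \<and> count_list l True = j}"

lemma finite_cells: "finite (cells n j)"
  by (rule finite_subset[OF _ finite_lists_length_eq[of UNIV n]]) (auto simp: cells_def)

lemma koszul_lin: "koszul xs (\<lambda>l. r * c l + s * d l) l = r * koszul xs c l + s * koszul xs d l"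
proof (induction xs arbitrary: c d l)
  case (Cons x xs)
  then show ?case by (cases l) (auto simp: algebra_simps)
qed simp

lemma koszul_scale: "koszul xs (\<lambda>l. r * c l) l = r * koszul xs c l"
  using koszul_lin[of xs r c 0 c l] by simp

lemma koszul_add: "koszul xs (\<lambda>l. c l + d l) l = koszul xs c l + koszul xs d l"
  using koszul_lin[of xs 1 c 1 d l] by simp

lemma koszul_diff: "koszul xs (\<lambda>l. c l - d l) l = koszul xs c l - koszul xs d l"
  using koszul_lin[of xs 1 c "-1" d l] by simp

lemma koszul_zero: "koszul xs (\<lambda>l. 0) l = 0"
  using koszul_scale[of xs 0 "\<lambda>l. 0" l] by simp

lemma koszul_uminus: "koszul xs (\<lambda>l. - c l) l = - koszul xs c l"
  using koszul_scale[of xs "-1" c l] by simp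

lemma koszul_koszul: "koszul xs (koszul xs c) l = 0"
proof (induction xs arbitrary: c l)
  case (Cons x xs)
  then show ?case by (cases l) (auto simp: koszul_diff koszul_scale)
qed simp

lemma koszul_degree_0: "count_list l True = 0 \<Longrightarrow> koszul xs c l = 0"
proof (induction xs arbitrary: c l)
  case (Cons x xs)
  then show ?case by (cases l) (auto split: if_splits)
qed simp

text \<open>Cochains are functions on all Boolean lists. Since the differential raises the degree by
  one, values outside the cells of degree j do not influence its result in degree j + 1.\<close>

lemma koszul_in_ideal:
  assumes J: "is_ideal J"
  shows "(\<And>k. k \<in> cells (length xs) j \<Longrightarrow> c k \<in> J) \<Longrightarrow> l \<in> cells (length xs) (Suc j) \<Longrightarrow> koszul xs c l \<in> J"
proof (induction xs arbitrary: c l j)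
  case Nil
  then show ?case using is_idealD(1)[OF J] by simp
next
  case (Cons x xs)
  obtain b l' where l: "l = b # l'" using Cons.prems(2) by (cases l) (auto simp: cells_def)
  show ?case
  proof (cases b)
    case True
    have "c (False # l') \<in> J" using Cons.prems l True by (auto simp: cells_def)
    moreover have "koszul xs (\<lambda>k. c (True # k)) l' \<in> J"
    proof (cases j)
      case 0
      then have "count_list l' True = 0" using Cons.prems(2) l True by (simp add: cells_def)
      then show ?thesis using koszul_degree_0 is_idealD(1)[OF J] by metis
    next
      case (Suc i)
      show ?thesis
        by (rule Cons.IH[of i]) (use Cons.prems l True Suc in \<open>auto simp: cells_def\<close>)
    qed
    ultimately show ?thesis using l True is_idealD(3,6)[OF J] by simp
  next
    case False
    have "koszul xs (\<lambda>k. c (False # k)) l' \<in> J"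
      by (rule Cons.IH[of j]) (use Cons.prems l False in \<open>auto simp: cells_def\<close>)
    then show ?thesis using l False by simp
  qed
qed

text \<open>The transition maps commute with the differentials: each step of the differential adds
  one index x, and x^(t+s) = x^t x^s accounts for the additional factor in the weight.\<close>

lemma koszul_weight:
  "koszul (map (\<lambda>x. x ^ (t + s)) xs) (\<lambda>k. weight xs k ^ s * c k) l
    = weight xs l ^ s * koszul (map (\<lambda>x. x ^ t) xs) c l"
proof (induction xs arbitrary: c l)
  case (Cons x xs)
  show ?case
  proof (cases l)
    case (Cons b l')
    have eq: "(\<lambda>k. (x * weight xs k) ^ s * c (True # k)) = (\<lambda>k. x ^ s * (weight xs k ^ s * c (True # k)))"
      by (simp add: power_mult_distrib mult.assoc)
    show ?thesis using Cons.IH Cons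
      by (simp add: eq koszul_scale power_mult_distrib power_add algebra_simps)
  qed simp
qed simp

lemma contract_lin: "contract i (\<lambda>k. r * c k - d k) l = r * contract i c l - contract i d l"
proof (induction i c l arbitrary: d rule: contract.induct)
  case (3 i c b l)
  show ?case
    by (cases b) (simp_all add: 3[simplified] algebra_simps)
qed auto

text \<open>Multiplication by a member of the sequence is null-homotopic, so every member
  annihilates the Koszul cohomology.\<close>

lemma koszul_homotopy:
  "i < length xs \<Longrightarrow> length l = length xs \<Longrightarrow>
    koszul xs (contract i c) l + contract i (koszul xs c) l = xs ! i * c l"
proof (induction xs arbitrary: i c l)
  case (Cons x xs)
  obtain b l' where l: "l = b # l'" using Cons.prems by (cases l) auto
  show ?case
  proof (cases i)
    case 0
    then show ?thesis using l by (cases b) (simp_all add: koszul_zero)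
  next
    case (Suc i')
    have IH: "koszul xs (contract i' d) l' + contract i' (koszul xs d) l' = xs ! i' * d l'" for d
      using Cons.IH[of i' l' d] Cons.prems Suc l by simp
    show ?thesis
      using Suc l IH[of "\<lambda>k. c (b # k)"]
      by (cases b) (simp_all add: koszul_uminus contract_lin algebra_simps)
  qed
qed simp

lemma contract_in_ideal:
  assumes J: "is_ideal J"
  shows "(\<And>k. k \<in> cells n (Suc j) \<Longrightarrow> c k \<in> J) \<Longrightarrow> l \<in> cells n j \<Longrightarrow> contract i c l \<in> J"
proof (induction i c l arbitrary: n j rule: contract.induct)
  case (1 i c)
  then show ?case using is_idealD(1)[OF J] by simp
next
  case (2 c b l)
  then show ?case using is_idealD(1)[OF J] by (auto simp: cells_def)
next
  case (3 i c b l)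
  obtain n' where n: "n = Suc n'" "length l = n'" using 3(4) by (auto simp: cells_def)
  show ?case
  proof (cases b)
    case True
    then obtain j' where j: "j = Suc j'" using 3(4) by (auto simp: cells_def)
    have "contract i (\<lambda>k. c (True # k)) l \<in> J"
      by (rule 3(1)[of n' j']) (use True 3(3,4) n j in \<open>auto simp: cells_def\<close>)
    then show ?thesis using True is_idealD(5)[OF J] by simp
  next
    case False
    have "contract i (\<lambda>k. c (False # k)) l \<in> J"
      by (rule 3(2)[of n' j]) (use False 3(3,4) n in \<open>auto simp: cells_def\<close>)
    then show ?thesis using False by simp
  qed
qed

lemma weight_degree_0: "count_list l True = 0 \<Longrightarrow> weight xs l = 1"
  by (induction xs l rule: weight.induct) (auto split: if_splits)

lemma weight_in_ideal:
  assumes "is_ideal I" "set xs \<subseteq> I"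
  shows "length l = length xs \<Longrightarrow> 0 < count_list l True \<Longrightarrow> weight xs l \<in> I"
  using assms(2) by (induction xs l rule: weight.induct) (auto simp: is_idealD(3,4)[OF assms(1)] split: if_splits)

section \<open>Sequences of Koszul cochains as a module\<close>

interpretation cochains: scalar_module "\<lambda>r (c :: nat \<Rightarrow> bool list \<Rightarrow> 'a::comm_ring_1) t l. r * c t l"
proof
  fix a b :: 'a and x y :: "nat \<Rightarrow> bool list \<Rightarrow> 'a"
  show "(\<lambda>t l. a * (x + y) t l) = (\<lambda>t l. a * x t l) + (\<lambda>t l. a * y t l)"
    by (intro ext) (simp add: distrib_left)
  show "(\<lambda>t l. (a + b) * x t l) = (\<lambda>t l. a * x t l) + (\<lambda>t l. b * x t l)"
    by (intro ext) (simp add: distrib_right)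
  show "(\<lambda>t l. a * (b * x t l)) = (\<lambda>t l. a * b * x t l)"
    by (intro ext) (simp add: mult.assoc)
  show "(\<lambda>t l. 1 * x t l) = x"
    by (intro ext) simp
qed

declare cochains.scale_scale [simp del] cochains.scale_one [simp del]
  cochains.scale_zero_left [simp del] cochains.scale_zero_right [simp del]
  cochains.scale_minus_left [simp del] cochains.scale_minus_right [simp del]

text \<open>The cohomology of \<open>R/J\<close> in degree \<open>j\<close> is the quotient of \<open>cocycles j J\<close> by \<open>coboundaries j J\<close>:
  a class in the limit of the Koszul cohomologies of the powers \<open>zs\<^sup>t\<close> is represented by an
  eventually compatible sequence of Koszul cocycles modulo \<open>J\<close>.\<close>

locale koszul_limit = noetherian_local ty m for ty :: "'a::comm_ring_1 itself" and m :: "'a set" +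
  fixes p :: "'a set" and zs :: "'a list"
  assumes zs_m: "set zs \<subseteq> m" and prim: "m_primary p zs"
begin

definition pows :: "nat \<Rightarrow> 'a list" where
  "pows t = map (\<lambda>x. x ^ t) zs"

definition exact :: "nat \<Rightarrow> nat \<Rightarrow> 'a set \<Rightarrow> (bool list \<Rightarrow> 'a) \<Rightarrow> bool" where
  "exact t j J c \<longleftrightarrow> (\<exists>b. \<forall>l\<in>cells (length zs) j. c l - koszul (pows t) b l \<in> J)"

definition closed :: "nat \<Rightarrow> nat \<Rightarrow> 'a set \<Rightarrow> (bool list \<Rightarrow> 'a) \<Rightarrow> bool" where
  "closed t j J c \<longleftrightarrow> (\<forall>l\<in>cells (length zs) (Suc j). koszul (pows t) c l \<in> J)"

definition cocycles :: "nat \<Rightarrow> 'a set \<Rightarrow> (nat \<Rightarrow> bool list \<Rightarrow> 'a) set" where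
  "cocycles j J = {c. (\<forall>\<^sub>F t in sequentially. exact (Suc t) j J (\<lambda>l. c (Suc t) l - weight zs l * c t l)) \<and>
     (\<forall>\<^sub>F t in sequentially. closed t j J (c t))}"

definition coboundaries :: "nat \<Rightarrow> 'a set \<Rightarrow> (nat \<Rightarrow> bool list \<Rightarrow> 'a) set" where
  "coboundaries j J = {c. \<forall>\<^sub>F t in sequentially. exact t j J (c t)}"

lemma length_pows [simp]: "length (pows t) = length zs"
  by (simp add: pows_def)

lemma koszul_pows_weight:
  "koszul (pows (t + s)) (\<lambda>k. weight zs k ^ s * c k) l = weight zs l ^ s * koszul (pows t) c l"
  unfolding pows_def by (rule koszul_weight)

lemma exact_in: "(\<And>l. l \<in> cells (length zs) j \<Longrightarrow> c l \<in> J) \<Longrightarrow> exact t j J c"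
  unfolding exact_def by (rule exI[of _ "\<lambda>_. 0"]) (simp add: koszul_zero)

lemma exact_add: "is_ideal J \<Longrightarrow> exact t j J c \<Longrightarrow> exact t j J d \<Longrightarrow> exact t j J (\<lambda>l. c l + d l)"
proof -
  assume J: "is_ideal J" and "exact t j J c" "exact t j J d"
  then obtain a b where ab: "\<And>l. l \<in> cells (length zs) j \<Longrightarrow> c l - koszul (pows t) a l \<in> J"
    "\<And>l. l \<in> cells (length zs) j \<Longrightarrow> d l - koszul (pows t) b l \<in> J" unfolding exact_def by blast
  have "(c l + d l) - koszul (pows t) (\<lambda>l. a l + b l) l \<in> J" if "l \<in> cells (length zs) j" for l
    using is_idealD(2)[OF J ab(1)[OF that] ab(2)[OF that]] by (simp add: koszul_add algebra_simps)
  then show ?thesis unfolding exact_def by (intro exI[of _ "\<lambda>l. a l + b l"]) blast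
qed

lemma exact_scale: "is_ideal J \<Longrightarrow> exact t j J c \<Longrightarrow> exact t j J (\<lambda>l. r * c l)"
proof -
  assume J: "is_ideal J" and "exact t j J c"
  then obtain a where a: "\<And>l. l \<in> cells (length zs) j \<Longrightarrow> c l - koszul (pows t) a l \<in> J"
    unfolding exact_def by blast
  have "r * c l - koszul (pows t) (\<lambda>l. r * a l) l \<in> J" if "l \<in> cells (length zs) j" for l
    using is_idealD(3)[OF J a[OF that], of r] by (simp add: koszul_scale algebra_simps)
  then show ?thesis unfolding exact_def by (intro exI[of _ "\<lambda>l. r * a l"]) blast
qed

lemma exact_cong:
  "is_ideal J \<Longrightarrow> exact t j J c \<Longrightarrow> exact t j J (\<lambda>l. d l - c l) \<Longrightarrow> exact t j J d"
  using exact_add[of J t j c "\<lambda>l. d l - c l"] by simp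

lemma exact_weight: "is_ideal J \<Longrightarrow> exact t j J c \<Longrightarrow> exact (t + s) j J (\<lambda>l. weight zs l ^ s * c l)"
proof -
  assume J: "is_ideal J" and "exact t j J c"
  then obtain a where a: "\<And>l. l \<in> cells (length zs) j \<Longrightarrow> c l - koszul (pows t) a l \<in> J"
    unfolding exact_def by blast
  have "weight zs l ^ s * c l - koszul (pows (t + s)) (\<lambda>l. weight zs l ^ s * a l) l \<in> J"
    if "l \<in> cells (length zs) j" for l
    using is_idealD(3)[OF J a[OF that], of "weight zs l ^ s"]
    by (simp add: koszul_pows_weight right_diff_distrib)
  then show ?thesis unfolding exact_def by (intro exI[of _ "\<lambda>l. weight zs l ^ s * a l"]) blast
qed

lemma exact_mono: "J \<subseteq> K \<Longrightarrow> exact t j J c \<Longrightarrow> exact t j K c"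
  unfolding exact_def by blast

lemma exact_koszul: "is_ideal J \<Longrightarrow> exact t j J (koszul (pows t) b)"
  unfolding exact_def by (intro exI[of _ b]) (simp add: is_idealD(1))

lemma exact_closed: "is_ideal J \<Longrightarrow> exact t j J c \<Longrightarrow> closed t j J c"
proof -
  assume J: "is_ideal J" and "exact t j J c"
  then obtain a where a: "\<And>l. l \<in> cells (length zs) j \<Longrightarrow> c l - koszul (pows t) a l \<in> J"
    unfolding exact_def by blast
  have "koszul (pows t) (\<lambda>l. c l - koszul (pows t) a l) l \<in> J" if "l \<in> cells (length zs) (Suc j)" for l
    by (rule koszul_in_ideal[OF J, of _ j]) (use a that in auto)
  then show ?thesis by (simp add: closed_def koszul_diff koszul_koszul)
qed

lemma subspace_coboundaries: "is_ideal J \<Longrightarrow> cochains.subspace (coboundaries j J)"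
proof (rule cochains.subspaceI)
  assume J: "is_ideal J"
  show "0 \<in> coboundaries j J" unfolding coboundaries_def
    using exact_in is_idealD(1)[OF J] by simp
  show "c + d \<in> coboundaries j J" if cd: "c \<in> coboundaries j J" "d \<in> coboundaries j J" for c d
  proof -
    have "\<forall>\<^sub>F t in sequentially. exact t j J (c t)" "\<forall>\<^sub>F t in sequentially. exact t j J (d t)"
      using cd by (simp_all add: coboundaries_def)
    then have "\<forall>\<^sub>F t in sequentially. exact t j J ((c + d) t)"
      by eventually_elim (use exact_add[OF J] in \<open>simp add: plus_fun_def\<close>)
    then show ?thesis by (simp add: coboundaries_def)
  qed
  show "(\<lambda>t l. r * c t l) \<in> coboundaries j J" if c: "c \<in> coboundaries j J" for r c
  proof -
    have "\<forall>\<^sub>F t in sequentially. exact t j J (c t)" using c by (simp add: coboundaries_def)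
    then have "\<forall>\<^sub>F t in sequentially. exact t j J (\<lambda>l. r * c t l)"
      by eventually_elim (rule exact_scale[OF J])
    then show ?thesis by (simp add: coboundaries_def)
  qed
qed

lemma subspace_cocycles: "is_ideal J \<Longrightarrow> cochains.subspace (cocycles j J)"
proof (rule cochains.subspaceI)
  assume J: "is_ideal J"
  show "0 \<in> cocycles j J" unfolding cocycles_def closed_def
    using exact_in is_idealD(1)[OF J] by (simp add: zero_fun_def koszul_zero)
  show "c + d \<in> cocycles j J" if cd: "c \<in> cocycles j J" "d \<in> cocycles j J" for c d
  proof -
    have "\<forall>\<^sub>F t in sequentially. exact (Suc t) j J (\<lambda>l. c (Suc t) l - weight zs l * c t l)"
      "\<forall>\<^sub>F t in sequentially. exact (Suc t) j J (\<lambda>l. d (Suc t) l - weight zs l * d t l)"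
      using cd by (simp_all add: cocycles_def)
    then have "\<forall>\<^sub>F t in sequentially. exact (Suc t) j J (\<lambda>l. (c + d) (Suc t) l - weight zs l * (c + d) t l)"
      by eventually_elim (drule (1) exact_add[OF J], simp add: algebra_simps)
    moreover have "\<forall>\<^sub>F t in sequentially. closed t j J (c t)" "\<forall>\<^sub>F t in sequentially. closed t j J (d t)"
      using cd by (simp_all add: cocycles_def)
    then have "\<forall>\<^sub>F t in sequentially. closed t j J ((c + d) t)"
      by eventually_elim (simp add: closed_def plus_fun_def koszul_add is_idealD(2)[OF J])
    ultimately show ?thesis by (simp add: cocycles_def)
  qed
  show "(\<lambda>t l. r * c t l) \<in> cocycles j J" if c: "c \<in> cocycles j J" for r c
  proof -
    have "\<forall>\<^sub>F t in sequentially. exact (Suc t) j J (\<lambda>l. c (Suc t) l - weight zs l * c t l)"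
      using c by (simp add: cocycles_def)
    then have "\<forall>\<^sub>F t in sequentially. exact (Suc t) j J (\<lambda>l. r * c (Suc t) l - weight zs l * (r * c t l))"
      by eventually_elim (drule exact_scale[OF J, of _ _ _ r], simp add: algebra_simps)
    moreover have "\<forall>\<^sub>F t in sequentially. closed t j J (c t)" using c by (simp add: cocycles_def)
    then have "\<forall>\<^sub>F t in sequentially. closed t j J (\<lambda>l. r * c t l)"
      by eventually_elim (simp add: closed_def koszul_scale is_idealD(3)[OF J])
    ultimately show ?thesis by (simp add: cocycles_def)
  qed
qed

lemma coboundaries_subset: "is_ideal J \<Longrightarrow> coboundaries j J \<subseteq> cocycles j J"
proof
  fix c assume J: "is_ideal J" and "c \<in> coboundaries j J"
  then have c: "\<forall>\<^sub>F t in sequentially. exact t j J (c t)" by (simp add: coboundaries_def)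
  then have "\<forall>\<^sub>F t in sequentially. closed t j J (c t)"
    by eventually_elim (rule exact_closed[OF J])
  moreover have "\<forall>\<^sub>F t in sequentially. exact (Suc t) j J (c (Suc t))"
    using c by (subst eventually_sequentially_Suc)
  with c have "\<forall>\<^sub>F t in sequentially. exact (Suc t) j J (\<lambda>l. c (Suc t) l - weight zs l * c t l)"
  proof eventually_elim
    case (elim t)
    then have "exact (t + 1) j J (\<lambda>l. weight zs l ^ 1 * c t l)" by (intro exact_weight J)
    then have "exact (Suc t) j J (\<lambda>l. (-1) * (weight zs l * c t l))"
      using exact_scale[OF J, of "Suc t" j "\<lambda>l. weight zs l * c t l" "-1"] by simp
    from exact_add[OF J elim(2) this] show ?case by simp
  qed
  ultimately show "c \<in> cocycles j J" by (simp add: cocycles_def)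
qed

text \<open>The class of a compatible sequence is determined by a single late term, whose images
  under the transition maps differ from the later terms by coboundaries only.\<close>

lemma tail_exact:
  assumes J: "is_ideal J"
    and c: "\<And>t. t0 \<le> t \<Longrightarrow> exact (Suc t) j J (\<lambda>l. c (Suc t) l - weight zs l * c t l)"
  shows "exact (t0 + s) j J (\<lambda>l. c (t0 + s) l - weight zs l ^ s * c t0 l)"
proof (induction s)
  case 0
  then show ?case using exact_in is_idealD(1)[OF J] by simp
next
  case (Suc s)
  have "exact (t0 + s + 1) j J (\<lambda>l. weight zs l ^ 1 * (c (t0 + s) l - weight zs l ^ s * c t0 l))"
    by (rule exact_weight[OF J Suc])
  with c[of "t0 + s"] have "exact (t0 + Suc s) j J (\<lambda>l. (c (Suc (t0 + s)) l - weight zs l * c (t0 + s) l) +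
      weight zs l * (c (t0 + s) l - weight zs l ^ s * c t0 l))"
    by (intro exact_add J) simp_all
  then show ?case by (simp add: algebra_simps)
qed

lemma eventually_shift: "(\<And>s. P (t0 + s)) \<Longrightarrow> eventually P sequentially"
  unfolding eventually_sequentially by (metis le_iff_add)

lemma cocycles_tail:
  assumes "c \<in> cocycles j J"
  obtains t0 where "\<And>t. t0 \<le> t \<Longrightarrow> exact (Suc t) j J (\<lambda>l. c (Suc t) l - weight zs l * c t l)"
    "\<And>t. t0 \<le> t \<Longrightarrow> closed t j J (c t)"
proof -
  have "\<forall>\<^sub>F t in sequentially. exact (Suc t) j J (\<lambda>l. c (Suc t) l - weight zs l * c t l) \<and> closed t j J (c t)"
    using assms unfolding cocycles_def by (simp add: eventually_conj_iff)
  then obtain t0 where "\<forall>t\<ge>t0. exact (Suc t) j J (\<lambda>l. c (Suc t) l - weight zs l * c t l) \<and> closed t j J (c t)"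
    unfolding eventually_sequentially by blast
  then show thesis using that[of t0] by simp
qed

text \<open>The scalars sending a late term z t0 to a coboundary form an ideal containing p and, by
  the homotopy, all x^t0 for x in zs. This ideal contains a power of each element of m, and
  \<open>tail_exact\<close> carries the result to all later terms.\<close>

lemma cocycles_torsion:
  assumes J: "is_ideal J" "p \<subseteq> J" and z: "z \<in> cocycles j J" and a: "a \<in> m"
  obtains k where "(\<lambda>t l. a ^ k * z t l) \<in> coboundaries j J"
proof -
  obtain t0 where t0: "\<And>t. t0 \<le> t \<Longrightarrow> exact (Suc t) j J (\<lambda>l. z (Suc t) l - weight zs l * z t l)"
    "\<And>t. t0 \<le> t \<Longrightarrow> closed t j J (z t)" using cocycles_tail[OF z] by blast
  define I where "I = {r. exact t0 j J (\<lambda>l. r * z t0 l)}"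
  have Ii: "is_ideal I" unfolding is_ideal_def
  proof (intro conjI ballI allI impI)
    show "0 \<in> I" unfolding I_def using exact_in is_idealD(1)[OF J(1)] by simp
  next
    fix r s assume "r \<in> I" "s \<in> I"
    then show "r + s \<in> I" unfolding I_def
      using exact_add[OF J(1), of t0 j "\<lambda>l. r * z t0 l" "\<lambda>l. s * z t0 l"] by (simp add: distrib_right)
  next
    fix r s assume "s \<in> I"
    then show "r * s \<in> I" unfolding I_def
      using exact_scale[OF J(1), of t0 j "\<lambda>l. s * z t0 l" r] by (simp add: mult.assoc)
  qed
  have pI: "p \<subseteq> I" unfolding I_def
    using J(2) is_idealD(4)[OF J(1)] by (auto intro!: exact_in)
  have "x ^ t0 \<in> I" if "x \<in> set zs" for x
  proof -
    obtain i where i: "i < length zs" "x = zs ! i" using \<open>x \<in> set zs\<close> by (metis in_set_conv_nth)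
    have "x ^ t0 * z t0 l - koszul (pows t0) (contract i (z t0)) l \<in> J" if l: "l \<in> cells (length zs) j" for l
    proof -
      have "koszul (pows t0) (contract i (z t0)) l + contract i (koszul (pows t0) (z t0)) l = x ^ t0 * z t0 l"
        using koszul_homotopy[of i "pows t0" l "z t0"] i l by (simp add: cells_def) (simp add: pows_def)
      then have "x ^ t0 * z t0 l - koszul (pows t0) (contract i (z t0)) l = contract i (koszul (pows t0) (z t0)) l"
        by (simp add: algebra_simps)
      moreover have "contract i (koszul (pows t0) (z t0)) l \<in> J"
        by (rule contract_in_ideal[OF J(1) _ l]) (use t0(2)[of t0] in \<open>simp add: closed_def\<close>)
      ultimately show ?thesis by simp
    qed
    then show ?thesis unfolding I_def exact_def by blast
  qed
  then obtain k where k: "a ^ k \<in> I"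
    using m_primary_power[OF prim Ii pI _ a] by metis
  have "exact (t0 + s) j J (\<lambda>l. a ^ k * z (t0 + s) l)" for s
  proof -
    have "exact (t0 + s) j J (\<lambda>l. weight zs l ^ s * (a ^ k * z t0 l))"
      by (rule exact_weight[OF J(1)]) (use k in \<open>simp add: I_def\<close>)
    moreover have "exact (t0 + s) j J (\<lambda>l. a ^ k * (z (t0 + s) l - weight zs l ^ s * z t0 l))"
      by (intro exact_scale tail_exact J t0)
    ultimately have "exact (t0 + s) j J (\<lambda>l. weight zs l ^ s * (a ^ k * z t0 l) +
        a ^ k * (z (t0 + s) l - weight zs l ^ s * z t0 l))" by (rule exact_add[OF J(1)])
    then show ?thesis by (simp add: algebra_simps)
  qed
  then have "\<forall>\<^sub>F t in sequentially. exact t j J (\<lambda>l. a ^ k * z t l)" by (rule eventually_shift)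
  then show thesis by (intro that[of k]) (simp add: coboundaries_def)
qed

section \<open>Dividing out the m-torsion, and the descending chain condition\<close>

definition saturation :: "'a set \<Rightarrow> 'a set" where
  "saturation J = {a. \<forall>c\<in>m. \<exists>k. c ^ k * a \<in> J}"

lemma saturation_ideal: "is_ideal J \<Longrightarrow> is_ideal (saturation J)"
  unfolding is_ideal_def[of "saturation J"]
proof (intro conjI ballI allI impI)
  assume J: "is_ideal J"
  show "0 \<in> saturation J" using is_idealD(1)[OF J] by (simp add: saturation_def)
next
  fix a b assume J: "is_ideal J" and ab: "a \<in> saturation J" "b \<in> saturation J"
  show "a + b \<in> saturation J" unfolding saturation_def
  proof (intro CollectI ballI)
    fix c assume "c \<in> m"
    then obtain k l where kl: "c ^ k * a \<in> J" "c ^ l * b \<in> J" using ab unfolding saturation_def by blast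
    have "c ^ (k + l) * (a + b) = c ^ l * (c ^ k * a) + c ^ k * (c ^ l * b)"
      by (simp add: power_add algebra_simps)
    also have "\<dots> \<in> J" using kl is_idealD(2,3)[OF J] by simp
    finally show "\<exists>k. c ^ k * (a + b) \<in> J" by blast
  qed
next
  fix r a assume J: "is_ideal J" and a: "a \<in> saturation J"
  show "r * a \<in> saturation J" unfolding saturation_def
  proof (intro CollectI ballI)
    fix c assume "c \<in> m"
    then obtain k where "c ^ k * a \<in> J" using a unfolding saturation_def by blast
    then have "r * (c ^ k * a) \<in> J" using is_idealD(3)[OF J] by blast
    then have "c ^ k * (r * a) \<in> J" by (simp add: mult.left_commute)
    then show "\<exists>k. c ^ k * (r * a) \<in> J" by blast
  qed
qed

lemma saturation_sup: "is_ideal J \<Longrightarrow> J \<subseteq> saturation J"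
  unfolding saturation_def using is_idealD(3) by blast

text \<open>An element whose annihilator modulo the saturation contains m is itself in the
  saturation. So no associated prime of the quotient contains m, and prime avoidance yields a
  regular x in m.\<close>

lemma saturation_regular:
  assumes J: "is_ideal J"
  obtains x where "x \<in> m" "\<And>a. x * a \<in> saturation J \<Longrightarrow> a \<in> saturation J"
proof -
  let ?K = "saturation J"
  have K: "is_ideal ?K" by (rule saturation_ideal[OF J])
  obtain F where F: "finite F" "\<And>P. P \<in> F \<Longrightarrow> prime_ideal P \<and> (\<exists>a. a \<notin> ?K \<and> P = colon ?K a)"
    "\<And>x a. x * a \<in> ?K \<Longrightarrow> a \<notin> ?K \<Longrightarrow> \<exists>P\<in>F. x \<in> P"
    using zero_divisors_in_finite_union[OF K] by metis
  have "\<not> m \<subseteq> P" if P: "P \<in> F" for P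
  proof
    assume mP: "m \<subseteq> P"
    obtain a where a: "a \<notin> ?K" "P = colon ?K a" using F(2)[OF P] by blast
    have "a \<in> ?K" unfolding saturation_def
    proof (intro CollectI ballI)
      fix c assume c: "c \<in> m"
      then have "c * a \<in> ?K" using mP a(2) by (auto simp: colon_def)
      then obtain k where "c ^ k * (c * a) \<in> J" using c unfolding saturation_def by blast
      then have "c ^ Suc k * a \<in> J" by (simp add: mult_ac)
      then show "\<exists>k. c ^ k * a \<in> J" by blast
    qed
    then show False using a(1) by simp
  qed
  then obtain x where x: "x \<in> m" "\<And>P. P \<in> F \<Longrightarrow> x \<notin> P"
    using prime_avoidance[OF F(1) m_ideal] F(2) by metis
  show thesis by (rule that[OF x(1)]) (use F(3) x(2) in blast)
qed

text \<open>In positive degree every cell has an entry \<open>True\<close>, so its weight lies in m.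
  A high transition map therefore moves the error from the saturation into J, for the finitely many
  cells simultaneously.\<close>

lemma coboundaries_saturation:
  assumes J: "is_ideal J" and c: "c \<in> cocycles (Suc j) J" "c \<in> coboundaries (Suc j) (saturation J)"
  shows "c \<in> coboundaries (Suc j) J"
proof -
  obtain t1 where t1: "\<And>t. t1 \<le> t \<Longrightarrow> exact (Suc t) (Suc j) J (\<lambda>l. c (Suc t) l - weight zs l * c t l)"
    using cocycles_tail[OF c(1)] by blast
  obtain t2 where t2: "\<And>t. t2 \<le> t \<Longrightarrow> exact t (Suc j) (saturation J) (c t)"
    using c(2) unfolding coboundaries_def eventually_sequentially by blast
  define t0 where "t0 = max t1 t2"
  obtain b where b: "\<And>l. l \<in> cells (length zs) (Suc j) \<Longrightarrow> c t0 l - koszul (pows t0) b l \<in> saturation J"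
    using t2[of t0] unfolding exact_def t0_def by auto
  let ?d = "\<lambda>l. c t0 l - koszul (pows t0) b l"
  have "\<forall>\<^sub>F s in sequentially. weight zs l ^ s * ?d l \<in> J" if l: "l \<in> cells (length zs) (Suc j)" for l
  proof -
    have "weight zs l \<in> m" using weight_in_ideal[OF m_ideal zs_m, of l] l by (simp add: cells_def)
    then obtain k where k: "weight zs l ^ k * ?d l \<in> J" using b[OF l] unfolding saturation_def by blast
    have "weight zs l ^ (k + i) * ?d l \<in> J" for i
    proof -
      have "weight zs l ^ (k + i) * ?d l = weight zs l ^ i * (weight zs l ^ k * ?d l)"
        by (simp add: power_add mult_ac)
      then show ?thesis using is_idealD(3)[OF J k] by simp
    qed
    then show ?thesis by (rule eventually_shift)
  qed
  then have "\<forall>\<^sub>F s in sequentially. \<forall>l\<in>cells (length zs) (Suc j). weight zs l ^ s * ?d l \<in> J"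
    by (intro eventually_ball_finite finite_cells) blast
  then obtain s0 where s0: "\<And>s l. s0 \<le> s \<Longrightarrow> l \<in> cells (length zs) (Suc j) \<Longrightarrow> weight zs l ^ s * ?d l \<in> J"
    unfolding eventually_sequentially by blast
  have "exact (t0 + s0 + i) (Suc j) J (c (t0 + s0 + i))" for i
  proof -
    let ?s = "s0 + i"
    have "exact (t0 + ?s) (Suc j) J (\<lambda>l. weight zs l ^ ?s * c t0 l)"
      unfolding exact_def
    proof (intro exI ballI)
      fix l assume "l \<in> cells (length zs) (Suc j)"
      then have "weight zs l ^ ?s * ?d l \<in> J" by (intro s0) simp_all
      then show "weight zs l ^ ?s * c t0 l - koszul (pows (t0 + ?s)) (\<lambda>k. weight zs k ^ ?s * b k) l \<in> J"
        by (simp only: koszul_pows_weight right_diff_distrib)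
    qed
    moreover have "exact (t0 + ?s) (Suc j) J (\<lambda>l. c (t0 + ?s) l - weight zs l ^ ?s * c t0 l)"
      by (rule tail_exact[OF J]) (use t1 in \<open>simp add: t0_def\<close>)
    ultimately have "exact (t0 + ?s) (Suc j) J (c (t0 + ?s))" by (rule exact_cong[OF J])
    then show ?thesis by (simp add: add.assoc)
  qed
  then have "\<forall>\<^sub>F t in sequentially. exact t (Suc j) J (c t)" by (rule eventually_shift)
  then show ?thesis by (simp add: coboundaries_def)
qed

text \<open>Degree zero cohomology is the m-torsion of R/J, that is, the saturation of J modulo J.
  It satisfies the chain condition by \<open>descending_chain_saturated\<close> at the prime
  m.\<close>

lemma dcc_degree_0:
  assumes J: "is_ideal J" "p \<subseteq> J"
  shows "cochains.dcc (coboundaries 0 J) (cocycles 0 J)"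
proof (rule cochains.dccI)
  fix U :: "nat \<Rightarrow> (nat \<Rightarrow> bool list \<Rightarrow> 'a) set"
  assume U: "\<And>n. cochains.subspace (U n)" "\<And>n. coboundaries 0 J \<subseteq> U n" "\<And>n. U n \<subseteq> cocycles 0 J"
    "\<And>n. U (Suc n) \<subseteq> U n"
  define o' where "o' = replicate (length zs) False"
  have cl: "l = o'" if "l \<in> cells (length zs) 0" for l
  proof -
    have "set l \<subseteq> {False}" using that by (auto simp: cells_def count_list_0_iff)
    then show ?thesis unfolding o'_def using that by (intro replicate_eqI) (auto simp: cells_def)
  qed
  have o': "o' \<in> cells (length zs) 0" by (simp add: cells_def o'_def count_list_0_iff)
  have ex: "exact t 0 J c \<longleftrightarrow> c o' \<in> J" for t c
  proof
    assume "exact t 0 J c"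
    then obtain b where "c o' - koszul (pows t) b o' \<in> J" unfolding exact_def using o' by blast
    moreover have "koszul (pows t) b o' = 0" using o' by (simp add: cells_def koszul_degree_0)
    ultimately show "c o' \<in> J" by simp
  next
    assume "c o' \<in> J"
    then show "exact t 0 J c" using cl by (intro exact_in) metis
  qed
  define I where "I = (\<lambda>n. {r. (\<lambda>t l. r) \<in> U n})"
  have Ii: "is_ideal (I n)" for n
  proof -
    have "(\<lambda>t l. 0) \<in> U n" using cochains.subspace_0[OF U(1)[of n]] by (simp add: zero_fun_def)
    moreover have "(\<lambda>t l. a + b) \<in> U n" if "(\<lambda>t l. a) \<in> U n" "(\<lambda>t l. b) \<in> U n" for a b
      using cochains.subspace_add[OF U(1) that] by (simp add: plus_fun_def)
    moreover have "(\<lambda>t l. r * a) \<in> U n" if "(\<lambda>t l. a) \<in> U n" for a r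
      using cochains.subspace_scale[OF U(1) that] by simp
    ultimately show ?thesis unfolding is_ideal_def I_def by blast
  qed
  have JI: "J \<subseteq> I n" for n
  proof
    fix r assume "r \<in> J"
    then have "(\<lambda>t l. r) \<in> coboundaries 0 J" unfolding coboundaries_def by (simp add: ex)
    then show "r \<in> I n" using U(2) unfolding I_def by blast
  qed
  have IJ: "I n \<subseteq> saturation J" for n
  proof
    fix r assume "r \<in> I n"
    then have rz: "(\<lambda>t l. r) \<in> cocycles 0 J" using U(3) unfolding I_def by blast
    show "r \<in> saturation J" unfolding saturation_def
    proof (intro CollectI ballI)
      fix c assume "c \<in> m"
      then obtain k where "(\<lambda>t l. c ^ k * r) \<in> coboundaries 0 J"
        using cocycles_torsion[OF J rz] by metis
      then have "\<forall>\<^sub>F t in sequentially. c ^ k * r \<in> J" unfolding coboundaries_def by (simp add: ex)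
      then show "\<exists>k. c ^ k * r \<in> J" by auto
    qed
  qed
  have Idec: "I (Suc n) \<subseteq> I n" for n using U(4) by (auto simp: I_def)
  obtain N where N: "\<And>n. N \<le> n \<Longrightarrow> I n = I N"
  proof (rule descending_chain_saturated[OF m_prime saturation_ideal[OF J(1)], of J I])
    show "\<exists>s n. s \<notin> m \<and> s * (c ^ n * a) \<in> J" if ac: "a \<in> saturation J" "c \<in> m" for a c
    proof -
      obtain k where "1 * (c ^ k * a) \<in> J" using ac unfolding saturation_def by auto
      then show ?thesis using m_proper by blast
    qed
  qed (use Ii JI IJ Idec cancel_unit[OF saturation_ideal[OF J(1)]] cancel_unit[OF Ii] that in blast)+
  have "U N \<subseteq> U n" if n: "N \<le> n" for n
  proof
    fix u assume u: "u \<in> U N"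
    then have "u \<in> cocycles 0 J" using U(3) by blast
    then obtain t0 where t0: "\<And>t. t0 \<le> t \<Longrightarrow> exact (Suc t) 0 J (\<lambda>l. u (Suc t) l - weight zs l * u t l)"
      using cocycles_tail by blast
    \<comment> \<open>The transition maps in degree zero are the identity, so up to a coboundary u
      is the constant sequence r.\<close>
    define r where "r = u t0 o'"
    have w: "weight zs o' = 1" using o' by (simp add: cells_def weight_degree_0)
    have "u (t0 + s) o' - r \<in> J" for s
      using tail_exact[of J t0 0 u s, OF J(1) t0] by (simp add: ex w r_def)
    then have "exact (t0 + s) 0 J (\<lambda>l. u (t0 + s) l - r)" for s by (simp add: ex)
    then have "\<forall>\<^sub>F t in sequentially. exact t 0 J (\<lambda>l. u t l - r)" by (rule eventually_shift)
    then have ur: "u - (\<lambda>t l. r) \<in> coboundaries 0 J" by (simp add: coboundaries_def fun_diff_def)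
    then have "u - (u - (\<lambda>t l. r)) \<in> U N" using u U(2) cochains.subspace_diff[OF U(1)] by blast
    then have "r \<in> I N" by (simp add: I_def)
    then have "r \<in> I n" using N[OF n] by simp
    then have "(\<lambda>t l. r) \<in> U n" by (simp add: I_def)
    then have "(u - (\<lambda>t l. r)) + (\<lambda>t l. r) \<in> U n" using ur U(2) cochains.subspace_add[OF U(1)] by blast
    then show "u \<in> U n" by simp
  qed
  then show "\<exists>N. \<forall>n\<ge>N. U n = U N"
    using lift_Suc_antimono_le[of U, OF U(4)] by (intro exI[of _ N]) blast
qed

text \<open>The connecting homomorphism of \<open>0 \<rightarrow> R/J \<rightarrow> R/J \<rightarrow> R/(J + xR) \<rightarrow> 0\<close> maps the cohomology in degree
  \<open>j\<close> onto the part killed by \<open>x\<close> in degree \<open>j + 1\<close>.\<close>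

lemma dcc_connecting:
  assumes J: "is_ideal J" and x: "\<And>a. x * a \<in> J \<Longrightarrow> a \<in> J"
    and dcc: "cochains.dcc (coboundaries j (adjoin J [x])) (cocycles j (adjoin J [x]))"
  shows "cochains.dcc (coboundaries (Suc j) J)
    {z \<in> cocycles (Suc j) J. (\<lambda>t l. x * z t l) \<in> coboundaries (Suc j) J}"
proof (rule cochains.dccI)
  fix U :: "nat \<Rightarrow> (nat \<Rightarrow> bool list \<Rightarrow> 'a) set"
  assume U: "\<And>n. cochains.subspace (U n)" "\<And>n. coboundaries (Suc j) J \<subseteq> U n"
    "\<And>n. U n \<subseteq> {z \<in> cocycles (Suc j) J. (\<lambda>t l. x * z t l) \<in> coboundaries (Suc j) J}"
    "\<And>n. U (Suc n) \<subseteq> U n"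
  let ?n = "length zs" and ?K = "adjoin J [x]"
  have K: "is_ideal ?K" by (rule adjoin_ideal[OF J])
  have xK: "x * a \<in> ?K" for a
    using adjoin_set[OF J, of "[x]"] is_idealD(4)[OF K, of x a] by simp
  have JK: "J \<subseteq> ?K" by (rule adjoin_sup)
  \<comment> \<open>The differential of b is x u modulo J, so the connecting homomorphism sends the
    class of b to that of u. \<Phi> n is the preimage of U n under this correspondence.\<close>
  define lifts where "lifts = (\<lambda>b u. \<forall>\<^sub>F t in sequentially. \<forall>l\<in>cells ?n (Suc j).
      koszul (pows t) (b t) l - x * u t l \<in> J)"
  define \<Phi> where "\<Phi> = (\<lambda>n. {b \<in> cocycles j ?K. \<exists>u\<in>U n. lifts b u})"
  have Zs: "cochains.subspace (cocycles j ?K)" by (rule subspace_cocycles[OF K])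
  have \<Phi>s: "cochains.subspace (\<Phi> n)" for n
  proof (rule cochains.subspaceI)
    have "lifts 0 0" unfolding lifts_def
      using is_idealD(1)[OF J] by (simp add: zero_fun_def koszul_zero)
    then show "0 \<in> \<Phi> n" unfolding \<Phi>_def
      using cochains.subspace_0[OF Zs] cochains.subspace_0[OF U(1)[of n]] by blast
  next
    fix b c assume "b \<in> \<Phi> n" "c \<in> \<Phi> n"
    then obtain u v where *: "b \<in> cocycles j ?K" "c \<in> cocycles j ?K" "u \<in> U n" "v \<in> U n" "lifts b u" "lifts c v"
      unfolding \<Phi>_def by blast
    have "lifts (b + c) (u + v)" using *(5,6) unfolding lifts_def
    proof eventually_elim
      case (elim t)
      show ?case
      proof
        fix l assume "l \<in> cells ?n (Suc j)"
        then have "(koszul (pows t) (b t) l - x * u t l) + (koszul (pows t) (c t) l - x * v t l) \<in> J"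
          using elim is_idealD(2)[OF J] by blast
        then show "koszul (pows t) ((b + c) t) l - x * (u + v) t l \<in> J"
          by (simp add: plus_fun_def koszul_add algebra_simps)
      qed
    qed
    then show "b + c \<in> \<Phi> n" unfolding \<Phi>_def
      using * cochains.subspace_add[OF Zs] cochains.subspace_add[OF U(1)] by blast
  next
    fix r b assume "b \<in> \<Phi> n"
    then obtain u where *: "b \<in> cocycles j ?K" "u \<in> U n" "lifts b u" unfolding \<Phi>_def by blast
    have "lifts (\<lambda>t l. r * b t l) (\<lambda>t l. r * u t l)" using *(3) unfolding lifts_def
    proof eventually_elim
      case (elim t)
      show ?case
      proof
        fix l assume "l \<in> cells ?n (Suc j)"
        then have "r * (koszul (pows t) (b t) l - x * u t l) \<in> J" using elim is_idealD(3)[OF J] by blast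
        then show "koszul (pows t) (\<lambda>l. r * b t l) l - x * (r * u t l) \<in> J"
          by (simp add: koszul_scale algebra_simps)
      qed
    qed
    then show "(\<lambda>t l. r * b t l) \<in> \<Phi> n" unfolding \<Phi>_def
      using * cochains.subspace_scale[OF Zs] cochains.subspace_scale[OF U(1)] by blast
  qed
  have \<Phi>B: "coboundaries j ?K \<subseteq> \<Phi> n" for n
  proof
    fix b assume b: "b \<in> coboundaries j ?K"
    have "\<exists>w. exact t j ?K (b t) \<longrightarrow> (\<forall>l\<in>cells ?n (Suc j). koszul (pows t) (b t) l - x * koszul (pows t) w l \<in> J)" for t
    proof (cases "exact t j ?K (b t)")
      case True
      then obtain a where a: "\<And>l. l \<in> cells ?n j \<Longrightarrow> b t l - koszul (pows t) a l \<in> ?K" unfolding exact_def by blast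
      have "\<exists>r. b t l - koszul (pows t) a l - x * r \<in> J" if l: "l \<in> cells ?n j" for l
      proof -
        obtain i r where "i \<in> J" "b t l - koszul (pows t) a l = i + r * x"
          using a[OF l] unfolding adjoin.simps by blast
        then have "b t l - koszul (pows t) a l - x * r \<in> J" by (simp add: mult.commute)
        then show ?thesis by blast
      qed
      then obtain w where w: "\<And>l. l \<in> cells ?n j \<Longrightarrow> b t l - koszul (pows t) a l - x * w l \<in> J" by metis
      have "koszul (pows t) (\<lambda>l. b t l - koszul (pows t) a l - x * w l) l \<in> J" if "l \<in> cells ?n (Suc j)" for l
        by (rule koszul_in_ideal[OF J, of _ j]) (use w that in auto)
      then show ?thesis by (intro exI[of _ w]) (simp add: koszul_diff koszul_scale koszul_koszul)
    qed simp
    then obtain w where w: "\<And>t. exact t j ?K (b t) \<Longrightarrow>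
        \<forall>l\<in>cells ?n (Suc j). koszul (pows t) (b t) l - x * koszul (pows t) (w t) l \<in> J" by metis
    define u where "u = (\<lambda>t. koszul (pows t) (w t))"
    have "u \<in> coboundaries (Suc j) J" unfolding coboundaries_def u_def using exact_koszul[OF J] by simp
    then have "u \<in> U n" using U(2) by blast
    moreover have "\<forall>\<^sub>F t in sequentially. exact t j ?K (b t)" using b by (simp add: coboundaries_def)
    then have "lifts b u" unfolding lifts_def u_def by eventually_elim (rule w)
    ultimately show "b \<in> \<Phi> n" unfolding \<Phi>_def using b coboundaries_subset[OF K] by blast
  qed
  have "\<Phi> n \<subseteq> cocycles j ?K" "\<Phi> (Suc n) \<subseteq> \<Phi> n" for n unfolding \<Phi>_def using U(4) by blast+
  then obtain N where N: "\<And>n. N \<le> n \<Longrightarrow> \<Phi> n = \<Phi> N"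
    by (rule cochains.dccD[OF dcc \<Phi>s \<Phi>B]) blast
  have "U N \<subseteq> U n" if n: "N \<le> n" for n
  proof
    fix u assume u: "u \<in> U N"
    then have uz: "u \<in> cocycles (Suc j) J" "(\<lambda>t l. x * u t l) \<in> coboundaries (Suc j) J" using U(3) by blast+
    obtain t1 where t1: "\<And>t. t1 \<le> t \<Longrightarrow> exact (Suc t) (Suc j) J (\<lambda>l. u (Suc t) l - weight zs l * u t l)"
      using cocycles_tail[OF uz(1)] by blast
    obtain t2 where t2: "\<And>t. t2 \<le> t \<Longrightarrow> exact t (Suc j) J (\<lambda>l. x * u t l)"
      using uz(2) unfolding coboundaries_def eventually_sequentially by blast
    define t0 where "t0 = max t1 t2"
    obtain b0 where b0: "\<And>l. l \<in> cells ?n (Suc j) \<Longrightarrow> x * u t0 l - koszul (pows t0) b0 l \<in> J"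
      using t2[of t0] unfolding exact_def t0_def by auto
    \<comment> \<open>Both u and its primitive b0 are restarted at t0 and continued by the
      transition maps, so that the relation at t0 persists at all later stages.\<close>
    define b where "b = (\<lambda>t l. weight zs l ^ (t - t0) * b0 l)"
    define u' where "u' = (\<lambda>t l. weight zs l ^ (t - t0) * u t0 l)"
    have "exact (t0 + s) (Suc j) J (\<lambda>l. u (t0 + s) l - u' (t0 + s) l)" for s
      using tail_exact[OF J, of t0 "Suc j" u s] t1 by (simp add: t0_def u'_def)
    then have "\<forall>\<^sub>F t in sequentially. exact t (Suc j) J (\<lambda>l. u t l - u' t l)" by (rule eventually_shift)
    then have uu': "u - u' \<in> coboundaries (Suc j) J" by (simp add: coboundaries_def fun_diff_def)
    then have "u - (u - u') \<in> U N" using u U(2) cochains.subspace_diff[OF U(1)] by blast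
    then have u'N: "u' \<in> U N" by simp
    have bu: "koszul (pows (t0 + s)) (b (t0 + s)) l - x * u' (t0 + s) l \<in> J" if l: "l \<in> cells ?n (Suc j)" for s l
    proof -
      have "(- (weight zs l ^ s)) * (x * u t0 l - koszul (pows t0) b0 l) \<in> J"
        using b0[OF l] is_idealD(3)[OF J] by blast
      moreover have "koszul (pows (t0 + s)) (b (t0 + s)) l = weight zs l ^ s * koszul (pows t0) b0 l"
        by (simp add: b_def koszul_pows_weight)
      ultimately show ?thesis by (simp add: u'_def algebra_simps)
    qed
    have lb: "lifts b u'" unfolding lifts_def by (rule eventually_shift[of _ t0]) (use bu in blast)
    have "closed (t0 + s) j ?K (b (t0 + s))" for s unfolding closed_def
    proof
      fix l assume l: "l \<in> cells ?n (Suc j)"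
      have "(koszul (pows (t0 + s)) (b (t0 + s)) l - x * u' (t0 + s) l) + x * u' (t0 + s) l \<in> ?K"
        using bu[OF l] JK xK is_idealD(2)[OF K] by blast
      then show "koszul (pows (t0 + s)) (b (t0 + s)) l \<in> ?K" by simp
    qed
    then have "\<forall>\<^sub>F t in sequentially. closed t j ?K (b t)" by (rule eventually_shift)
    moreover have "exact (Suc (t0 + s)) j ?K (\<lambda>l. b (Suc (t0 + s)) l - weight zs l * b (t0 + s) l)" for s
      by (rule exact_in) (simp add: b_def Suc_diff_le is_idealD(1)[OF K])
    then have "\<forall>\<^sub>F t in sequentially. exact (Suc t) j ?K (\<lambda>l. b (Suc t) l - weight zs l * b t l)"
      by (rule eventually_shift)
    ultimately have "b \<in> cocycles j ?K" by (simp add: cocycles_def)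
    then have "b \<in> \<Phi> N" unfolding \<Phi>_def using lb u'N by blast
    then have "b \<in> \<Phi> n" using N[OF n] by simp
    \<comment> \<open>Here v in U n has the same lift b as u'. Hence x (u' - v) lies in J on the
      relevant cells, and x may be cancelled.\<close>
    then obtain v where v: "v \<in> U n" "lifts b v" unfolding \<Phi>_def by blast
    have "\<forall>\<^sub>F t in sequentially. exact t (Suc j) J (\<lambda>l. u' t l - v t l)"
      using lb v(2) unfolding lifts_def
    proof eventually_elim
      case (elim t)
      show ?case
      proof (rule exact_in)
        fix l assume "l \<in> cells ?n (Suc j)"
        then have "(koszul (pows t) (b t) l - x * v t l) - (koszul (pows t) (b t) l - x * u' t l) \<in> J"
          using elim is_idealD(6)[OF J] by blast
        then have "x * (u' t l - v t l) \<in> J" by (simp add: algebra_simps)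
        then show "u' t l - v t l \<in> J" by (rule x)
      qed
    qed
    then have "u' - v \<in> coboundaries (Suc j) J" by (simp add: coboundaries_def fun_diff_def)
    then have "((u - u') + (u' - v)) + v \<in> U n"
      using uu' v(1) U(2) cochains.subspace_add[OF U(1)] by blast
    then show "u \<in> U n" by simp
  qed
  then show "\<exists>N. \<forall>n\<ge>N. U n = U N"
    using lift_Suc_antimono_le[of U, OF U(4)] by (intro exI[of _ N]) blast
qed

text \<open>Modulo the saturation there is a regular x in m. The induction hypothesis for the ideal
  enlarged by x controls the part killed by x one degree higher, and \<open>dcc_torsion\<close>
  extends this to everything, because the cohomology is m-torsion. In positive degree the result
  descends from the saturation to J.\<close>

theorem dcc_cohomology:
  "is_ideal J \<Longrightarrow> p \<subseteq> J \<Longrightarrow> cochains.dcc (coboundaries j J) (cocycles j J)"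
proof (induction j arbitrary: J)
  case 0
  then show ?case by (rule dcc_degree_0)
next
  case (Suc j)
  let ?K = "saturation J"
  have J: "is_ideal J" using Suc.prems(1) .
  have K: "is_ideal ?K" "J \<subseteq> ?K" "p \<subseteq> ?K"
    using saturation_ideal[OF J] saturation_sup[OF J] Suc.prems(2) by blast+
  obtain x where x: "x \<in> m" "\<And>a. x * a \<in> ?K \<Longrightarrow> a \<in> ?K" using saturation_regular[OF J] by blast
  have "p \<subseteq> adjoin ?K [x]" using K(3) adjoin_sup by blast
  then have "cochains.dcc (coboundaries j (adjoin ?K [x])) (cocycles j (adjoin ?K [x]))"
    by (rule Suc.IH[OF adjoin_ideal[OF K(1)]])
  then have conn: "cochains.dcc (coboundaries (Suc j) ?K)
      {z \<in> cocycles (Suc j) ?K. (\<lambda>t l. x * z t l) \<in> coboundaries (Suc j) ?K}"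
    by (rule dcc_connecting[OF K(1), rotated]) (rule x(2))
  have dK: "cochains.dcc (coboundaries (Suc j) ?K) (cocycles (Suc j) ?K)"
  proof (rule cochains.dcc_torsion[OF subspace_coboundaries[OF K(1)] subspace_cocycles[OF K(1)]
        coboundaries_subset[OF K(1)] _ conn])
    fix z assume "z \<in> cocycles (Suc j) ?K"
    then show "\<exists>k. (\<lambda>t l. x ^ k * z t l) \<in> coboundaries (Suc j) ?K"
      using cocycles_torsion[OF K(1,3) _ x(1)] by metis
  qed
  show ?case
  proof (rule cochains.dccI)
    fix U :: "nat \<Rightarrow> (nat \<Rightarrow> bool list \<Rightarrow> 'a) set"
    assume U: "\<And>n. cochains.subspace (U n)" "\<And>n. coboundaries (Suc j) J \<subseteq> U n"
      "\<And>n. U n \<subseteq> cocycles (Suc j) J" "\<And>n. U (Suc n) \<subseteq> U n"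
    \<comment> \<open>The image of the chain in the cohomology modulo the saturation. By
      \<open>coboundaries_saturation\<close> the passage is injective on classes, so stability of V
      gives stability of U.\<close>
    define V where "V = (\<lambda>n. {u + b | u b. u \<in> U n \<and> b \<in> coboundaries (Suc j) ?K})"
    have Vs: "cochains.subspace (V n)" for n
    proof -
      have C: "cochains.subspace (coboundaries (Suc j) ?K)" by (rule subspace_coboundaries[OF K(1)])
      show ?thesis
      proof (rule cochains.subspaceI)
        have "0 = (0 :: nat \<Rightarrow> bool list \<Rightarrow> 'a) + 0" by simp
        then show "0 \<in> V n" unfolding V_def
          using cochains.subspace_0[OF U(1)[of n]] cochains.subspace_0[OF C] by blast
      next
        fix v w assume "v \<in> V n" "w \<in> V n"
        then obtain u b u' b' where *: "v = u + b" "w = u' + b'" "u \<in> U n" "u' \<in> U n"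
          "b \<in> coboundaries (Suc j) ?K" "b' \<in> coboundaries (Suc j) ?K" unfolding V_def by blast
        then have "v + w = (u + u') + (b + b')" by (simp add: algebra_simps)
        then show "v + w \<in> V n" unfolding V_def
          using * cochains.subspace_add[OF U(1)] cochains.subspace_add[OF C] by blast
      next
        fix r v assume "v \<in> V n"
        then obtain u b where *: "v = u + b" "u \<in> U n" "b \<in> coboundaries (Suc j) ?K" unfolding V_def by blast
        then have "(\<lambda>t l. r * v t l) = (\<lambda>t l. r * u t l) + (\<lambda>t l. r * b t l)"
          by (intro ext) (simp add: distrib_left)
        then show "(\<lambda>t l. r * v t l) \<in> V n" unfolding V_def
          using * cochains.subspace_scale[OF U(1)] cochains.subspace_scale[OF C] by blast
      qed
    qed
    have ZK: "cocycles (Suc j) J \<subseteq> cocycles (Suc j) ?K"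
    proof
      fix c assume "c \<in> cocycles (Suc j) J"
      then have "\<forall>\<^sub>F t in sequentially. exact (Suc t) (Suc j) J (\<lambda>l. c (Suc t) l - weight zs l * c t l)"
        and *: "\<forall>\<^sub>F t in sequentially. closed t (Suc j) J (c t)" by (simp_all add: cocycles_def)
      then have "\<forall>\<^sub>F t in sequentially. exact (Suc t) (Suc j) ?K (\<lambda>l. c (Suc t) l - weight zs l * c t l)"
        by eventually_elim (rule exact_mono[OF K(2)])
      moreover have "\<forall>\<^sub>F t in sequentially. closed t (Suc j) ?K (c t)"
        using * by eventually_elim (use K(2) in \<open>auto simp: closed_def\<close>)
      ultimately show "c \<in> cocycles (Suc j) ?K" by (simp add: cocycles_def)
    qed
    have VB: "coboundaries (Suc j) ?K \<subseteq> V n" for n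
    proof
      fix b assume "b \<in> coboundaries (Suc j) ?K"
      then show "b \<in> V n" unfolding V_def
        using cochains.subspace_0[OF U(1)[of n]] by (intro CollectI exI[of _ 0] exI[of _ b]) simp
    qed
    have VZ: "V n \<subseteq> cocycles (Suc j) ?K" for n
      unfolding V_def
      using U(3) ZK coboundaries_subset[OF K(1)] cochains.subspace_add[OF subspace_cocycles[OF K(1)]] by blast
    have VS: "V (Suc n) \<subseteq> V n" for n unfolding V_def using U(4) by blast
    obtain N where N: "\<And>n. N \<le> n \<Longrightarrow> V n = V N"
      using cochains.dccD[of _ _ V, OF dK Vs VB VZ VS] by metis
    have "U N \<subseteq> U n" if n: "N \<le> n" for n
    proof
      fix u assume u: "u \<in> U N"
      have "u + 0 \<in> V N" unfolding V_def
        using u cochains.subspace_0[OF subspace_coboundaries[OF K(1)]] by blast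
      then have "u \<in> V n" using N[OF n] by simp
      then obtain v b where vb: "u = v + b" "v \<in> U n" "b \<in> coboundaries (Suc j) ?K" unfolding V_def by blast
      have "u - v \<in> cocycles (Suc j) J"
        using u vb(2) U(3) cochains.subspace_diff[OF subspace_cocycles[OF J]] by blast
      then have "b \<in> cocycles (Suc j) J" using vb(1) by simp
      then have "b \<in> coboundaries (Suc j) J" using coboundaries_saturation[OF J _ vb(3)] by blast
      then show "u \<in> U n" using vb U(2) cochains.subspace_add[OF U(1)] by blast
    qed
    then show "\<exists>N. \<forall>n\<ge>N. U n = U N"
      using lift_Suc_antimono_le[of U, OF U(4)] by (intro exI[of _ N]) blast
  qed
qed

end

section \<open>The Koszul complex in top degree\<close>

lemma koszul_in_generated:
  assumes K: "is_ideal K"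
  shows "set xs \<subseteq> K \<Longrightarrow> koszul xs c l \<in> K"
proof (induction xs c l rule: koszul.induct)
  case (3 x xs c b l)
  then show ?case using is_idealD(4)[OF K, of x "c (False # l)"] is_idealD(6)[OF K] by simp
qed (simp_all add: is_idealD(1)[OF K])

text \<open>The summand r x is the contribution of the cell that lacks x, and induction supplies the
  rest. The minus sign in the witness undoes the one in the recursion of
  \<open>koszul\<close>.\<close>

lemma koszul_top_surj:
  assumes J: "is_ideal J"
  shows "a \<in> adjoin J xs \<Longrightarrow> \<exists>v. koszul xs v (replicate (length xs) True) - a \<in> J"
proof (induction xs arbitrary: a)
  case Nil
  then show ?case using is_idealD(5)[OF J] by simp
next
  case (Cons x xs)
  then obtain a' r where a: "a' \<in> adjoin J xs" "a = a' + r * x" unfolding adjoin.simps by blast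
  then obtain v where v: "koszul xs v (replicate (length xs) True) - a' \<in> J" using Cons.IH by blast
  define w where "w = (\<lambda>l. case l of [] \<Rightarrow> 0 | b # k \<Rightarrow> if b then - v k else r)"
  have "koszul (x # xs) w (replicate (length (x # xs)) True) - a
      = koszul xs v (replicate (length xs) True) - a'"
    by (simp add: w_def koszul_uminus a(2) algebra_simps)
  then show ?case using v by metis
qed

lemma weight_True: "weight xs (replicate (length xs) True) = prod_list xs"
  by (induction xs) auto

lemma count_True_full: "length l = n \<Longrightarrow> count_list l True = n \<Longrightarrow> l = replicate n True"
proof (induction l arbitrary: n)
  case (Cons b l)
  have "count_list l True \<le> length l" by (rule count_le_length)
  then show ?case using Cons by (auto split: if_splits)
qed simp

section \<open>Families with prescribed annihilator\<close>

context matlis begin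

text \<open>If the top local cohomology vanished, then \<open>H = H\<^sup>d\<^sup>-\<^sup>1\<^bsub>xs\<^esub>(R/p)\<close> would be \<open>w H + \<Gamma>\<^bsub>m\<^esub>(H)\<close> for every
  parameter \<open>w\<close>, so that homomorphisms \<open>f k\<close> with pairwise different annihilators
  \<open>q k\<close> of coheight \<open>d - 1\<close> would stay independent on \<open>\<Gamma>\<^bsub>m\<^esub>(H)\<close>. As a quotient of the Artinian module
  \<open>H\<^sup>d\<^sup>-\<^sup>1\<^bsub>m\<^esub>(R/p)\<close>, the module \<open>\<Gamma>\<^bsub>m\<^esub>(H)\<close> does not admit infinitely many of them.\<close>

lemma top_cohomology_nonzero:
  assumes p: "prime_ideal p" "prime_chain_above p (Suc d)" "\<not> prime_chain_above p (Suc (Suc d))"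
    and d: "1 \<le> d" "length xs = d" and xm: "set (x # xs) \<subseteq> m" and prim: "m_primary p (x # xs)"
    and IH: "\<And>q. prime_ideal q \<Longrightarrow> prime_chain_above q d \<Longrightarrow> \<not> prime_chain_above q (Suc d) \<Longrightarrow>
      m_primary q xs \<Longrightarrow> \<exists>e. family xs q e \<and> ann e = q"
  shows "\<exists>n. \<forall>s. prod_list (x # xs) ^ s \<notin> adjoin p (map (\<lambda>z. z ^ (n + s)) (x # xs))"
proof (rule ccontr)
  assume "\<nexists>n. \<forall>s. prod_list (x # xs) ^ s \<notin> adjoin p (map (\<lambda>z. z ^ (n + s)) (x # xs))"
  then have van: "\<exists>s. prod_list (x # xs) ^ s \<in> adjoin p (map (\<lambda>z. z ^ (n + s)) (x # xs))" for n by blast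
  have pi: "is_ideal p" using p(1) by (rule prime_idealD)
  define y where "y = prod_list xs"
  define S where "S = {q. prime_ideal q \<and> p \<subset> q \<and> prime_chain_above q d \<and> m_primary q xs}"
  have "infinite S" unfolding S_def by (rule infinitely_many_cuts[OF p(1,2) d(1) prim]) (use xm in simp)
  then obtain q :: "nat \<Rightarrow> 'a set" where qinj: "inj q" and qS: "range q \<subseteq> S"
    using infinite_countable_subset by blast
  have q: "prime_ideal (q k)" "p \<subset> q k" "prime_chain_above (q k) d" "m_primary (q k) xs" for k
    using qS unfolding S_def by blast+
  have qi: "is_ideal (q k)" for k using q(1) by (rule prime_idealD)
  have qnot: "\<not> prime_chain_above (q k) (Suc d)" for k
    using prime_chain_above_Suc[OF p(1) q(1,2)] p(3) by blast
  have qmax: "\<not> q i \<subset> q j" for i j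
    using prime_chain_above_Suc[OF q(1) q(1) _ q(3)] qnot by blast
  have "\<exists>e. family xs (q k) e \<and> ann e = q k" for k using IH[OF q(1,3) qnot q(4)] .
  then obtain f where f: "\<And>k. family xs (q k) (f k)" "\<And>k. ann (f k) = q k" by metis
  interpret koszul_limit ty m p "x # xs"
    by unfold_locales (use xm prim in auto)
  define T where "T = replicate d True"
  have T: "length T = d" "count_list T True = d" by (auto simp: T_def count_list_eq_length_filter)
  have koT: "koszul (pows t) c (False # T) = koszul (map (\<lambda>z. z ^ t) xs) (\<lambda>k. c (False # k)) T" for t c
    by (simp add: pows_def)
  have kill: "koszul (map (\<lambda>z. z ^ t) xs) c l *s f k t = 0" for t c l k
  proof -
    have "koszul (map (\<lambda>z. z ^ t) xs) c l \<in> {a. \<forall>v\<in>{f k t}. a *s v = 0}"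
      by (rule koszul_in_generated[OF annihilator_ideal]) (use familyD(1)[OF f(1)] in auto)
    then show ?thesis by blast
  qed
  \<comment> \<open>The cell False # T omits x. Its coefficient in z t is the numerator over y^t of
    the image of z in H, the top cohomology for \<open>xs\<close>. So U N collects the cocycles
    whose images f 0, ..., f N kill.\<close>
  define U where "U = (\<lambda>N. {z \<in> cocycles d p. \<forall>k\<le>N. \<forall>\<^sub>F t in sequentially. z t (False # T) *s f k t = 0})"
  have Zs: "cochains.subspace (cocycles d p)" by (rule subspace_cocycles[OF pi])
  have Us: "cochains.subspace (U N)" for N
  proof (rule cochains.subspaceI)
    show "0 \<in> U N" unfolding U_def using cochains.subspace_0[OF Zs] by simp
  next
    fix z w assume zw: "z \<in> U N" "w \<in> U N"
    have "\<forall>\<^sub>F t in sequentially. (z + w) t (False # T) *s f k t = 0" if "k \<le> N" for k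
    proof -
      have "\<forall>\<^sub>F t in sequentially. z t (False # T) *s f k t = 0" "\<forall>\<^sub>F t in sequentially. w t (False # T) *s f k t = 0"
        using zw \<open>k \<le> N\<close> unfolding U_def by blast+
      then show ?thesis by eventually_elim (simp add: scale_left_distrib)
    qed
    then show "z + w \<in> U N" using zw cochains.subspace_add[OF Zs] unfolding U_def by blast
  next
    fix r z assume z: "z \<in> U N"
    have "\<forall>\<^sub>F t in sequentially. (r * z t (False # T)) *s f k t = 0" if "k \<le> N" for k
    proof -
      have "\<forall>\<^sub>F t in sequentially. z t (False # T) *s f k t = 0"
        using z \<open>k \<le> N\<close> unfolding U_def by blast
      then show ?thesis by eventually_elim (metis scale_scale scale_zero_right)
    qed
    then show "(\<lambda>t l. r * z t l) \<in> U N" using z cochains.subspace_scale[OF Zs] unfolding U_def by blast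
  qed
  have UB: "coboundaries d p \<subseteq> U N" for N
  proof
    fix z assume z: "z \<in> coboundaries d p"
    have "\<forall>\<^sub>F t in sequentially. z t (False # T) *s f k t = 0" for k
    proof -
      have "\<forall>\<^sub>F t in sequentially. exact t d p (z t)" using z by (simp add: coboundaries_def)
      then show ?thesis
      proof eventually_elim
        case (elim t)
        have "False # T \<in> cells (length (x # xs)) d" using T d by (simp add: cells_def)
        then obtain b where "z t (False # T) - koszul (pows t) b (False # T) \<in> p"
          using elim unfolding exact_def by blast
        then have "(z t (False # T) - koszul (pows t) b (False # T)) *s f k t = 0"
          using familyD(2)[OF f(1)] q(2) by blast
        then show ?case using kill koT by (simp add: scale_left_diff_distrib)
      qed
    qed
    then show "z \<in> U N" unfolding U_def using z coboundaries_subset[OF pi] by blast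
  qed
  have UZ: "U N \<subseteq> cocycles d p" for N by (auto simp: U_def)
  have "U (Suc N) \<subseteq> U N" for N by (auto simp: U_def)
  then obtain N where N: "\<And>n. N \<le> n \<Longrightarrow> U n = U N"
    using cochains.dccD[of _ _ U, OF dcc_cohomology[OF pi order_refl] Us UB UZ] by metis
  \<comment> \<open>The q k are incomparable, so some b kills f 0, ..., f N but not f (N+1). For
    every cocycle z, the multiple b z lies in U N = U (N+1); hence g = b f (N+1) vanishes on the
    image of every cocycle.\<close>
  obtain b where b: "b \<notin> q (Suc N)" "\<And>Q. Q \<in> q ` {..N} \<Longrightarrow> b \<in> Q"
  proof (rule prime_contains_Inter[of "q ` {..N}" "q (Suc N)"])
    fix Q assume "Q \<in> q ` {..N}"
    then obtain k where k: "Q = q k" "k \<le> N" by auto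
    then have "Q \<noteq> q (Suc N)" using qinj by (auto dest: injD)
    then show "is_ideal Q \<and> \<not> Q \<subseteq> q (Suc N)" using k qi qmax[of k "Suc N"] by blast
  qed (use q that in auto)
  define g where "g = (\<lambda>t. b *s f (Suc N) t)"
  have g: "family xs (q (Suc N)) g" unfolding g_def by (rule family_scale[OF f(1)])
  have gZ: "\<forall>\<^sub>F t in sequentially. z t (False # T) *s g t = 0" if z: "z \<in> cocycles d p" for z
  proof -
    have "(b * z t (False # T)) *s f k t = 0" if "k \<le> N" for k t
    proof -
      have "b \<in> ann (f k)" using b(2) \<open>k \<le> N\<close> f(2) by auto
      then have "z t (False # T) *s (b *s f k t) = 0" by (simp add: ann_def)
      then show ?thesis by (simp add: mult.commute)
    qed
    then have "(\<lambda>t l. b * z t l) \<in> U N" unfolding U_def using cochains.subspace_scale[OF Zs z] by simp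
    then have "(\<lambda>t l. b * z t l) \<in> U (Suc N)" using N[of "Suc N"] by simp
    then have "\<forall>\<^sub>F t in sequentially. (b * z t (False # T)) *s f (Suc N) t = 0" unfolding U_def by blast
    then show ?thesis by eventually_elim (simp add: g_def mult.commute)
  qed
  \<comment> \<open>A class r/y^t0 of H killed by a power of x is the image of a cocycle for x # xs,
    so g vanishes on it.\<close>
  have key: "r *s g t0 = 0" if r: "x ^ M * r \<in> adjoin p (map (\<lambda>z. z ^ t0) xs)" for r M t0
  proof -
    obtain v where v: "koszul (map (\<lambda>z. z ^ t0) xs) v T - x ^ M * r \<in> p"
      using koszul_top_surj[OF pi r] d by (auto simp: T_def)
    \<comment> \<open>The coefficients on cells containing x come from the primitive v of x^M r.
      Scaled by x^(t-M), their differential cancels x^t times the coefficient on the cell omitting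
      x. Truncated differences are harmless, as only t \<ge> t1 counts.\<close>
    define z where "z = (\<lambda>t l. case l of [] \<Rightarrow> 0 |
       b # k \<Rightarrow> if b then x ^ (t - M) * (weight xs k ^ (t - t0) * v k) else y ^ (t - t0) * r)"
    define t1 where "t1 = max t0 M"
    have wT: "weight xs T = y" using weight_True[of xs] d by (simp add: T_def y_def)
    have cl: "closed t d p (z t)" if t: "t1 \<le> t" for t
      unfolding closed_def
    proof
      fix l assume "l \<in> cells (length (x # xs)) (Suc d)"
      then have l: "l = True # T"
        using count_True_full[of l "Suc d"] d by (simp add: cells_def T_def)
      have e: "t = t0 + (t - t0)" "t = (t - M) + M" using t by (auto simp: t1_def)
      have kw: "koszul (map (\<lambda>z. z ^ t) xs) (\<lambda>k. weight xs k ^ (t - t0) * v k) T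
          = y ^ (t - t0) * koszul (map (\<lambda>z. z ^ t0) xs) v T"
        using koszul_weight[of t0 "t - t0" xs v T] e(1) wT by simp
      have xt: "x ^ t = x ^ (t - M) * x ^ M" using e(2) by (metis power_add)
      have "koszul (pows t) (z t) l = x ^ t * (y ^ (t - t0) * r) -
          koszul (map (\<lambda>z. z ^ t) xs) (\<lambda>k. x ^ (t - M) * (weight xs k ^ (t - t0) * v k)) T"
        by (simp add: l z_def pows_def)
      also have "\<dots> = x ^ (t - M) * x ^ M * (y ^ (t - t0) * r) -
          x ^ (t - M) * (y ^ (t - t0) * koszul (map (\<lambda>z. z ^ t0) xs) v T)"
        by (simp only: koszul_scale kw xt)
      also have "\<dots> = - (x ^ (t - M) * y ^ (t - t0)) * (koszul (map (\<lambda>z. z ^ t0) xs) v T - x ^ M * r)"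
        by (simp add: algebra_simps)
      finally have "koszul (pows t) (z t) l
          = - (x ^ (t - M) * y ^ (t - t0)) * (koszul (map (\<lambda>z. z ^ t0) xs) v T - x ^ M * r)" .
      then show "koszul (pows t) (z t) l \<in> p" by (simp only:) (rule is_idealD(3)[OF pi v])
    qed
    have ex: "exact (Suc t) d p (\<lambda>l. z (Suc t) l - weight (x # xs) l * z t l)" if t: "t1 \<le> t" for t
    proof (rule exact_in)
      fix l assume l: "l \<in> cells (length (x # xs)) d"
      then obtain c k where ck: "l = c # k" by (cases l) (auto simp: cells_def)
      have s: "Suc t - M = Suc (t - M)" "Suc t - t0 = Suc (t - t0)" using t by (auto simp: t1_def)
      have "z (Suc t) l - weight (x # xs) l * z t l = 0"
      proof (cases c)
        case True
        then show ?thesis using ck s by (simp add: z_def mult_ac)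
      next
        case False
        then have "k = T" using count_True_full[of k d] l ck d by (simp add: cells_def T_def)
        then show ?thesis using ck False s wT by (simp add: z_def mult_ac)
      qed
      then show "z (Suc t) l - weight (x # xs) l * z t l \<in> p" using is_idealD(1)[OF pi] by simp
    qed
    have "z \<in> cocycles d p" unfolding cocycles_def eventually_sequentially using cl ex by blast
    then have "\<forall>\<^sub>F t in sequentially. z t (False # T) *s g t = 0" by (rule gZ)
    then obtain t2 where t2: "\<And>t. t2 \<le> t \<Longrightarrow> z t (False # T) *s g t = 0"
      unfolding eventually_sequentially by blast
    have "(y ^ t2 * r) *s g (t0 + t2) = 0" using t2[of "t0 + t2"] by (simp add: z_def)
    then have "r *s (y ^ t2 *s g (t0 + t2)) = 0" by (simp add: mult.commute)
    then show ?thesis using family_prod_power[OF g] by (simp add: y_def)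
  qed
  have "g n = 0" for n
  proof -
    let ?A = "adjoin (q (Suc N)) (map (\<lambda>z. z ^ n) xs)"
    have Ai: "is_ideal ?A" by (rule adjoin_ideal[OF qi])
    obtain k where k: "x ^ k \<in> ?A"
    proof (rule m_primary_power[OF q(4) Ai adjoin_sup])
      show "z ^ n \<in> ?A" if "z \<in> set xs" for z
        using adjoin_set[OF qi, of "map (\<lambda>z. z ^ n) xs"] that by auto
      show "x \<in> m" using xm by simp
    qed (use that in blast)
    \<comment> \<open>The summand k puts x^K into ?A; the summand n allows g n to be recovered from
      g K by multiplying with y^k.\<close>
    define K where "K = k + n"
    have xK: "x ^ K \<in> ?A" unfolding K_def power_add using is_idealD(4)[OF Ai k] .
    obtain s where "(x * y) ^ s \<in> adjoin p (map (\<lambda>z. z ^ (K + s)) (x # xs))"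
      using van[of K] by (auto simp: y_def)
    then obtain i r where i: "i \<in> adjoin p (map (\<lambda>z. z ^ (K + s)) xs)" "(x * y) ^ s = i + r * x ^ (K + s)"
      unfolding list.map adjoin.simps by blast
    let ?I = "adjoin p (map (\<lambda>z. z ^ (K + s)) xs)"
    have Ii: "is_ideal ?I" by (rule adjoin_ideal[OF pi])
    \<comment> \<open>The assumed vanishing makes (y^s - r x^K)/y^(K+s) a class of H killed by x^s.
      So g takes the same value on 1/y^K and on the multiple r x^K/y^(K+s).\<close>
    have "x ^ s * (y ^ s - r * x ^ K) = i"
      using i(2) by (simp add: power_mult_distrib power_add algebra_simps)
    then have "(y ^ s - r * x ^ K) *s g (K + s) = 0" using key[of s] i(1) by metis
    then have ys: "y ^ s *s g (K + s) = (r * x ^ K) *s g (K + s)" by (simp add: scale_left_diff_distrib)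
    define w where "w = y ^ k * r"
    have "g n = y ^ (k + s) *s g (n + (k + s))" using family_prod_power[OF g, of "k + s" n] by (simp add: y_def)
    also have "\<dots> = y ^ k *s (y ^ s *s g (K + s))" by (simp add: power_add K_def add_ac)
    also have "\<dots> = x ^ K *s (w *s g (K + s))" by (simp add: ys w_def mult_ac)
    finally have gn: "g n = x ^ K *s (w *s g (K + s))" .
    \<comment> \<open>After multiplication by z^n the class w/y^(K+s) becomes x-torsion, so
      \<open>key\<close> applies again. Thus all of ?A kills w g(K+s), including x^K, and g n = 0
      follows.\<close>
    have zw: "z ^ n *s (w *s g (K + s)) = 0" if z: "z \<in> set xs" for z
    proof -
      have "z dvd y" unfolding y_def using z by (rule prod_list_dvd)
      then have "z ^ (k + s) dvd y ^ (k + s)" by (rule dvd_power_same)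
      then obtain c where c: "y ^ (k + s) = z ^ (k + s) * c" by (elim dvdE)
      have "x ^ (K + s) * (z ^ n * w) = (z ^ n * y ^ k) * (r * x ^ (K + s))" by (simp add: w_def mult_ac)
      also have "\<dots> = (z ^ n * y ^ k) * ((x * y) ^ s - i)" using i(2) by simp
      also have "\<dots> = x ^ s * (z ^ n * y ^ (k + s)) - (z ^ n * y ^ k) * i"
        by (simp add: power_mult_distrib power_add algebra_simps)
      also have "\<dots> = (x ^ s * c) * z ^ (K + s) - (z ^ n * y ^ k) * i"
        by (simp only: c) (simp add: K_def power_add mult_ac)
      also have "\<dots> \<in> ?I"
        using adjoin_set[OF pi, of "map (\<lambda>z. z ^ (K + s)) xs"] z i(1)
        by (intro is_idealD(6)[OF Ii] is_idealD(3)[OF Ii]) auto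
      finally have "(z ^ n * w) *s g (K + s) = 0" by (rule key)
      then show ?thesis by simp
    qed
    have "?A \<subseteq> {a. \<forall>v\<in>{w *s g (K + s)}. a *s v = 0}"
    proof (rule adjoin_least[OF annihilator_ideal])
      have "a *s (w *s g (K + s)) = 0" if "a \<in> q (Suc N)" for a
        using familyD(2)[OF g that, of "K + s"] by (metis scale_left_commute scale_zero_right)
      then show "q (Suc N) \<subseteq> {a. \<forall>v\<in>{w *s g (K + s)}. a *s v = 0}" by auto
    qed (use zw in auto)
    then show "g n = 0" using xK gn by auto
  qed
  then have "b \<in> ann (f (Suc N))" by (simp add: g_def ann_def)
  then show False using b(1) f(2) by simp
qed

text \<open>Since the injective hull is Artinian, the inverse system of the submodules \<open>E t\<close> killed by \<open>p\<close> and
  the powers \<open>zs\<^sup>t\<close> has a nonzero limit as soon as the stable images are nonzero.\<close>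

lemma family_exists:
  assumes p: "is_ideal p" and n: "\<And>s. prod_list zs ^ s \<notin> adjoin p (map (\<lambda>z. z ^ (n + s)) zs)"
  shows "\<exists>e. family zs p e \<and> 1 \<notin> ann e"
proof -
  define y where "y = prod_list zs"
  define E where "E = (\<lambda>t. {v. (\<forall>a\<in>p. a *s v = 0) \<and> (\<forall>z\<in>set zs. z ^ t *s v = 0)})"
  \<comment> \<open>The image of E (t + s) in E t; for fixed t these images decrease and stabilise
    from s = st t on.\<close>
  define S where "S = (\<lambda>t s. {y ^ s *s v | v. v \<in> E (t + s)})"
  have Es: "subspace (E t)" for t unfolding E_def
    by (rule subspaceI) (auto simp: scale_right_distrib scale_left_commute simp del: scale_scale)
  have yE: "y *s v \<in> E t" if v: "v \<in> E (Suc t)" for v t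
  proof -
    have "a *s (y *s v) = 0" if "a \<in> p" for a
    proof -
      have "y *s (a *s v) = 0" using v \<open>a \<in> p\<close> by (simp add: E_def del: scale_scale)
      then show ?thesis by (subst scale_left_commute)
    qed
    moreover have "z ^ t *s (y *s v) = 0" if z: "z \<in> set zs" for z
    proof -
      obtain c where "y = z * c" using prod_list_dvd[OF z] unfolding y_def by (elim dvdE)
      then have "z ^ t *s (y *s v) = c *s (z ^ Suc t *s v)" by (simp add: mult_ac)
      moreover have "z ^ Suc t *s v = 0" using v z by (simp add: E_def del: power_Suc scale_scale)
      ultimately show ?thesis by (simp only: scale_zero_right)
    qed
    ultimately show ?thesis unfolding E_def by blast
  qed
  have Ss: "subspace (S t s)" for t s
  proof (rule subspaceI)
    have "0 = y ^ s *s 0" by simp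
    then show "0 \<in> S t s" unfolding S_def using subspace_0[OF Es] by blast
  next
    fix u v assume "u \<in> S t s" "v \<in> S t s"
    then obtain u' v' where *: "u = y ^ s *s u'" "v = y ^ s *s v'" "u' \<in> E (t + s)" "v' \<in> E (t + s)"
      unfolding S_def by blast
    then have "u + v = y ^ s *s (u' + v')" by (simp add: scale_right_distrib)
    then show "u + v \<in> S t s" unfolding S_def using * subspace_add[OF Es] by blast
  next
    fix c u assume "u \<in> S t s"
    then obtain u' where *: "u = y ^ s *s u'" "u' \<in> E (t + s)" unfolding S_def by blast
    then have "c *s u = y ^ s *s (c *s u')" by (simp add: mult.commute)
    then show "c *s u \<in> S t s" unfolding S_def using * subspace_scale[OF Es] by blast
  qed
  have Sdec: "S t (Suc s) \<subseteq> S t s" for t s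
  proof
    fix u assume "u \<in> S t (Suc s)"
    then obtain v where v: "u = y ^ Suc s *s v" "v \<in> E (Suc (t + s))" unfolding S_def by auto
    then have "u = y ^ s *s (y *s v)" by (simp add: mult.commute)
    then show "u \<in> S t s" unfolding S_def using yE[OF v(2)] by blast
  qed
  have Smono: "S t s' \<subseteq> S t s" if "s \<le> s'" for t s s'
    using lift_Suc_antimono_le[of "S t", OF Sdec that] .
  have "\<exists>N. \<forall>s\<ge>N. S t s = S t N" for t
  proof -
    have z: "{0} \<subseteq> S t s" "S t s \<subseteq> UNIV" for s using subspace_0[OF Ss] by auto
    obtain N where "\<And>s. N \<le> s \<Longrightarrow> S t s = S t N"
      using dccD[of _ _ "S t", OF dcc_hull Ss z Sdec] by metis
    then show ?thesis by blast
  qed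
  then obtain st where st: "\<And>t s. st t \<le> s \<Longrightarrow> S t s = S t (st t)" by metis
  have inS: "v \<in> S t s" if "v \<in> S t (st t)" for v t s
  proof (cases "st t \<le> s")
    case True
    then show ?thesis using st that by blast
  next
    case False
    then show ?thesis using Smono[of s "st t" t] that by auto
  qed
  \<comment> \<open>Mittag-Leffler argument: multiplication by y maps the stable image at t + 1 onto
    the stable image at t.\<close>
  have step: "\<exists>u. u \<in> S (Suc t) (st (Suc t)) \<and> y *s u = v" if v: "v \<in> S t (st t)" for v t
  proof -
    let ?N = "st (Suc t)"
    obtain w where w: "v = y ^ Suc ?N *s w" "w \<in> E (t + Suc ?N)"
      using inS[OF v, of "Suc ?N"] unfolding S_def by blast
    then have "y ^ ?N *s w \<in> S (Suc t) ?N" unfolding S_def by auto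
    moreover have "y *s (y ^ ?N *s w) = v" using w(1) by simp
    ultimately show ?thesis by blast
  qed
  \<comment> \<open>Non-membership in the ideal gives an element of E (n + st n) not killed by y^(st
    n), that is, a nonzero element of the stable image at n.\<close>
  obtain v where v: "\<And>a. a \<in> adjoin p (map (\<lambda>z. z ^ (n + st n)) zs) \<Longrightarrow> a *s v = 0" "y ^ st n *s v \<noteq> 0"
    using separating[OF adjoin_ideal[OF p] n[of "st n"]] unfolding y_def by metis
  have "v \<in> E (n + st n)" unfolding E_def
    using v(1) adjoin_sup[of p] adjoin_set[OF p, of "map (\<lambda>z. z ^ (n + st n)) zs"] by auto
  then have u: "y ^ st n *s v \<in> S n (st n)" unfolding S_def by blast
  have "\<exists>h. \<forall>k. (h k \<in> S (n + k) (st (n + k)) \<and> (k = 0 \<longrightarrow> h k \<noteq> 0)) \<and> y *s h (Suc k) = h k"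
  proof (rule dependent_nat_choice)
    show "\<exists>x. x \<in> S (n + 0) (st (n + 0)) \<and> (0 = (0::nat) \<longrightarrow> x \<noteq> 0)" using u v(2) by auto
    show "\<exists>u. (u \<in> S (n + Suc k) (st (n + Suc k)) \<and> (Suc k = 0 \<longrightarrow> u \<noteq> 0)) \<and> y *s u = w"
      if "w \<in> S (n + k) (st (n + k)) \<and> (k = 0 \<longrightarrow> w \<noteq> 0)" for w k
      using step[of w "n + k"] that by auto
  qed
  then obtain h where h: "\<And>k. h k \<in> S (n + k) (st (n + k))" "h 0 \<noteq> 0" "\<And>k. y *s h (Suc k) = h k" by metis
  \<comment> \<open>The sequence h starts at index n, with h t in E (n + t). Multiplying by y^n
    shifts it to start at index 0, with e n = h 0.\<close>
  define e where "e = (\<lambda>t. y ^ n *s h t)"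
  have hE: "h k \<in> E (n + k)" for k using inS[OF h(1), of k 0] unfolding S_def by auto
  have "y ^ n *s h (k + n) = h k" for k n
  proof (induction n)
    case (Suc n)
    have "y ^ Suc n *s h (k + Suc n) = y ^ n *s (y *s h (Suc (k + n)))" by (simp add: mult.commute)
    then show ?case using Suc h(3) by simp
  qed simp
  then have en: "e n = h 0" unfolding e_def by (metis add_0)
  have yE': "y ^ k *s w \<in> E t" if "w \<in> E (k + t)" for k t w
    using that
  proof (induction k arbitrary: w)
    case (Suc k)
    have "y ^ Suc k *s w = y ^ k *s (y *s w)" by (simp add: mult.commute)
    then show ?case using Suc.IH[of "y *s w"] yE[of w "k + t"] Suc.prems by simp
  qed simp
  have eE: "e t \<in> E t" for t unfolding e_def using yE'[OF hE[of t]] .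
  have "family zs p e" unfolding family_def
  proof (intro allI conjI)
    fix t
    show "\<forall>x\<in>set zs. x ^ t *s e t = 0" "\<forall>a\<in>p. a *s e t = 0" using eE[of t] by (auto simp: E_def)
    have "y *s e (Suc t) = y ^ n *s (y *s h (Suc t))" by (simp add: e_def mult.commute)
    then show "prod_list zs *s e (Suc t) = e t" by (simp only: h(3) e_def y_def[symmetric])
  qed
  moreover have "1 \<notin> ann e" using en h(2) by (auto simp: ann_def intro: exI[of _ n])
  ultimately show ?thesis by blast
qed

lemma family_multiple:
  "family xs p e \<Longrightarrow> k \<le> l \<Longrightarrow> \<exists>r. e k = r *s e l"
  using family_prod_power[of xs p e "l - k" k] by (metis le_add_diff_inverse)

text \<open>The images of the multiples of \<open>g\<close> are directed downwards, and the hull is Artinian.\<close>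

lemma divisible_multiple:
  assumes q: "prime_ideal q" and g: "family xs q g" "ann g = q"
  shows "\<exists>g'. family xs q g' \<and> ann g' = q \<and> (\<forall>a n. a \<notin> q \<longrightarrow> (\<exists>r k. g' n = (a * r) *s g' k))"
proof -
  define X where "X = (\<lambda>a. {v. \<exists>r k. v = (a * r) *s g k})"
  have Xs: "subspace (X a)" for a
  proof (rule subspaceI)
    have "0 = (a * 0) *s g 0" by simp
    then show "0 \<in> X a" unfolding X_def by blast
  next
    fix u v assume "u \<in> X a" "v \<in> X a"
    then obtain r k s l where *: "u = (a * r) *s g k" "v = (a * s) *s g l" unfolding X_def by blast
    obtain r' s' where "g k = r' *s g (max k l)" "g l = s' *s g (max k l)"
      using family_multiple[OF g(1)] by (metis max.cobounded1 max.cobounded2)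
    then have "u + v = (a * (r * r' + s * s')) *s g (max k l)"
      using * by (simp add: scale_left_distrib distrib_left mult.assoc)
    then show "u + v \<in> X a" unfolding X_def by blast
  next
    fix c u assume "u \<in> X a"
    then obtain r k where "u = (a * r) *s g k" unfolding X_def by blast
    then have "c *s u = (a * (c * r)) *s g k" by (simp add: mult_ac)
    then show "c *s u \<in> X a" unfolding X_def by blast
  qed
  have "\<exists>a. a \<notin> q \<and> (\<forall>b. b \<notin> q \<longrightarrow> X a \<subseteq> X (a * b))"
  proof (rule ccontr)
    assume no: "\<nexists>a. a \<notin> q \<and> (\<forall>b. b \<notin> q \<longrightarrow> X a \<subseteq> X (a * b))"
    have "\<exists>a. \<forall>n. a n \<notin> q \<and> (X (a (Suc n)) \<subseteq> X (a n) \<and> \<not> X (a n) \<subseteq> X (a (Suc n)))"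
    proof (rule dependent_nat_choice)
      show "\<exists>a. a \<notin> q" using prime_idealD(2)[OF q] by blast
      show "\<exists>c. c \<notin> q \<and> (X c \<subseteq> X a \<and> \<not> X a \<subseteq> X c)" if a: "a \<notin> q" for a and n :: nat
      proof -
        obtain b where b: "b \<notin> q" "\<not> X a \<subseteq> X (a * b)" using no a by blast
        have "a * b \<notin> q" using prime_idealD(3)[OF q] a b(1) by blast
        moreover have "X (a * b) \<subseteq> X a" unfolding X_def by (auto simp: mult.assoc)
        ultimately show ?thesis using b(2) by blast
      qed
    qed
    then obtain a where a: "\<And>n. X (a (Suc n)) \<subseteq> X (a n)" "\<And>n. \<not> X (a n) \<subseteq> X (a (Suc n))" by metis
    have z: "{0} \<subseteq> X (a n)" "X (a n) \<subseteq> UNIV" for n using subspace_0[OF Xs] by auto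
    obtain N where N: "\<And>n. N \<le> n \<Longrightarrow> X (a n) = X (a N)"
      using dccD[of _ _ "\<lambda>n. X (a n)", OF dcc_hull Xs z a(1)] by metis
    have "X (a (Suc N)) = X (a N)" by (rule N) simp
    then show False using a(2) by blast
  qed
  then obtain a where a: "a \<notin> q" "\<And>b. b \<notin> q \<Longrightarrow> X a \<subseteq> X (a * b)" by blast
  define g' where "g' = (\<lambda>n. a *s g n)"
  have "ann g' = q"
    unfolding g'_def ann_scale g(2) colon_def
    using prime_idealD(3)[OF q] a(1) is_idealD(4)[OF prime_idealD(1)[OF q]] by blast
  moreover have "\<exists>r k. g' n = (b * r) *s g' k" if b: "b \<notin> q" for b n
  proof -
    have "g' n = (a * 1) *s g n" by (simp add: g'_def)
    then have "g' n \<in> X a" unfolding X_def by blast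
    then have "g' n \<in> X (a * b)" using a(2)[OF b] by blast
    then obtain r k where "g' n = (a * b * r) *s g k" unfolding X_def by blast
    then have "g' n = (b * r) *s g' k" by (simp add: g'_def mult_ac)
    then show ?thesis by blast
  qed
  moreover have "family xs q g'" unfolding g'_def by (rule family_scale[OF g(1)])
  ultimately show ?thesis by blast
qed

lemma family_sum:
  assumes "\<And>k. k \<in> A \<Longrightarrow> family xs p (F k)"
  shows "family xs p (\<lambda>n. \<Sum>k\<in>A. F k n)"
  unfolding family_def
proof (intro allI conjI ballI)
  fix n x assume "x \<in> set xs"
  then show "x ^ n *s (\<Sum>k\<in>A. F k n) = 0"
    using familyD(1)[OF assms] by (simp add: scale_sum_right)
next
  fix n a assume "a \<in> p"
  then show "a *s (\<Sum>k\<in>A. F k n) = 0"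
    using familyD(2)[OF assms] by (simp add: scale_sum_right)
next
  fix n
  show "prod_list xs *s (\<Sum>k\<in>A. F k (Suc n)) = (\<Sum>k\<in>A. F k n)"
    using familyD(3)[OF assms] by (simp add: scale_sum_right)
qed

text \<open>The family is an infinite sum of multiples \<open>c k \<cdot> g k\<close>, where \<open>c k\<close> kills \<open>g k\<close> on so large a part that
  all \<open>g i j\<close> remain multiples of values of the sum.\<close>

lemma combine_families:
  fixes q :: "nat \<Rightarrow> 'a set" and g :: "nat \<Rightarrow> nat \<Rightarrow> 'e"
  assumes xm: "set xs \<subseteq> m"
    and q: "\<And>k. prime_ideal (q k)" "\<And>k. q k \<noteq> m" "\<And>i j. q i \<subseteq> q j \<Longrightarrow> i = j"
    and p: "\<And>k. p \<subseteq> q k" "\<And>a. (\<And>k. a \<in> q k) \<Longrightarrow> a \<in> p"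
    and g: "\<And>k. family xs (q k) (g k)" "\<And>k. ann (g k) = q k"
      "\<And>k a n. a \<notin> q k \<Longrightarrow> \<exists>r l. g k n = (a * r) *s g k l"
  shows "\<exists>f. family xs p f \<and> ann f = p"
proof -
  have qi: "is_ideal (q k)" for k using q(1) by (rule prime_idealD)
  have gp: "family xs p (g k)" for k using g(1)[of k] p(1)[of k] unfolding family_def by blast
  define F where "F = (\<lambda>N c t. \<Sum>k<N. c k *s g k t)"
  have Ff: "family xs p (F N c)" for N and c :: "nat \<Rightarrow> 'a"
    unfolding F_def by (intro family_sum family_scale gp)
  define P where "P = (\<lambda>N (s :: nat \<times> (nat \<Rightarrow> 'e)). \<exists>c. (\<forall>k<N. c k \<notin> q k) \<and> snd s = F N c)"
  \<comment> \<open>A stage is a partial sum with an index up to which its values are final. The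
    next stage keeps these values, and each g k j with k, j \<le> N becomes a multiple of its value
    at the new index.\<close>
  define Q where "Q = (\<lambda>N (s :: nat \<times> (nat \<Rightarrow> 'e)) s'. fst s < fst s' \<and> (\<forall>t\<le>fst s. snd s' t = snd s t) \<and>
     (\<forall>k\<in>{..N}. \<forall>j\<in>{..N}. \<exists>r. g k j = r *s snd s' (fst s')))"
  have "\<exists>h. \<forall>N. P N (h N) \<and> Q N (h N) (h (Suc N))"
  proof (rule dependent_nat_choice)
    have "snd (0 :: nat, F 0 (\<lambda>_. 0)) = F 0 (\<lambda>_. 0)" by simp
    then show "\<exists>s. P 0 s" unfolding P_def by blast
  next
    fix s N assume "P N s"
    then obtain c where c: "\<And>k. k < N \<Longrightarrow> c k \<notin> q k" "snd s = F N c" unfolding P_def by blast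
    define T where "T = fst s"
    obtain x where x: "x \<in> m" "x \<notin> q N" using q(2)[of N] prime_subset[OF q(1)[of N]] by blast
    \<comment> \<open>Killing g N T suffices for all t \<le> T, since the earlier values are
      multiples of it. As x lies outside q N, so does the coefficient x^n.\<close>
    obtain n where n: "x ^ n *s g N T = 0" using m_torsion[OF x(1)] by blast
    define c' where "c' = c(N := x ^ n)"
    have c': "c' k \<notin> q k" if "k \<le> N" for k
      using that c(1)[of k] x(2) prime_ideal_power[OF q(1)] by (auto simp: c'_def)
    have F': "F (Suc N) c' t = F N c t + x ^ n *s g N t" for t by (simp add: F_def c'_def)
    have FT: "F (Suc N) c' t = F N c t" if "t \<le> T" for t
    proof -
      obtain r where "g N t = r *s g N T" using family_multiple[OF g(1) \<open>t \<le> T\<close>] by blast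
      then have "x ^ n *s g N t = r *s (x ^ n *s g N T)" by (simp add: mult.commute)
      then show ?thesis using F' n by simp
    qed
    have ev: "\<forall>\<^sub>F t in sequentially. \<exists>r. g k j = r *s F (Suc N) c' t" if k: "k \<le> N" for k j
    proof -
      \<comment> \<open>Multiplication by b isolates the k-th summand. The divisibility of g k then
        expresses each g k j through b c' k g k at a later index, and so through the sum.\<close>
      obtain b where b: "b \<notin> q k" "\<And>Q. Q \<in> q ` ({..N} - {k}) \<Longrightarrow> b \<in> Q"
      proof (rule prime_contains_Inter[of "q ` ({..N} - {k})" "q k"])
        show "is_ideal Q \<and> \<not> Q \<subseteq> q k" if "Q \<in> q ` ({..N} - {k})" for Q
          using that qi q(3) by blast
      qed (use q(1) that in auto)
      have bF: "b *s F (Suc N) c' t = (b * c' k) *s g k t" for t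
      proof -
        have "b *s F (Suc N) c' t = (\<Sum>i<Suc N. b *s (c' i *s g i t))" unfolding F_def by (rule scale_sum_right)
        also have "\<dots> = (\<Sum>i<Suc N. if i = k then (b * c' k) *s g k t else 0)"
        proof (rule sum.cong[OF refl])
          fix i assume i: "i \<in> {..<Suc N}"
          show "b *s (c' i *s g i t) = (if i = k then (b * c' k) *s g k t else 0)"
          proof (cases "i = k")
            case False
            then have "b \<in> ann (g i)" using b(2) i g(2) by auto
            then have "c' i *s (b *s g i t) = 0" by (simp add: ann_def)
            then show ?thesis using False by (metis scale_left_commute)
          qed simp
        qed
        also have "\<dots> = (b * c' k) *s g k t" using k by (simp add: sum.delta)
        finally show ?thesis .
      qed
      have "b * c' k \<notin> q k" using prime_idealD(3)[OF q(1)] b(1) c'[OF k] by blast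
      then obtain r l where "g k j = (b * c' k * r) *s g k l" using g(3) by blast
      then have "g k j = r *s ((b * c' k) *s g k l)" by (simp add: mult.commute)
      then have l: "g k j = (r * b) *s F (Suc N) c' l" using bF[of l] by (metis scale_scale)
      have "\<exists>r. g k j = r *s F (Suc N) c' t" if "l \<le> t" for t
      proof -
        obtain u where "F (Suc N) c' l = u *s F (Suc N) c' t" using family_multiple[OF Ff \<open>l \<le> t\<close>] by blast
        then have "g k j = (r * b * u) *s F (Suc N) c' t" using l by simp
        then show ?thesis by blast
      qed
      then show ?thesis unfolding eventually_sequentially by blast
    qed
    have "\<forall>\<^sub>F t in sequentially. \<forall>k\<in>{..N}. \<forall>j\<in>{..N}. \<exists>r. g k j = r *s F (Suc N) c' t"
      by (intro eventually_ball_finite ballI finite_atMost) (use ev in auto)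
    then have "\<forall>\<^sub>F t in sequentially. T < t \<and> (\<forall>k\<in>{..N}. \<forall>j\<in>{..N}. \<exists>r. g k j = r *s F (Suc N) c' t)"
      by (intro eventually_conj eventually_gt_at_top)
    then obtain T' where T': "T < T'" "\<forall>k\<in>{..N}. \<forall>j\<in>{..N}. \<exists>r. g k j = r *s F (Suc N) c' T'"
      unfolding eventually_sequentially by blast
    have "P (Suc N) (T', F (Suc N) c')" unfolding P_def using c' by (auto simp: less_Suc_eq_le)
    moreover have "Q N s (T', F (Suc N) c')" unfolding Q_def using T' FT c(2) by (simp add: T_def)
    ultimately show "\<exists>s'. P (Suc N) s' \<and> Q N s s'" by blast
  qed
  then obtain h where h: "\<And>N. P N (h N)" "\<And>N. Q N (h N) (h (Suc N))" by blast
  define T where "T = (\<lambda>N. fst (h N))"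
  define G where "G = (\<lambda>N. snd (h N))"
  have G: "family xs p (G N)" for N
    using h(1)[of N] Ff unfolding P_def G_def by auto
  have TS: "T N < T (Suc N)" and GS: "\<And>t. t \<le> T N \<Longrightarrow> G (Suc N) t = G N t" for N
    using h(2)[of N] by (auto simp: Q_def T_def G_def)
  have mult: "\<exists>r. g k j = r *s G (Suc N) (T (Suc N))" if "k \<le> N" "j \<le> N" for k j N
    using h(2)[of N] that unfolding Q_def T_def G_def by auto
  have Tge: "N \<le> T N" for N
  proof (induction N)
    case (Suc N)
    then show ?case using TS[of N] by simp
  qed simp
  have Tmono: "T M \<le> T N" if "M \<le> N" for M N
    using lift_Suc_mono_le[of T, OF less_imp_le[OF TS] that] .
  have Geq: "G (M + k) t = G M t" if t: "t \<le> T M" for M k t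
  proof (induction k)
    case (Suc k)
    have "t \<le> T (M + k)" using t Tmono[of M "M + k"] by simp
    then show ?case using Suc GS by simp
  qed simp
  \<comment> \<open>The diagonal is the limit of the partial sums: T t \<ge> t makes the value of G
    t at t final.\<close>
  define f where "f = (\<lambda>t. G t t)"
  have fG: "f t = G M t" if "t \<le> T M" for M t
  proof (cases "M \<le> t")
    case True
    then show ?thesis using Geq[OF that, of "t - M"] by (simp add: f_def)
  next
    case False
    then show ?thesis using Geq[OF Tge, of t "M - t"] by (simp add: f_def)
  qed
  have "family xs p f" unfolding family_def
  proof (intro allI conjI ballI)
    fix n
    show "x ^ n *s f n = 0" if "x \<in> set xs" for x using familyD(1)[OF G that] by (simp add: f_def)
    show "a *s f n = 0" if "a \<in> p" for a using familyD(2)[OF G that] by (simp add: f_def)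
    have "f n = G (Suc n) n" "f (Suc n) = G (Suc n) (Suc n)" using fG Tge Suc_leD by metis+
    then show "prod_list xs *s f (Suc n) = f n" using familyD(3)[OF G] by simp
  qed
  moreover have "ann f \<subseteq> p"
  proof
    fix a assume a: "a \<in> ann f"
    show "a \<in> p"
    proof (rule p(2))
      fix k
      have "a *s g k j = 0" for j
      proof -
        let ?N = "Suc (max k j)"
        obtain r where "g k j = r *s G ?N (T ?N)" using mult[of k "max k j" j] by auto
        then have "g k j = r *s f (T ?N)" using fG[of "T ?N" ?N] by simp
        then have "a *s g k j = r *s (a *s f (T ?N))" by (simp add: mult.commute)
        moreover have "a *s f (T ?N) = 0" using a by (simp add: ann_def)
        ultimately show ?thesis by (simp only: scale_zero_right)
      qed
      then have "a \<in> ann (g k)" by (simp add: ann_def)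
      then show "a \<in> q k" using g(2) by simp
    qed
  qed
  ultimately show ?thesis using family_zero_ann by blast
qed

text \<open>The list ys completes xs to a system of parameters of R/p. Cutting removes one element
  of ys; once ys is empty, the top case applies the induction hypothesis to the tail of xs.\<close>

lemma family_with_annihilator:
  "prime_ideal p \<Longrightarrow> prime_chain_above p d \<Longrightarrow> \<not> prime_chain_above p (Suc d) \<Longrightarrow>
    set (xs @ ys) \<subseteq> m \<Longrightarrow> m_primary p (xs @ ys) \<Longrightarrow> length xs + length ys = d \<Longrightarrow> xs \<noteq> [] \<Longrightarrow>
    \<exists>e. family xs p e \<and> ann e = p"
proof (induction d arbitrary: p xs ys)
  case 0
  then show ?case by simp
next
  case (Suc d)
  note p = Suc.prems(1-3)
  have pi: "is_ideal p" using p(1) by (rule prime_idealD)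
  show ?case
  proof (cases ys)
    case Nil
    obtain x zs where xs: "xs = x # zs" using Suc.prems(7) by (cases xs) auto
    have len: "length zs = d" using Suc.prems(6) xs Nil by simp
    have xm: "set (x # zs) \<subseteq> m" and prim: "m_primary p (x # zs)" using Suc.prems(4,5) xs Nil by auto
    have "\<exists>n. \<forall>s. prod_list xs ^ s \<notin> adjoin p (map (\<lambda>z. z ^ (n + s)) xs)"
    proof (cases "d = 0")
      case False
      then have zs: "zs \<noteq> []" using len by auto
      show ?thesis unfolding xs
      proof (rule top_cohomology_nonzero[OF p _ len xm prim])
        show "1 \<le> d" using False by simp
        show "\<exists>e. family zs q e \<and> ann e = q"
          if "prime_ideal q" "prime_chain_above q d" "\<not> prime_chain_above q (Suc d)" "m_primary q zs" for q
          using Suc.IH[of q zs "[]"] that xm len zs by simp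
      qed
    next
      case True
      then have x: "xs = [x]" using len xs by simp
      \<comment> \<open>In dimension one the tail of xs is empty, so nonvanishing is shown directly.
        Here n = 1 works: 1 - r x is a unit, and x lies outside p.\<close>
      have "x ^ s \<notin> adjoin p [x ^ (1 + s)]" for s
      proof
        assume "x ^ s \<in> adjoin p [x ^ (1 + s)]"
        then obtain i r where i: "i \<in> p" "x ^ s = i + r * x ^ (1 + s)" by (auto simp: adjoin.simps(2))
        then have "x ^ s * (1 - r * x) = i" by (simp add: algebra_simps)
        then have "x ^ s * (1 - r * x) \<in> p" using i(1) by simp
        then consider "x ^ s \<in> p" | "1 - r * x \<in> p" using prime_idealD(3)[OF p(1)] by blast
        then show False
        proof cases
          case 1
          then have "x \<in> p" by (rule prime_ideal_power[OF p(1)])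
          then have "p = m" using prim p(1) len True unfolding m_primary_def by simp
          then obtain Q where "(m, Q) \<in> spec_less ^^ Suc d"
            using p(2) prime_chain_above_iff[OF p(1)] by blast
          then obtain B where "(m, B) \<in> spec_less" by (rule relpow_Suc_E2)
          then show False using prime_subset[of B] unfolding spec_less_def by blast
        next
          case 2
          then have "1 - r * x \<in> m" using prime_subset[OF p(1)] by blast
          moreover have "r * x \<in> m" using xm is_idealD(3)[OF m_ideal] by simp
          ultimately have "1 - r * x + r * x \<in> m" by (rule is_idealD(2)[OF m_ideal])
          then show False using m_proper by simp
        qed
      qed
      then show ?thesis using x by (intro exI[of _ 1]) simp
    qed
    then obtain e where e: "family xs p e" "1 \<notin> ann e" using family_exists[OF pi] by metis
    obtain a where a: "prime_ideal (colon (ann e) a)" using prime_colon[OF ann_ideal e(2)] by blast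
    define e' where "e' = (\<lambda>n. a *s e n)"
    have e': "family xs p e'" "prime_ideal (ann e')"
      unfolding e'_def ann_scale using family_scale[OF e(1)] a by blast+
    have "prime_chain_above (ann e') (Suc d)"
      using prime_chain_above_ann[OF e'] xs len by simp
    then have "\<not> p \<subset> ann e'" using prime_chain_above_Suc[OF p(1) e'(2)] p(3) by blast
    then have "ann e' = p" using family_zero_ann[OF e'(1)] by blast
    then show ?thesis using e'(1) by blast
  next
    case (Cons z zs)
    have d: "1 \<le> d" "length xs + length zs = d" using Suc.prems(6,7) Cons by (cases xs; simp)+
    have zm: "z \<in> m" "set (xs @ zs) \<subseteq> m" using Suc.prems(4) Cons by auto
    have prim: "m_primary p (z # (xs @ zs))"
      using Suc.prems(5) Cons unfolding m_primary_def by auto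
    define S where "S = {q. prime_ideal q \<and> p \<subset> q \<and> prime_chain_above q d \<and> m_primary q (xs @ zs)}"
    have "infinite S" unfolding S_def by (rule infinitely_many_cuts[OF p(1,2) d(1) prim zm(1)])
    then obtain q :: "nat \<Rightarrow> 'a set" where qinj: "inj q" and qS: "range q \<subseteq> S"
      using infinite_countable_subset by blast
    have q: "prime_ideal (q k)" "p \<subset> q k" "prime_chain_above (q k) d" "m_primary (q k) (xs @ zs)" for k
      using qS unfolding S_def by blast+
    have qi: "is_ideal (q k)" for k using q(1) by (rule prime_idealD)
    have coheight: "\<not> P \<subset> q k" if P: "prime_ideal P" "p \<subset> P" for P k
    proof
      assume "P \<subset> q k"
      then have "prime_chain_above P (Suc d)" using prime_chain_above_Suc[OF P(1) q(1) _ q(3)] by blast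
      then show False using prime_chain_above_Suc[OF p(1) P] p(3) by blast
    qed
    have qnot: "\<not> prime_chain_above (q k) (Suc d)" for k
      using prime_chain_above_Suc[OF p(1) q(1,2)] p(3) by blast
    have "\<exists>g. family xs (q k) g \<and> ann g = q k \<and> (\<forall>a n. a \<notin> q k \<longrightarrow> (\<exists>r l. g n = (a * r) *s g l))" for k
    proof -
      obtain g where "family xs (q k) g" "ann g = q k"
        using Suc.IH[OF q(1,3) qnot zm(2) q(4) d(2) Suc.prems(7)] by blast
      then show ?thesis by (rule divisible_multiple[OF q(1)])
    qed
    then obtain g where g: "\<And>k. family xs (q k) (g k)" "\<And>k. ann (g k) = q k"
      "\<And>k a n. a \<notin> q k \<Longrightarrow> \<exists>r l. g k n = (a * r) *s g k l" by metis
    show ?thesis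
    proof (rule combine_families[OF _ q(1) _ _ _ _ g(1,2)])
      show "set xs \<subseteq> m" using zm(2) by simp
      show "q k \<noteq> m" for k
      proof
        assume "q k = m"
        then obtain Q where "(m, Q) \<in> spec_less ^^ Suc (d - 1)"
          using q(3)[of k] prime_chain_above_iff[OF q(1), of k d] d(1) by auto
        then obtain B where "(m, B) \<in> spec_less" by (rule relpow_Suc_E2)
        then show False using prime_subset[of B] unfolding spec_less_def by blast
      qed
      show "i = j" if "q i \<subseteq> q j" for i j
        using coheight[OF q(1,2), of i j] that qinj by (auto dest: injD)
      show "p \<subseteq> q k" for k using q(2) by blast
      show "\<exists>r l. g k n = (a * r) *s g k l" if "a \<notin> q k" for k a n using g(3) that .
      \<comment> \<open>No prime lies strictly between p and q k. If a outside p lay in all q k,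
        each q k would be minimal over p + (a), which leaves only finitely many
        possibilities.\<close>
      show "a \<in> p" if a: "\<And>k. a \<in> q k" for a
      proof (rule ccontr)
        assume ap: "a \<notin> p"
        obtain F where F: "finite F" "\<And>P. P \<in> F \<Longrightarrow> prime_ideal P \<and> adjoin p [a] \<subseteq> P"
          "\<And>Q. prime_ideal Q \<Longrightarrow> adjoin p [a] \<subseteq> Q \<Longrightarrow> \<exists>P\<in>F. P \<subseteq> Q"
          using finite_primes_below[OF adjoin_ideal[OF pi], of "[a]"] by metis
        have "q k \<in> F" for k
        proof -
          have "adjoin p [a] \<subseteq> q k" using a q(2)[of k] by (intro adjoin_least qi) auto
          then obtain P where P: "P \<in> F" "P \<subseteq> q k" using F(3)[OF q(1)] by blast
          have "a \<in> P" "p \<subseteq> P" using F(2)[OF P(1)] adjoin_set[OF pi, of "[a]"] adjoin_sup[of p "[a]"] by auto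
          then have "p \<subset> P" using ap by blast
          then have "P = q k" using coheight[of P k] F(2)[OF P(1)] P(2) by blast
          then show ?thesis using P(1) by simp
        qed
        then have "range q \<subseteq> F" by blast
        then have "finite (range q)" using F(1) finite_subset by blast
        then show False using finite_imageD[OF _ qinj] infinite_UNIV_nat by blast
      qed
    qed
  qed
qed

section \<open>From families to homomorphisms on local cohomology\<close>

lemma lc_hom_family:
  assumes e: "family xs p e"
  shows "lc_hom scale xs (\<lambda>r n. r *s e n)"
proof -
  define y where "y = prod_list xs"
  have ye: "y ^ k *s e (n + k) = e n" for n k using family_prod_power[OF e] by (simp add: y_def)
  have pad: "(r * y ^ k) *s e (n + k) = r *s e n" for r n k
    using ye[of k n] by (metis scale_scale)
  \<comment> \<open>Vanishing of z/y^N gives y^(k+t) z = y^(k+N) \<sigma>, where \<sigma> is a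
    combination of t-th powers of \<open>xs\<close> and so kills e t. Padding both fractions to one
    denominator transfers this to z.\<close>
  have zero: "z *s e N = 0" if z: "cech_top_zero xs {0} z N" for z N
  proof -
    obtain t k a where tka: "y ^ k * (y ^ t * z - y ^ N * (\<Sum>j<length xs. a j * (xs ! j) ^ t)) = 0"
      using z unfolding cech_top_zero_def Let_def y_def by auto
    define \<sigma> where "\<sigma> = (\<Sum>j<length xs. a j * (xs ! j) ^ t)"
    have "\<sigma> *s e t = 0"
      using familyD(1)[OF e] by (simp add: \<sigma>_def scale_sum_left scale_scale[symmetric] del: scale_scale)
    have "z *s e N = (z * y ^ (k + t)) *s e (N + (k + t))" by (simp only: pad)
    also have "z * y ^ (k + t) = \<sigma> * y ^ (k + N)"
      using tka by (simp add: \<sigma>_def power_add algebra_simps)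
    also have "N + (k + t) = t + (k + N)" by simp
    also have "(\<sigma> * y ^ (k + N)) *s e (t + (k + N)) = \<sigma> *s e t" by (rule pad)
    finally show ?thesis using \<open>\<sigma> *s e t = 0\<close> by simp
  qed
  have "r *s e n = s *s e k" if eq: "lc_eq xs r n s k" for r n s k
  proof -
    have "(r * y ^ k - s * y ^ n) *s e (n + k) = 0"
      using zero eq unfolding lc_eq_def Let_def y_def by blast
    then show ?thesis using pad[of r k n] pad[of s n k] by (simp add: scale_left_diff_distrib add.commute)
  qed
  moreover have "r *s e n + s *s e k = (r * y ^ k + s * y ^ n) *s e (n + k)" for r n s k
    using pad[of r k n] pad[of s n k] by (simp add: scale_left_distrib add.commute)
  ultimately show ?thesis unfolding lc_hom_def Let_def y_def by simp
qed

text \<open>If \<open>H\<^sup>i(R/p) = 0\<close>, then \<open>H = p H\<close> for \<open>H = H\<^sup>i(R)\<close>, so a homomorphism killed by \<open>p\<close> vanishes.\<close>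

lemma lc_hom_zero:
  assumes f: "lc_hom scale xs f" and p: "\<And>a r n. a \<in> p \<Longrightarrow> a *s f r n = 0"
    and van: "\<not> top_lc_nonzero xs p"
  shows "f r n = 0"
proof -
  define y where "y = prod_list xs"
  have wd: "f r n = f s k" if "lc_eq xs r n s k" for r n s k using f that unfolding lc_hom_def Let_def by blast
  have add: "f r n + f s k = f (r * y ^ k + s * y ^ n) (n + k)" for r n s k
    using f unfolding lc_hom_def Let_def y_def by blast
  have sc: "f (a * r) n = a *s f r n" for a r n using f unfolding lc_hom_def Let_def by blast
  have zero: "cech_top_zero xs {0} 0 n" for n
    unfolding cech_top_zero_def Let_def by (intro exI[of _ 0] exI[of _ 0] exI[of _ "\<lambda>_. 0"]) simp
  have pad: "f (r * y ^ j) (n + j) = f r n" for r n j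
    by (rule wd) (simp add: lc_eq_def Let_def y_def power_add mult_ac zero)
  have f0: "f 0 n = 0" for n using sc[of 0 0 n] by simp
  have add': "f (r + s) n = f r n + f s n" for r s n
    using add[of r n s n] pad[of "r + s" n n] by (simp add: distrib_right)
  have fsum: "f (\<Sum>j<k. b j) n = (\<Sum>j<k. f (b j) n)" for b :: "nat \<Rightarrow> 'a" and k n
    by (induction k) (simp_all add: f0 add')
  \<comment> \<open>The fraction a x_j^t / y^t is the image of a / y_j^t under the Cech map, hence
    zero in cohomology.\<close>
  have fx: "f (a * (xs ! j) ^ t) t = 0" if j: "j < length xs" for a j t
  proof -
    have "(\<Sum>i<length xs. (if i = j then a else 0) * (xs ! i) ^ t) = a * (xs ! j) ^ t"
      using j by (simp add: if_distrib[of "\<lambda>c. c * _"] cong: if_cong)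
    then have "y ^ 0 * (y ^ t * (a * (xs ! j) ^ t) -
        y ^ t * (\<Sum>i<length xs. (if i = j then a else 0) * (xs ! i) ^ t)) \<in> {0}" by simp
    then have "cech_top_zero xs {0} (a * (xs ! j) ^ t) t"
      unfolding cech_top_zero_def Let_def y_def
      by (intro exI[of _ t] exI[of _ "0 :: nat"] exI[of _ "\<lambda>i. if i = j then a else 0"])
    then have "lc_eq xs (a * (xs ! j) ^ t) t 0 0" by (simp add: lc_eq_def Let_def)
    then show ?thesis using wd f0 by metis
  qed
  obtain t k a where "y ^ k * (y ^ t * r - y ^ n * (\<Sum>j<length xs. a j * (xs ! j) ^ t)) \<in> p"
    using van unfolding top_lc_nonzero_def cech_top_zero_def Let_def y_def by blast
  then obtain w where w: "w \<in> p" "w = y ^ k * (y ^ t * r - y ^ n * (\<Sum>j<length xs. a j * (xs ! j) ^ t))"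
    by blast
  define \<sigma> where "\<sigma> = (\<Sum>j<length xs. a j * (xs ! j) ^ t)"
  have "f r n = f (r * y ^ (k + t)) (n + (k + t))" by (simp only: pad)
  \<comment> \<open>Vanishing modulo p presents r/y^n as a fraction with numerator w in p plus the
    Cech boundary \<sigma>/y^t. The map f kills both parts.\<close>
  also have "r * y ^ (k + t) = w + \<sigma> * y ^ (n + k)"
    by (simp add: w(2) \<sigma>_def power_add algebra_simps)
  also have "f \<dots> (n + (k + t)) = f w (n + (k + t)) + f (\<sigma> * y ^ (n + k)) (n + (k + t))" by (rule add')
  also have "f w (n + (k + t)) = 0" using sc[of w 1] p[OF w(1)] by simp
  also have "f (\<sigma> * y ^ (n + k)) (n + (k + t)) = f \<sigma> t" using pad[of \<sigma> "n + k" t] by (simp add: add_ac)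
  also have "f \<sigma> t = 0" unfolding \<sigma>_def fsum using fx by simp
  finally show ?thesis by simp
qed

lemma ass_subset: "ass_matlis_dual_lc scale xs \<subseteq> {p. prime_ideal p \<and> top_lc_nonzero xs p}"
proof
  fix p assume "p \<in> ass_matlis_dual_lc scale xs"
  then obtain f where p: "prime_ideal p" and f: "lc_hom scale xs f" "p = {a. \<forall>r n. a *s f r n = 0}"
    unfolding ass_matlis_dual_lc_def by blast
  have "top_lc_nonzero xs p"
  proof (rule ccontr)
    assume van: "\<not> top_lc_nonzero xs p"
    have pf: "a *s f r n = 0" if "a \<in> p" for a r n using that by (subst (asm) f(2)) simp
    have "f r n = 0" for r n by (rule lc_hom_zero[OF f(1) _ van]) (rule pf)
    then have "1 \<in> p" by (subst f(2)) simp
    then show False using prime_idealD(2)[OF p] by simp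
  qed
  then show "p \<in> {p. prime_ideal p \<and> top_lc_nonzero xs p}" using p by simp
qed

lemma part_of_sop_subset:
  assumes "xs \<noteq> []"
  shows "{p. prime_ideal p \<and> part_of_sop m p xs} \<subseteq> ass_matlis_dual_lc scale xs"
proof
  fix p assume "p \<in> {p. prime_ideal p \<and> part_of_sop m p xs}"
  then obtain ys where p: "prime_ideal p" and dim: "dim_quot_eq p (length xs + length ys)"
    and sm: "set (xs @ ys) \<subseteq> m" and rad: "radical {a + b | a b. a \<in> p \<and> b \<in> ideal_gen (xs @ ys)} = m"
    unfolding part_of_sop_def by blast
  have "m_primary p (xs @ ys)" unfolding m_primary_def
  proof (intro allI impI)
    fix Q assume Q: "prime_ideal Q" "p \<subseteq> Q" "set (xs @ ys) \<subseteq> Q"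
    have Qi: "is_ideal Q" using Q(1) by (rule prime_idealD)
    have "ideal_gen (xs @ ys) \<subseteq> Q"
    proof
      fix r assume "r \<in> ideal_gen (xs @ ys)"
      then obtain c where r: "r = (\<Sum>j<length (xs @ ys). c j * (xs @ ys) ! j)" unfolding ideal_gen_def by blast
      have "c j * (xs @ ys) ! j \<in> Q" if "j < length (xs @ ys)" for j
        using Q(3) nth_mem[OF that] is_idealD(3)[OF Qi] by blast
      then show "r \<in> Q" unfolding r by (intro ideal_sum[OF Qi]) simp
    qed
    then have sub: "{a + b | a b. a \<in> p \<and> b \<in> ideal_gen (xs @ ys)} \<subseteq> Q" using Q(2) is_idealD(2)[OF Qi] by blast
    have "m \<subseteq> Q"
    proof
      fix r assume "r \<in> m"
      then have "r \<in> radical {a + b | a b. a \<in> p \<and> b \<in> ideal_gen (xs @ ys)}" using rad by simp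
      then obtain k where "r ^ k \<in> Q" using sub unfolding radical_def by blast
      then show "r \<in> Q" by (rule prime_ideal_power[OF Q(1)])
    qed
    then show "Q = m" using prime_subset[OF Q(1)] by blast
  qed
  then obtain e where e: "family xs p e" "ann e = p"
    using family_with_annihilator[OF p _ _ sm _ refl assms] dim unfolding dim_quot_eq_def by blast
  have "ann e = {a. \<forall>r n. a *s (r *s e n) = 0}"
  proof (intro set_eqI iffI)
    fix a assume "a \<in> ann e"
    then have "a *s e n = 0" for n by (simp add: ann_def)
    then have "r *s (a *s e n) = 0" for r n by (simp only: scale_zero_right)
    then show "a \<in> {a. \<forall>r n. a *s (r *s e n) = 0}" by (simp add: mult.commute)
  next
    fix a assume "a \<in> {a. \<forall>r n. a *s (r *s e n) = 0}"
    then have "a *s (1 *s e n) = 0" for n by blast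
    then show "a \<in> ann e" by (simp add: ann_def)
  qed
  then show "p \<in> ass_matlis_dual_lc scale xs"
    unfolding ass_matlis_dual_lc_def e(2)
    using p lc_hom_family[OF e(1)] by (intro CollectI conjI exI[of _ "\<lambda>r n. r *s e n"])
qed

end

theorem theorem2p4:
  fixes m :: "'a::comm_ring_1 set"
    and scale :: "'a \<Rightarrow> 'm::ab_group_add \<Rightarrow> 'm"
    and xs :: "'a list"
  assumes noeth: "noetherian_ring TYPE('a)"
    and loc: "local_ring m"
    and E: "injective_hull_residue scale m"
    and i: "length xs \<ge> 1"
  shows "ass_matlis_dual_lc scale xs \<subseteq> {p. prime_ideal p \<and> top_lc_nonzero xs p} \<and>
         (contains_field TYPE('a) \<longrightarrow>
           {p. prime_ideal p \<and> part_of_sop m p xs} \<subseteq> ass_matlis_dual_lc scale xs)"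
proof -
  interpret module scale using E unfolding injective_hull_residue_def by blast
  interpret matlis "TYPE('a)" m scale
    by unfold_locales (use noeth loc E in auto)
  have "xs \<noteq> []" using i by auto
  then show ?thesis using ass_subset part_of_sop_subset by blast
qed

end
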